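(* Let $m\geq 1$ be an integer and let $\xi_{(m)}$ denote the $m$th eigenvalue (without counting multiplicity) of the first fourth-order Steklov problem. (1) Fix $A>0$. The $m$th Steklov eigenvalue $\xi_{(m)}(K;A)$ on a geodesic disk of area $A$ in the space form $M_K^2$ is a strictly increasing function of the curvature $K\in(-\infty,4\pi/A)$. (2) Fix $\rho>0$. The $m$th Steklov eigenvalue $\xi_{(m)}(K;\rho)$ on a geodesic disk of radius $\rho$ in the space form $M_K^2$ is a strictly increasing function of the curvature $K\in(-\infty,(\pi/\rho)^2)$.
   Context: For $K\in\mathbb{R}$, $M_K^2=[0,r_0)\times\mathbb{S}^{1}$ (with $\{0\}\times\mathbb{S}^1$ collapsed to a point) is the $2$-dimensional space form of constant curvature $K$, with metric $dr^2+h_K^2(r)g_{\mathbb{S}^1}$, where $h_K(r)=\frac{1}{\sqrt K}\sin(\sqrt K r)$ and $r_0=\pi/\sqrt K$ if $K>0$; $h_0(r)=r$ and $r_0=+\infty$ if $K=0$; $h_K(r)=\frac{1}{\sqrt{-K}}\sinh(\sqrt{-K}r)$ and $r_0=+\infty$ if $K<0$. Geodesic disks are closed disks $\{r\le R\}$ with $0<R<r_0$; "of area $A$" means $2\pi\int_0^R h_K(r)\,dr=A$. First fourth-order Steklov problem: on a smooth compact Riemannian manifold $M$ with boundary $\partial M$ and outward unit normal $\nu$, a real number $\xi$ is an eigenvalue if there is a nontrivial $u$ with $$\Delta^2 u=0 \text{ in } M,\qquad \frac{\partial u}{\partial\nu}=0,\quad \frac{\partial(\Delta u)}{\partial\nu}+\xi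 u=0 \text{ on } \partial M,$$ where $\Delta$ is the Laplace--Beltrami operator ($\Delta=\operatorname{div}\nabla$). The spectrum is discrete, nonnegative and unbounded; the distinct eigenvalues (without counting multiplicity) are listed in increasing order as $0=\xi_{(0)}<\xi_{(1)}<\xi_{(2)}<\cdots$. *)

theory Defs
  imports "HOL-Analysis.Analysis"
begin

section \<open>Calculus in a coordinate chart\<close>

definition partial_deriv :: "'n::finite \<Rightarrow> (real^'n \<Rightarrow> real) \<Rightarrow> real^'n \<Rightarrow> real" where
  "partial_deriv i f x = frechet_derivative f (at x) (axis i 1)"

text \<open>\<open>C^k\<close> regularity on an open set \<open>U\<close>.\<close>

primrec Ck_on :: "nat \<Rightarrow> (real^'n::finite) set \<Rightarrow> (real^'n \<Rightarrow> real) \<Rightarrow> bool" where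
  "Ck_on 0 U f \<longleftrightarrow> continuous_on U f"
| "Ck_on (Suc k) U f \<longleftrightarrow> f differentiable_on U \<and> (\<forall>i. Ck_on k U (partial_deriv i f))"

text \<open>A function on an arbitrary set \<open>M\<close> is smooth if it has a smooth extension to an open
  neighbourhood of \<open>M\<close>. Since functions are total here, \<open>u\<close> itself is taken to be such
  an extension; for a closed disk, all derivatives of \<open>u\<close> at points of the disk are
  determined by the restriction of \<open>u\<close> to the disk.\<close>

definition smooth_near :: "(real^'n::finite) set \<Rightarrow> (real^'n \<Rightarrow> real) \<Rightarrow> bool" where
  "smooth_near M u \<longleftrightarrow> (\<exists>U. open U \<and> M \<subseteq> U \<and> (\<forall>k. Ck_on k U u))"

text \<open>A Riemannian metric in a chart is given by its Gram matrix \<open>g x\<close> at each point.\<close>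

definition riem_grad ::
  "(real^'n \<Rightarrow> real^'n^'n) \<Rightarrow> (real^'n::finite \<Rightarrow> real) \<Rightarrow> real^'n \<Rightarrow> real^'n" where
  "riem_grad g u x = matrix_inv (g x) *v (\<chi> j. partial_deriv j u x)"

definition riem_div ::
  "(real^'n \<Rightarrow> real^'n^'n) \<Rightarrow> (real^'n::finite \<Rightarrow> real^'n) \<Rightarrow> real^'n \<Rightarrow> real" where
  "riem_div g X x =
     (\<Sum>i\<in>UNIV. partial_deriv i (\<lambda>y. sqrt (det (g y)) * X y $ i) x) / sqrt (det (g x))"

definition laplace_beltrami ::
  "(real^'n \<Rightarrow> real^'n^'n) \<Rightarrow> (real^'n::finite \<Rightarrow> real) \<Rightarrow> real^'n \<Rightarrow> real" where
  "laplace_beltrami g u = riem_div g (riem_grad g u)"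


section \<open>The first fourth-order Steklov problem\<close>

text \<open>\<open>M\<close> is a compact domain in the chart, \<open>frontier M\<close> its boundary and \<open>\<nu>\<close> the outward unit
  normal field (with respect to \<open>g\<close>) along the boundary. Nontriviality is required on \<open>M\<close>,
  because the values of \<open>u\<close> elsewhere are irrelevant.\<close>

definition steklov_eigenvalue ::
  "(real^'n \<Rightarrow> real^'n^'n) \<Rightarrow> (real^'n::finite) set \<Rightarrow> (real^'n \<Rightarrow> real^'n) \<Rightarrow> real \<Rightarrow> bool" where
  "steklov_eigenvalue g M \<nu> \<xi> \<longleftrightarrow>
     (\<exists>u. smooth_near M u \<and> (\<exists>x\<in>M. u x \<noteq> 0) \<and>
        (\<forall>x\<in>M. laplace_beltrami g (laplace_beltrami g u) x = 0) \<and>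
        (\<forall>x\<in>frontier M. frechet_derivative u (at x) (\<nu> x) = 0 \<and>
           frechet_derivative (laplace_beltrami g u) (at x) (\<nu> x) + \<xi> * u x = 0))"

text \<open>The element number \<open>m\<close> (starting from 0) of a set of reals listed in increasing order,
  without repetition.\<close>

definition nth_smallest :: "real set \<Rightarrow> nat \<Rightarrow> real" where
  "nth_smallest S m = (THE \<xi>. \<xi> \<in> S \<and> finite {\<eta> \<in> S. \<eta> < \<xi>} \<and> card {\<eta> \<in> S. \<eta> < \<xi>} = m)"


section \<open>Two-dimensional space forms\<close>

definition h_fun :: "real \<Rightarrow> real \<Rightarrow> real" where
  "h_fun K r =
     (if K > 0 then sin (sqrt K * r) / sqrt K
      else if K = 0 then r
      else sinh (sqrt (- K) * r) / sqrt (- K))"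

definition r_max :: "real \<Rightarrow> ereal" where
  "r_max K = (if K > 0 then ereal (pi / sqrt K) else \<infinity>)"

text \<open>The space form in geodesic normal coordinates \<open>x = r (cos \<theta>, sin \<theta>)\<close>, \<open>r < r_max K\<close>.
  These are the coordinates of \<open>[0, r_max K) \<times> S^1\<close> with \<open>{0} \<times> S^1\<close> collapsed to
  the origin, and they are smooth there. The metric \<open>dr^2 + h^2 d\<theta>^2\<close> becomes
  \<open>P + (h / r)^2 (I - P)\<close>, with \<open>P\<close> the projection onto the radial direction.\<close>

definition space_form_metric :: "real \<Rightarrow> real^2 \<Rightarrow> real^2^2" where
  "space_form_metric K x =
     (if x = 0 then mat 1
      else \<chi> i j. x $ i * x $ j / (norm x)\<^sup>2 +
             (h_fun K (norm x) / norm x)\<^sup>2 * (mat 1 $ i $ j - x $ i * x $ j / (norm x)\<^sup>2))"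

text \<open>The closed disk \<open>r \<le> R\<close> is \<open>cball 0 R\<close>, with outward unit normal \<open>\<partial>/\<partial>r\<close> on its boundary.\<close>

definition radial_field :: "real^2 \<Rightarrow> real^2" where
  "radial_field x = x /\<^sub>R norm x"

definition disk_steklov_spectrum :: "real \<Rightarrow> real \<Rightarrow> real set" where
  "disk_steklov_spectrum K R =
     {\<xi>. steklov_eigenvalue (space_form_metric K) (cball 0 R) radial_field \<xi>}"

definition steklov_xi_radius :: "nat \<Rightarrow> real \<Rightarrow> real \<Rightarrow> real" where
  "steklov_xi_radius m K \<rho> = nth_smallest (disk_steklov_spectrum K \<rho>) m"

definition radius_of_area :: "real \<Rightarrow> real \<Rightarrow> real" where
  "radius_of_area K A =
     (THE R. 0 < R \<and> ereal R < r_max K \<and> 2 * pi * integral {0..R} (h_fun K) = A)"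

definition steklov_xi_area :: "nat \<Rightarrow> real \<Rightarrow> real \<Rightarrow> real" where
  "steklov_xi_area m K A = steklov_xi_radius m K (radius_of_area K A)"


section \<open>Agreement with the polar form of the metric\<close>

lemma space_form_metric_polar:
  fixes K r t :: real
  assumes "r > 0"
  defines "x \<equiv> vector [r * cos t, r * sin t] :: real^2"
    and "d_r \<equiv> vector [cos t, sin t] :: real^2"
    and "d_t \<equiv> vector [- r * sin t, r * cos t] :: real^2"
  shows "norm x = r" and "radial_field x = d_r"
    and "d_r \<bullet> (space_form_metric K x *v d_r) = 1"
    and "d_r \<bullet> (space_form_metric K x *v d_t) = 0"
    and "d_t \<bullet> (space_form_metric K x *v d_r) = 0"
    and "d_t \<bullet> (space_form_metric K x *v d_t) = (h_fun K r)\<^sup>2"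
proof -
  have sc: "(sin t)\<^sup>2 = 1 - (cos t)\<^sup>2"
    by (simp add: sin_squared_eq)
  have "(norm x)\<^sup>2 = r\<^sup>2"
    unfolding power2_norm_eq_inner inner_vec_def x_def
    by (simp add: sum_2 sc power2_eq_square[symmetric] power_mult_distrib algebra_simps)
  with \<open>r > 0\<close> show n: "norm x = r"
    by (simp add: power2_eq_iff_nonneg)
  show "radial_field x = d_r"
    unfolding radial_field_def n using \<open>r > 0\<close>
    by (simp add: vec_eq_iff forall_2 x_def d_r_def)
  have "x \<noteq> 0"
    using n \<open>r > 0\<close> by auto
  define q where "q = (h_fun K r / r)\<^sup>2"
  define c where "c = cos t"
  define s where "s = sin t"
  have s2: "s * s = 1 - c * c"
    using sc by (simp add: c_def s_def power2_eq_square)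
  have G: "space_form_metric K x = (\<chi> i j. d_r $ i * d_r $ j + q * (mat 1 $ i $ j - d_r $ i * d_r $ j))"
    using \<open>r > 0\<close>
    unfolding space_form_metric_def n q_def[symmetric] if_not_P[OF \<open>x \<noteq> 0\<close>]
    by (simp add: vec_eq_iff forall_2 x_def d_r_def power2_eq_square)
  have P: "space_form_metric K x *v v = (d_r \<bullet> v) *\<^sub>R d_r + q *\<^sub>R (v - (d_r \<bullet> v) *\<^sub>R d_r)" for v
    unfolding G
    by (simp add: vec_eq_iff forall_2 matrix_vector_mult_def inner_vec_def sum_2 mat_def algebra_simps)
  have 1: "d_r \<bullet> d_r = 1" "d_r \<bullet> d_t = 0" "d_t \<bullet> d_r = 0" "d_t \<bullet> d_t = r\<^sup>2"
    by (simp_all add: d_r_def d_t_def inner_vec_def sum_2 power2_eq_square algebra_simps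
        flip: c_def s_def distrib_left) (simp_all add: s2 algebra_simps)
  show "d_r \<bullet> (space_form_metric K x *v d_r) = 1"
    "d_r \<bullet> (space_form_metric K x *v d_t) = 0"
    "d_t \<bullet> (space_form_metric K x *v d_r) = 0"
    unfolding P by (simp_all add: 1 inner_add_right inner_diff_right)
  show "d_t \<bullet> (space_form_metric K x *v d_t) = (h_fun K r)\<^sup>2"
    unfolding P using \<open>r > 0\<close> by (simp add: 1 q_def power_divide)
qed

end

theory Submission
  imports Defs
begin

text \<open>In the conformal coordinate \<open>z = tan\<^sub>K(r/2) e\<^sup>i\<^sup>\<theta>\<close>, where \<open>tan\<^sub>K(r/2) = h(r) / (1 + h'(r))\<close>, the functions
  \<open>w = Re z\<^sup>k\<close> are harmonic, and \<open>\<Delta>(f(q) w) = w\<close> for \<open>q = \<bar>z\<bar>\<^sup>2\<close> reduces to an ordinary differential equation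
  with \<open>f'(q) = \<integral>\<^sub>0\<^sup>1 s\<^sup>k / (1 + K q s)\<^sup>2 ds\<close>. A suitable combination \<open>(f(q) + b) w\<close> is an eigenfunction with
  eigenvalue \<open>\<xi>\<^sub>k = k\<^sup>2 / (2 h q f'(q))\<close>, evaluated at the boundary. Conversely, each angular Fourier coefficient of an
  eigenfunction solves the same radial equations and is bounded at the centre, so it vanishes unless \<open>\<xi> = \<xi>\<^sub>k\<close>, and
  the completeness of the trigonometric system shows that there are no other eigenvalues. As \<open>\<xi>\<^sub>k\<close> increases with
  \<open>k\<close>, it is the \<open>k\<close>th eigenvalue without multiplicity. With \<open>S = h(R/2)\<^sup>2\<close> and \<open>y = K S\<close>, an integration by parts
  turns \<open>1/\<xi>\<^sub>k\<close> into an expression that increases with \<open>S\<close> and decreases with \<open>y\<close>. A disk of area \<open>A\<close> has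
  \<open>S = A / 4\<pi>\<close>; for a fixed radius, \<open>S\<close> decreases and \<open>y\<close> increases with \<open>K\<close>.\<close>

section \<open>Calculus of smooth functions\<close>

text \<open>The obstacle is the centre: polar coordinates are singular there, whereas an
  eigenfunction is smooth in normal coordinates. The bridge is the identity h^2 \<Delta> = (h
  d/dr)^2 + (d/d\<theta>)^2, whose two derivations are smooth vector fields; values at the centre
  then follow by continuity. Since h d/dr multiplies w by k and q by 2, it acts on f(q) w as 2 q
  d/dq + k. This yields the equation for f, as (2 q d/dq + k)^2 - k^2 = 4 q (q d^2/dq^2 + (k + 1)
  d/dq) and h^2 = 4 q / (1 + K q)^2. It also yields the eigenvalue: the Neumann condition says f + b
  = - 2 q f' / k at the boundary, and the normal derivative of \<Delta>u = w is k w / h, so \<xi> =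
  - (k / h) / (f + b). The half radius enters because a disk has area 4 pi h(R/2)^2. The integration
  by parts enters because q f'(q) is the integral of S s^k (1 - y) / (1 - y (1 - s))^2 over [0,1],
  and the factor depending on y is not monotone: its derivative at y = 0 is 1 - 2 s.\<close>

definition smooth_on_open :: "(real^'n::finite) set \<Rightarrow> (real^'n \<Rightarrow> real) \<Rightarrow> bool" where
  "smooth_on_open U f \<longleftrightarrow> open U \<and> (\<forall>k. Ck_on k U f)"

lemma partial_deriv_eq:
  "(f has_derivative f') (at x) \<Longrightarrow> partial_deriv i f x = f' (axis i 1)"
  unfolding partial_deriv_def using frechet_derivative_at by fastforce

lemma has_derivative_cong_open:
  assumes "open U" "x \<in> U" "\<And>y. y \<in> U \<Longrightarrow> f y = g y"
  shows "(f has_derivative f') (at x) \<longleftrightarrow> (g has_derivative f') (at x)"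
  using assms has_derivative_transform_within_open[of f f' x UNIV U g]
    has_derivative_transform_within_open[of g f' x UNIV U f] by auto

lemma frechet_derivative_cong_open:
  assumes "open U" "x \<in> U" "\<And>y. y \<in> U \<Longrightarrow> f y = g y"
  shows "frechet_derivative f (at x) = frechet_derivative g (at x)"
  unfolding frechet_derivative_def using has_derivative_cong_open[OF assms] by simp

lemma partial_deriv_cong_open:
  assumes "open U" "x \<in> U" "\<And>y. y \<in> U \<Longrightarrow> f y = g y"
  shows "partial_deriv i f x = partial_deriv i g x"
  unfolding partial_deriv_def using frechet_derivative_cong_open[OF assms] by simp

lemma Ck_on_cong_open:
  assumes "open U" "\<And>y. y \<in> U \<Longrightarrow> f y = g y" "Ck_on k U f"
  shows "Ck_on k U g"
  using assms(2,3)
proof (induction k arbitrary: f g)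
  case 0
  then show ?case by (auto cong: continuous_on_cong)
next
  case (Suc k)
  have "g differentiable (at x)" if x: "x \<in> U" for x
  proof -
    obtain D where "(f has_derivative D) (at x)"
      using Suc.prems(2) x by (auto simp: differentiable_on_eq_differentiable_at[OF assms(1)] differentiable_def)
    then have "(g has_derivative D) (at x)"
      using has_derivative_cong_open[OF assms(1) x Suc.prems(1)] by simp
    then show ?thesis by (auto simp: differentiable_def)
  qed
  then have "g differentiable_on U"
    by (simp add: differentiable_on_eq_differentiable_at[OF assms(1)])
  moreover have "Ck_on k U (partial_deriv i g)" for i
  proof (rule Suc.IH)
    show "Ck_on k U (partial_deriv i f)"
      using Suc.prems(2) by simp
    show "partial_deriv i f x = partial_deriv i g x" if "x \<in> U" for x
      using Suc.prems(1) by (rule partial_deriv_cong_open[OF assms(1) that])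
  qed
  ultimately show ?case by simp
qed

lemma Ck_on_SucD: "Ck_on (Suc k) U f \<Longrightarrow> Ck_on k U f"
proof (induction k arbitrary: f)
  case (Suc k)
  then show ?case unfolding Ck_on.simps(2)[of "Suc k"] Ck_on.simps(2)[of k U f] by blast
qed (simp add: differentiable_imp_continuous_on)

lemma Ck_on_subset: "V \<subseteq> U \<Longrightarrow> Ck_on k U f \<Longrightarrow> Ck_on k V f"
proof (induction k arbitrary: f)
  case (Suc k)
  then show ?case unfolding Ck_on.simps(2) using differentiable_on_subset by blast
qed (auto intro: continuous_on_subset)

lemma Ck_on_has_derivative:
  assumes "open U" "Ck_on (Suc k) U f" "x \<in> U"
  shows "(f has_derivative (\<lambda>v. \<Sum>i\<in>UNIV. v $ i * partial_deriv i f x)) (at x)"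
proof -
  have d: "f differentiable (at x)"
    using assms by (auto simp: differentiable_on_eq_differentiable_at)
  then obtain f' where f': "(f has_derivative f') (at x)"
    by (auto simp: differentiable_def)
  then interpret bounded_linear f' by (rule has_derivative_bounded_linear)
  have "f' v = (\<Sum>i\<in>UNIV. v $ i * partial_deriv i f x)" for v
  proof -
    have "f' v = f' (\<Sum>i\<in>UNIV. v $ i *\<^sub>R axis i 1)"
      using basis_expansion[of v] by (simp add: scalar_mult_eq_scaleR)
    then show ?thesis by (simp add: sum scale partial_deriv_eq[OF f'])
  qed
  then have "f' = (\<lambda>v. \<Sum>i\<in>UNIV. v $ i * partial_deriv i f x)" by (rule ext)
  from f'[unfolded this] show ?thesis .
qed

lemma sum_axis: "(\<Sum>j\<in>UNIV. axis i 1 $ j * p j) = (p i :: real)"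
  for i :: "'n::finite"
proof -
  have "axis i 1 $ j * p j = (if j = i then p j else 0)" for j
    by (auto simp: axis_def)
  then show ?thesis by simp
qed

lemma Ck_on_const: "Ck_on k U (\<lambda>x. c)"
  for U :: "(real^'n::finite) set"
proof (induction k arbitrary: c)
  case (Suc k)
  have "partial_deriv i (\<lambda>x. c) = (\<lambda>x::real^'n. 0)" for i
    by (rule ext, rule partial_deriv_eq) (rule has_derivative_const)
  with Suc show ?case by simp
qed simp

lemma partial_deriv_component: "partial_deriv i (\<lambda>x. x $ j) x = (if i = j then 1 else 0)"
  by (subst partial_deriv_eq[of _ "\<lambda>x. x $ j"])
    (auto intro!: bounded_linear_imp_has_derivative bounded_linear_vec_nth simp: axis_def)

lemma Ck_on_component: "Ck_on k U (\<lambda>x. x $ j)"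
  for U :: "(real^'n::finite) set"
proof (cases k)
  case (Suc l)
  have "partial_deriv i (\<lambda>x::real^'n. x $ j) = (\<lambda>x. if i = j then 1 else 0)" for i
    by (rule ext) (rule partial_deriv_component)
  moreover have "(\<lambda>x. x $ j) differentiable_on U"
    by (intro linear_imp_differentiable_on bounded_linear.linear bounded_linear_vec_nth)
  ultimately show ?thesis
    unfolding Suc by (simp add: Ck_on_const)
qed (auto intro: continuous_intros)

context
  fixes U :: "(real^'n::finite) set"
  assumes U: "open U"
begin

lemma partial_deriv_add:
  assumes "Ck_on (Suc k) U f" "Ck_on (Suc l) U g" "x \<in> U"
  shows "partial_deriv i (\<lambda>x. f x + g x) x = partial_deriv i f x + partial_deriv i g x"
  using partial_deriv_eq[OF has_derivative_add[OF Ck_on_has_derivative[OF U assms(1,3)]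
        Ck_on_has_derivative[OF U assms(2,3)]]]
  by (simp add: sum_axis)

lemma partial_deriv_mult:
  assumes "Ck_on (Suc k) U f" "Ck_on (Suc l) U g" "x \<in> U"
  shows "partial_deriv i (\<lambda>x. f x * g x) x = f x * partial_deriv i g x + partial_deriv i f x * g x"
  using partial_deriv_eq[OF has_derivative_mult[OF Ck_on_has_derivative[OF U assms(1,3)]
        Ck_on_has_derivative[OF U assms(2,3)]]]
  by (simp add: sum_axis)

lemma Ck_on_add: "Ck_on k U f \<Longrightarrow> Ck_on k U g \<Longrightarrow> Ck_on k U (\<lambda>x. f x + g x)"
proof (induction k arbitrary: f g)
  case 0
  then show ?case by (auto intro: continuous_intros)
next
  case (Suc k)
  have "Ck_on k U (partial_deriv i (\<lambda>x. f x + g x))" for i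
    by (rule Ck_on_cong_open[OF U, of "\<lambda>x. partial_deriv i f x + partial_deriv i g x"])
      (use Suc partial_deriv_add in auto)
  with Suc.prems show ?case by (auto intro: differentiable_on_add)
qed

lemma Ck_on_mult: "Ck_on k U f \<Longrightarrow> Ck_on k U g \<Longrightarrow> Ck_on k U (\<lambda>x. f x * g x)"
proof (induction k arbitrary: f g)
  case 0
  then show ?case by (auto intro: continuous_intros)
next
  case (Suc k)
  have "Ck_on k U (partial_deriv i (\<lambda>x. f x * g x))" for i
  proof (rule Ck_on_cong_open[OF U])
    show "Ck_on k U (\<lambda>x. f x * partial_deriv i g x + partial_deriv i f x * g x)"
      using Suc.prems Ck_on_SucD[OF Suc.prems(1)] Ck_on_SucD[OF Suc.prems(2)]
      by (intro Ck_on_add Suc.IH) simp_all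
  qed (use partial_deriv_mult[OF Suc.prems] in simp)
  with Suc.prems show ?case by (auto intro: differentiable_on_mult)
qed

lemma partial_deriv_compose:
  assumes "Ck_on (Suc k) U f" "x \<in> U" "(\<phi> has_field_derivative d) (at (f x))"
  shows "partial_deriv i (\<lambda>x. \<phi> (f x)) x = d * partial_deriv i f x"
  using partial_deriv_eq[OF has_derivative_compose[OF Ck_on_has_derivative[OF U assms(1,2)]
        assms(3)[unfolded has_field_derivative_def]]]
  by (simp add: sum_axis)

text \<open>The outer function is given together with all its derivatives as a sequence
  \<open>D\<close>, since the chain rule produces \<open>D (Suc n)\<close>; the induction is
  therefore over all \<open>n\<close> at once. Smooth functions of one variable enter the
  development in this form.\<close>

lemma Ck_on_compose:
  assumes "\<And>n t. t \<in> S \<Longrightarrow> (D n has_field_derivative D (Suc n) t) (at t)"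
    and "\<And>x. x \<in> U \<Longrightarrow> f x \<in> S" and "Ck_on k U f"
  shows "Ck_on k U (\<lambda>x. D n (f x))"
  using assms(3)
proof (induction k arbitrary: n)
  case 0
  have "continuous_on S (D n)"
    using assms(1) by (meson DERIV_continuous continuous_at_imp_continuous_on)
  then show ?case
    using 0 assms(2) by (auto intro: continuous_on_compose2)
next
  case (Suc k)
  have "Ck_on k U (partial_deriv i (\<lambda>x. D n (f x)))" for i
  proof (rule Ck_on_cong_open[OF U])
    show "Ck_on k U (\<lambda>x. D (Suc n) (f x) * partial_deriv i f x)"
      using Suc.prems Ck_on_SucD[OF Suc.prems] by (intro Ck_on_mult Suc.IH) simp_all
    show "D (Suc n) (f x) * partial_deriv i f x = partial_deriv i (\<lambda>x. D n (f x)) x"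
      if "x \<in> U" for x
      using partial_deriv_compose[OF Suc.prems that assms(1)[OF assms(2)[OF that]]] by simp
  qed
  moreover have "(\<lambda>x. D n (f x)) differentiable (at x)" if "x \<in> U" for x
    using has_derivative_compose[OF Ck_on_has_derivative[OF U Suc.prems that]]
      assms(1)[OF assms(2)[OF that], of n]
    unfolding differentiable_def has_field_derivative_def by blast
  ultimately show ?case by (simp add: differentiable_on_eq_differentiable_at[OF U])
qed

end

lemma smooth_onD:
  assumes "smooth_on_open U f"
  shows "open U" "Ck_on k U f"
  using assms by (auto simp: smooth_on_open_def)

lemma smooth_on_subset:
  "smooth_on_open U f \<Longrightarrow> open V \<Longrightarrow> V \<subseteq> U \<Longrightarrow> smooth_on_open V f"
  unfolding smooth_on_open_def using Ck_on_subset by blast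

lemma smooth_on_continuous: "smooth_on_open U f \<Longrightarrow> continuous_on U f"
  using smooth_onD(2)[of U f 0] by simp

lemma smooth_on_has_derivative:
  assumes "smooth_on_open U f" "x \<in> U"
  shows "(f has_derivative (\<lambda>v. \<Sum>i\<in>UNIV. v $ i * partial_deriv i f x)) (at x)"
  using Ck_on_has_derivative[of U 0 f x] smooth_onD[OF assms(1)] assms(2) by simp

lemma smooth_on_partial:
  "smooth_on_open U f \<Longrightarrow> smooth_on_open U (partial_deriv i f)"
  unfolding smooth_on_open_def using Ck_on.simps(2) by blast

lemma smooth_on_const: "open U \<Longrightarrow> smooth_on_open U (\<lambda>x. c)"
  by (simp add: smooth_on_open_def Ck_on_const)

lemma smooth_on_component: "open U \<Longrightarrow> smooth_on_open U (\<lambda>x. x $ j)"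
  by (simp add: smooth_on_open_def Ck_on_component)

lemma smooth_on_add:
  "smooth_on_open U f \<Longrightarrow> smooth_on_open U g \<Longrightarrow> smooth_on_open U (\<lambda>x. f x + g x)"
  by (simp add: smooth_on_open_def Ck_on_add)

lemma smooth_on_mult:
  "smooth_on_open U f \<Longrightarrow> smooth_on_open U g \<Longrightarrow> smooth_on_open U (\<lambda>x. f x * g x)"
  by (simp add: smooth_on_open_def Ck_on_mult)

lemma smooth_on_power:
  "smooth_on_open U f \<Longrightarrow> smooth_on_open U (\<lambda>x. f x ^ n)"
  by (induction n) (auto intro: smooth_on_const smooth_on_mult smooth_onD)

lemma smooth_on_compose:
  assumes "smooth_on_open U f" "\<And>n t. t \<in> S \<Longrightarrow> (D n has_field_derivative D (Suc n) t) (at t)"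
    and "\<And>x. x \<in> U \<Longrightarrow> f x \<in> S"
  shows "smooth_on_open U (\<lambda>x. D n (f x))"
  using assms Ck_on_compose[of U S D f] by (auto simp: smooth_on_open_def)

lemma smooth_on_inverse:
  assumes "smooth_on_open U f" "\<And>x. x \<in> U \<Longrightarrow> f x \<noteq> 0"
  shows "smooth_on_open U (\<lambda>x. inverse (f x))"
proof -
  define D :: "nat \<Rightarrow> real \<Rightarrow> real" where
    "D n t = (-1) ^ n * fact n * inverse t ^ Suc n" for n t
  have D: "(D n has_field_derivative D (Suc n) t) (at t)" if "t \<in> -{0}" for n t
  proof -
    have "(inverse has_field_derivative - (inverse t ^ Suc (Suc 0))) (at t)"
      using that by (intro DERIV_inverse) auto
    from DERIV_cmult[OF DERIV_power_Suc[OF this, of n], of "(-1) ^ n * fact n"]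
    show ?thesis
      unfolding D_def by (simp add: algebra_simps)
  qed
  have "smooth_on_open U (\<lambda>x. D 0 (f x))"
    by (rule smooth_on_compose[where D = D and S = "-{0}", OF assms(1) D]) (use assms(2) in simp_all)
  then show ?thesis by (simp add: D_def)
qed

lemma smooth_on_divide:
  assumes "smooth_on_open U f" "smooth_on_open U g" "\<And>x. x \<in> U \<Longrightarrow> g x \<noteq> 0"
  shows "smooth_on_open U (\<lambda>x. f x / g x)"
  unfolding divide_inverse using assms by (intro smooth_on_mult smooth_on_inverse)

section \<open>The warping function as a power series\<close>

lemma summable_factorial_bound:
  fixes c :: "nat \<Rightarrow> real"
  assumes "\<And>n. \<bar>c n\<bar> \<le> B * C ^ n / fact n"
  shows "summable (\<lambda>n. c n * y ^ n)"
proof (rule summable_comparison_test')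
  show "summable (\<lambda>n. B * (inverse (fact n) * (C * \<bar>y\<bar>) ^ n))"
    by (intro summable_mult summable_exp)
  show "norm (c n * y ^ n) \<le> B * (inverse (fact n) * (C * \<bar>y\<bar>) ^ n)" for n
    using mult_right_mono[OF assms, of "\<bar>y\<bar> ^ n" n]
    by (simp add: abs_mult power_abs power_mult_distrib field_simps)
qed

lemma smooth_on_power_series:
  assumes "\<And>y. summable (\<lambda>n. c n * y ^ n)" "smooth_on_open U f"
  shows "smooth_on_open U (\<lambda>x. \<Sum>n. c n * f x ^ n)"
proof -
  define D where "D m t = (\<Sum>n. (diffs ^^ m) c n * t ^ n)" for m and t :: real
  have s: "summable (\<lambda>n. (diffs ^^ m) c n * y ^ n)" for m y
    by (induction m arbitrary: y) (auto simp: assms(1) intro: termdiff_converges_all)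
  have D: "(D m has_field_derivative D (Suc m) t) (at t)" if "t \<in> UNIV" for m t
    unfolding D_def using termdiffs_strong_converges_everywhere[OF s] by simp
  have "smooth_on_open U (\<lambda>x. D 0 (f x))"
    by (rule smooth_on_compose[where D = D and S = UNIV, OF assms(2) D]) simp_all
  then show ?thesis by (simp add: D_def)
qed

text \<open>Coefficients in powers of s = r^2, not of r: r^2 is a polynomial in the coordinates, so
  functions of it are smooth across the origin, where the norm is not. The factor (-K)^n treats all
  signs of K by one series.\<close>

definition cos_coeff_K :: "real \<Rightarrow> nat \<Rightarrow> real" where
  "cos_coeff_K K n = (-K) ^ n / fact (2 * n)"

definition sin_coeff_K :: "real \<Rightarrow> nat \<Rightarrow> real" where
  "sin_coeff_K K n = (-K) ^ n / fact (2 * n + 1)"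

text \<open>With \<open>s = r\<^sup>2\<close>, these are \<open>h_K'(r)\<close>, \<open>h_K(r) / r\<close> and \<open>(h_K(r) / r - 1) / r\<^sup>2\<close>
  as entire functions of \<open>s\<close>.\<close>

definition cosK :: "real \<Rightarrow> real \<Rightarrow> real" where
  "cosK K s = (\<Sum>n. cos_coeff_K K n * s ^ n)"

definition sincK :: "real \<Rightarrow> real \<Rightarrow> real" where
  "sincK K s = (\<Sum>n. sin_coeff_K K n * s ^ n)"

definition sincK1 :: "real \<Rightarrow> real \<Rightarrow> real" where
  "sincK1 K s = (\<Sum>n. sin_coeff_K K (Suc n) * s ^ n)"

lemma summable_cos_coeff_K: "summable (\<lambda>n. cos_coeff_K K n * y ^ n)"
proof (rule summable_factorial_bound[where B = 1 and C = "\<bar>K\<bar>"])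
  show "\<bar>cos_coeff_K K n\<bar> \<le> 1 * \<bar>K\<bar> ^ n / fact n" for n
    unfolding cos_coeff_K_def abs_divide power_abs abs_minus_cancel
    by (auto intro!: divide_left_mono fact_mono simp del: fact_Suc)
qed

lemma summable_sin_coeff_K: "summable (\<lambda>n. sin_coeff_K K n * y ^ n)"
proof (rule summable_factorial_bound[where B = 1 and C = "\<bar>K\<bar>"])
  show "\<bar>sin_coeff_K K n\<bar> \<le> 1 * \<bar>K\<bar> ^ n / fact n" for n
    unfolding sin_coeff_K_def abs_divide power_abs abs_minus_cancel
    by (auto intro!: divide_left_mono fact_mono simp del: fact_Suc)
qed

lemma summable_sin_coeff_K_Suc: "summable (\<lambda>n. sin_coeff_K K (Suc n) * y ^ n)"
proof (rule summable_factorial_bound[where B = "\<bar>K\<bar>" and C = "\<bar>K\<bar>"])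
  show "\<bar>sin_coeff_K K (Suc n)\<bar> \<le> \<bar>K\<bar> * \<bar>K\<bar> ^ n / fact n" for n
    unfolding sin_coeff_K_def abs_divide power_abs abs_minus_cancel power_Suc[symmetric]
    by (auto intro!: divide_left_mono fact_mono simp del: power_Suc fact_Suc)
qed

lemma sincK_eq: "sincK K s = 1 + s * sincK1 K s"
proof -
  have "sincK K s = (\<Sum>n. sin_coeff_K K (Suc n) * s ^ Suc n) + 1"
    unfolding sincK_def
    by (subst suminf_split_head[OF summable_sin_coeff_K]) (simp add: sin_coeff_K_def)
  also have "(\<Sum>n. sin_coeff_K K (Suc n) * s ^ Suc n) = s * sincK1 K s"
    unfolding sincK1_def
    by (subst suminf_mult[OF summable_sin_coeff_K_Suc, symmetric]) (simp add: mult_ac)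
  finally show ?thesis by simp
qed

lemma cosK_0 [simp]: "cosK K 0 = 1"
  using sums_unique[OF powser_sums_zero[of "cos_coeff_K K"]]
  by (simp add: cosK_def cos_coeff_K_def)

lemma sincK_0 [simp]: "sincK K 0 = 1"
  by (simp add: sincK_eq)

lemma DERIV_cosK: "(cosK K has_field_derivative (- K / 2 * sincK K s)) (at s)"
proof -
  have "diffs (cos_coeff_K K) n = - K / 2 * sin_coeff_K K n" for n
  proof -
    define m where "m = 2 * real n + 2"
    have f: "fact (2 * Suc n) = m * fact (2 * n + 1)" "real (Suc n) = m / 2" "m > 0"
      by (simp_all add: m_def algebra_simps)
    show ?thesis
      unfolding diffs_def cos_coeff_K_def sin_coeff_K_def f(1,2) using f(3)
      by (simp add: divide_simps del: fact_Suc)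
  qed
  then have "(\<Sum>n. diffs (cos_coeff_K K) n * s ^ n) = - K / 2 * sincK K s"
    unfolding sincK_def suminf_mult[OF summable_sin_coeff_K, symmetric] by (simp add: mult_ac)
  then show ?thesis
    using termdiffs_strong_converges_everywhere[OF summable_cos_coeff_K[of K], of s]
    unfolding cosK_def[abs_def] by simp
qed

definition sincK' :: "real \<Rightarrow> real \<Rightarrow> real" where
  "sincK' K s = (\<Sum>n. diffs (sin_coeff_K K) n * s ^ n)"

lemma DERIV_sincK: "(sincK K has_field_derivative sincK' K s) (at s)"
  unfolding sincK_def[abs_def] sincK'_def
  by (rule termdiffs_strong_converges_everywhere[OF summable_sin_coeff_K])

text \<open>In terms of r this is d/dr (r \<open>sincK\<close>(r^2)) = \<open>cosK\<close>(r^2). It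
  is read off coefficientwise: 2 s d/ds multiplies s^n by 2 n, and (2 n + 1) / (2 n + 1)! = 1 / (2
  n)!.\<close>

lemma sincK'_eq: "sincK K s + 2 * s * sincK' K s = cosK K s"
proof -
  have "(\<lambda>n. of_nat n * sin_coeff_K K n * s ^ (n - Suc 0)) sums sincK' K s"
    unfolding sincK'_def
    by (rule diffs_equiv[OF termdiff_converges_all[OF summable_sin_coeff_K]])
  from sums_mult[OF this, of "2 * s"]
  have "(\<lambda>n. 2 * of_nat n * sin_coeff_K K n * s ^ n) sums (2 * s * sincK' K s)"
  proof (rule sums_cong[THEN iffD1, rotated])
    show "2 * s * (of_nat n * sin_coeff_K K n * s ^ (n - Suc 0))
      = 2 * of_nat n * sin_coeff_K K n * s ^ n" for n
      by (cases n) simp_all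
  qed
  moreover have "(\<lambda>n. sin_coeff_K K n * s ^ n) sums sincK K s"
    unfolding sincK_def by (rule summable_sums[OF summable_sin_coeff_K])
  ultimately have "(\<lambda>n. 2 * of_nat n * sin_coeff_K K n * s ^ n + sin_coeff_K K n * s ^ n)
      sums (2 * s * sincK' K s + sincK K s)"
    by (rule sums_add)
  moreover have "2 * of_nat n * sin_coeff_K K n * s ^ n + sin_coeff_K K n * s ^ n
      = cos_coeff_K K n * s ^ n" for n
  proof -
    have "fact (2 * n + 1) = (2 * real n + 1) * fact (2 * n)"
      by (simp add: algebra_simps)
    then have "(2 * real n + 1) * sin_coeff_K K n = cos_coeff_K K n"
      unfolding cos_coeff_K_def sin_coeff_K_def by (simp add: divide_simps del: fact_Suc)
    then show ?thesis by (simp add: algebra_simps flip: \<open>_ = cos_coeff_K K n\<close>)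
  qed
  ultimately show ?thesis
    unfolding cosK_def by (simp add: sums_iff)
qed

lemma DERIV_cosK_sq: "((\<lambda>r. cosK K (r\<^sup>2)) has_field_derivative - K * (r * sincK K (r\<^sup>2))) (at r)"
proof -
  have "((\<lambda>r. r\<^sup>2) has_field_derivative 2 * r) (at r)"
    by (auto intro!: derivative_eq_intros)
  from DERIV_chain2[OF DERIV_cosK this, of K] show ?thesis by (simp add: mult_ac)
qed

lemma DERIV_sincK_sq: "((\<lambda>r. r * sincK K (r\<^sup>2)) has_field_derivative cosK K (r\<^sup>2)) (at r)"
proof -
  have "((\<lambda>r. r\<^sup>2) has_field_derivative 2 * r) (at r)"
    by (auto intro!: derivative_eq_intros)
  from DERIV_mult[OF DERIV_ident DERIV_chain2[OF DERIV_sincK this, of K]] show ?thesis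
    by (simp add: sincK'_eq[symmetric] power2_eq_square algebra_simps)
qed

section \<open>Identities for h_K and h_K'\<close>

lemma real_deriv0_const:
  fixes f :: "real \<Rightarrow> real"
  assumes "\<And>x. (f has_field_derivative 0) (at x)"
  shows "f x = f y"
  using DERIV_isconst_all[of f x y] assms by blast

lemma cosK_sincK_id: "(cosK K s)\<^sup>2 + K * s * (sincK K s)\<^sup>2 = 1" if "s \<ge> 0"
proof -
  let ?f = "\<lambda>r. (cosK K (r\<^sup>2))\<^sup>2 + K * (r * sincK K (r\<^sup>2))\<^sup>2"
  have "(?f has_field_derivative 0) (at r)" for r
    by (rule derivative_eq_intros DERIV_cosK_sq DERIV_sincK_sq refl)+ (simp add: algebra_simps)
  from real_deriv0_const[of ?f "sqrt s" 0, OF this] that show ?thesis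
    by (simp add: power_mult_distrib)
qed

text \<open>This is h_K'. The cases mirror \<open>h_fun\<close>, so that the double-angle formulas
  come from the trigonometric and hyperbolic functions.\<close>

definition c_fun :: "real \<Rightarrow> real \<Rightarrow> real" where
  "c_fun K r = (if K > 0 then cos (sqrt K * r) else if K = 0 then 1 else cosh (sqrt (- K) * r))"

lemma curvature_cases:
  obtains (pos) a where "a > 0" "K = a\<^sup>2" | (zero) "K = (0::real)" | (neg) a where "a > 0" "K = - (a\<^sup>2)"
proof -
  consider "K > 0" | "K = 0" | "K < 0" by linarith
  then show ?thesis
    using pos[of "sqrt K"] zero neg[of "sqrt (- K)"] by cases auto
qed

lemma space_form_funs_pos:
  assumes "a > 0"
  shows "h_fun (a\<^sup>2) r = sin (a * r) / a" "c_fun (a\<^sup>2) r = cos (a * r)" "r_max (a\<^sup>2) = ereal (pi / a)"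
  using assms by (auto simp: h_fun_def c_fun_def r_max_def)

lemma space_form_funs_zero:
  "h_fun 0 r = r" "c_fun 0 r = 1" "r_max 0 = \<infinity>"
  by (auto simp: h_fun_def c_fun_def r_max_def)

lemma space_form_funs_neg:
  assumes "a > 0"
  shows "h_fun (- (a\<^sup>2)) r = sinh (a * r) / a" "c_fun (- (a\<^sup>2)) r = cosh (a * r)" "r_max (- (a\<^sup>2)) = \<infinity>"
  using assms by (auto simp: h_fun_def c_fun_def r_max_def)

lemmas space_form_funs = space_form_funs_pos space_form_funs_zero space_form_funs_neg

lemma DERIV_h_fun: "(h_fun K has_field_derivative c_fun K r) (at r)"
  by (cases K rule: curvature_cases)
    (auto simp: h_fun_def[abs_def] c_fun_def intro!: derivative_eq_intros)

lemma DERIV_c_fun: "(c_fun K has_field_derivative - K * h_fun K r) (at r)"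
  by (cases K rule: curvature_cases)
    (auto simp: h_fun_def c_fun_def[abs_def] power2_eq_square intro!: derivative_eq_intros)

lemma h_fun_0 [simp]: "h_fun K 0 = 0" and c_fun_0 [simp]: "c_fun K 0 = 1"
  by (auto simp: h_fun_def c_fun_def)

lemma c_h_id: "(c_fun K r)\<^sup>2 + K * (h_fun K r)\<^sup>2 = 1"
proof -
  let ?f = "\<lambda>r. (c_fun K r)\<^sup>2 + K * (h_fun K r)\<^sup>2"
  have "(?f has_field_derivative 0) (at r)" for r
    by (rule derivative_eq_intros DERIV_h_fun DERIV_c_fun refl)+ (simp add: algebra_simps)
  from real_deriv0_const[of ?f r 0, OF this] show ?thesis by simp
qed

text \<open>Both pairs solve c' = - K h, h' = c with the same initial values. The combinations
  \<open>?f\<close> and \<open>?g\<close> are the addition-theorem expressions for the cosine and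
  sine of a difference; they are constant and keep their values 1 and 0 from r = 0. Together with
  \<open>c_h_id\<close> these two linear equations identify the pairs.\<close>

lemma h_fun_eq_sincK: "h_fun K r = r * sincK K (r\<^sup>2)"
  and c_fun_eq_cosK: "c_fun K r = cosK K (r\<^sup>2)"
proof -
  let ?C = "cosK K (r\<^sup>2)" and ?H = "r * sincK K (r\<^sup>2)"
  let ?f = "\<lambda>r. cosK K (r\<^sup>2) * c_fun K r + K * (r * sincK K (r\<^sup>2)) * h_fun K r"
  let ?g = "\<lambda>r. (r * sincK K (r\<^sup>2)) * c_fun K r - cosK K (r\<^sup>2) * h_fun K r"
  have "(?f has_field_derivative 0) (at r)" for r
    by (rule derivative_eq_intros DERIV_cosK_sq DERIV_sincK_sq DERIV_h_fun DERIV_c_fun refl)+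
      (simp add: algebra_simps)
  from real_deriv0_const[of ?f r 0, OF this] have f: "?C * c_fun K r + K * ?H * h_fun K r = 1"
    by simp
  have "(?g has_field_derivative 0) (at r)" for r
    by (rule derivative_eq_intros DERIV_cosK_sq DERIV_sincK_sq DERIV_h_fun DERIV_c_fun refl)+
      (simp add: algebra_simps)
  from real_deriv0_const[of ?g r 0, OF this] have g: "?H * c_fun K r = ?C * h_fun K r"
    by simp
  from f g c_h_id[of K r] show "h_fun K r = ?H" "c_fun K r = ?C"
    unfolding power2_eq_square by algebra+
qed

lemma c_fun_double: "c_fun K (2 * r) = 1 - 2 * K * (h_fun K r)\<^sup>2"
proof (cases K rule: curvature_cases)
  case (pos a)
  then show ?thesis
    using cos_double_sin[of "a * r"] by (simp add: space_form_funs power_divide mult_ac)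
next
  case (neg a)
  then show ?thesis
    using cosh_double[of "a * r"] cosh_square_eq[of "a * r"]
    by (simp add: space_form_funs power_divide mult_ac)
qed (simp add: space_form_funs)

lemma h_fun_double: "h_fun K (2 * r) = 2 * h_fun K r * c_fun K r"
proof (cases K rule: curvature_cases)
  case (pos a)
  then show ?thesis
    using sin_double[of "a * r"] by (simp add: space_form_funs mult_ac)
next
  case (neg a)
  then show ?thesis
    using sinh_double[of "a * r"] by (simp add: space_form_funs mult_ac)
qed (simp add: space_form_funs)

lemma h_fun_pos:
  assumes "0 < r" "ereal r < r_max K"
  shows "h_fun K r > 0"
proof (cases K rule: curvature_cases)
  case (pos a)
  then have "a * r < pi"
    using assms by (simp add: space_form_funs field_simps)
  then show ?thesis
    using pos assms by (simp add: space_form_funs sin_gt_zero)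
qed (use assms in \<open>simp_all add: space_form_funs\<close>)

lemma c_fun_gt_m1:
  assumes "0 \<le> r" "ereal r < r_max K"
  shows "1 + c_fun K r > 0"
proof (cases K rule: curvature_cases)
  case (pos a)
  then have "a * r < pi"
    using assms by (simp add: space_form_funs field_simps)
  then have "cos pi < cos (a * r)"
    using pos assms by (intro cos_monotone_0_pi) auto
  then show ?thesis
    using pos by (simp add: space_form_funs)
next
  case (neg a)
  then show ?thesis
    using cosh_real_pos[of "a * r"] by (simp add: space_form_funs add_pos_pos)
qed (simp add: space_form_funs)

lemma sincK_pos:
  assumes "0 \<le> r" "ereal r < r_max K"
  shows "sincK K (r\<^sup>2) > 0"
proof (cases "r = 0")
  case False
  then show ?thesis
    using assms h_fun_pos[of r K] by (simp add: h_fun_eq_sincK zero_less_mult_iff)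
qed simp

lemma smooth_on_cosK: "smooth_on_open U f \<Longrightarrow> smooth_on_open U (\<lambda>x. cosK K (f x))"
  unfolding cosK_def by (rule smooth_on_power_series[OF summable_cos_coeff_K])

lemma smooth_on_sincK: "smooth_on_open U f \<Longrightarrow> smooth_on_open U (\<lambda>x. sincK K (f x))"
  unfolding sincK_def by (rule smooth_on_power_series[OF summable_sin_coeff_K])

lemma smooth_on_sincK1: "smooth_on_open U f \<Longrightarrow> smooth_on_open U (\<lambda>x. sincK1 K (f x))"
  unfolding sincK1_def by (rule smooth_on_power_series[OF summable_sin_coeff_K_Suc])

section \<open>Derivations in the plane\<close>

definition deriv_along :: "(real^2 \<Rightarrow> real^2) \<Rightarrow> (real^2 \<Rightarrow> real) \<Rightarrow> real^2 \<Rightarrow> real" where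
  "deriv_along X u x = X x $ 1 * partial_deriv 1 u x + X x $ 2 * partial_deriv 2 u x"

lemma smooth_on_partial_add:
  assumes "smooth_on_open U f" "smooth_on_open U g" "x \<in> U"
  shows "partial_deriv i (\<lambda>x. f x + g x) x = partial_deriv i f x + partial_deriv i g x"
  using assms unfolding smooth_on_open_def by (intro partial_deriv_add) auto

lemma smooth_on_partial_mult:
  assumes "smooth_on_open U f" "smooth_on_open U g" "x \<in> U"
  shows "partial_deriv i (\<lambda>x. f x * g x) x = f x * partial_deriv i g x + partial_deriv i f x * g x"
  using assms unfolding smooth_on_open_def by (intro partial_deriv_mult) auto

lemma smooth_on_partial_compose:
  assumes "smooth_on_open U f" "x \<in> U" "(\<phi> has_field_derivative d) (at (f x))"
  shows "partial_deriv i (\<lambda>x. \<phi> (f x)) x = d * partial_deriv i f x"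
  using assms unfolding smooth_on_open_def by (intro partial_deriv_compose) auto

lemma deriv_along_cong_open:
  assumes "open U" "x \<in> U" "\<And>y. y \<in> U \<Longrightarrow> f y = g y"
  shows "deriv_along X f x = deriv_along X g x"
  unfolding deriv_along_def using partial_deriv_cong_open[OF assms] by simp

lemma frechet_derivative_eq_deriv_along:
  assumes "smooth_on_open U u" "x \<in> U"
  shows "frechet_derivative u (at x) (X x) = deriv_along X u x"
  using frechet_derivative_at[OF smooth_on_has_derivative[OF assms]]
  by (simp add: deriv_along_def sum_2 fun_eq_iff)

lemma deriv_along_add:
  assumes "smooth_on_open U f" "smooth_on_open U g" "x \<in> U"
  shows "deriv_along X (\<lambda>x. f x + g x) x = deriv_along X f x + deriv_along X g x"
  unfolding deriv_along_def smooth_on_partial_add[OF assms] by (simp add: algebra_simps)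

lemma deriv_along_mult:
  assumes "smooth_on_open U f" "smooth_on_open U g" "x \<in> U"
  shows "deriv_along X (\<lambda>x. f x * g x) x = f x * deriv_along X g x + deriv_along X f x * g x"
  unfolding deriv_along_def smooth_on_partial_mult[OF assms] by (simp add: algebra_simps)

lemma deriv_along_compose:
  assumes "smooth_on_open U f" "x \<in> U" "(\<phi> has_field_derivative d) (at (f x))"
  shows "deriv_along X (\<lambda>x. \<phi> (f x)) x = d * deriv_along X f x"
  unfolding deriv_along_def smooth_on_partial_compose[OF assms] by (simp add: algebra_simps)

lemma partial_deriv_const: "partial_deriv i (\<lambda>x. c) x = 0"
  by (rule partial_deriv_eq) (rule has_derivative_const)

lemma deriv_along_const: "deriv_along X (\<lambda>x. c) x = 0"
  by (simp add: deriv_along_def partial_deriv_const)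

lemma deriv_along_component: "deriv_along X (\<lambda>x. x $ j) x = X x $ j"
  using exhaust_2[of j] by (auto simp: deriv_along_def partial_deriv_component)

lemma deriv_along_cmult:
  assumes "smooth_on_open U f" "x \<in> U"
  shows "deriv_along X (\<lambda>x. c * f x) x = c * deriv_along X f x"
  using deriv_along_mult[OF smooth_on_const[OF smooth_onD(1)[OF assms(1)], of c] assms, of X]
  by (simp add: deriv_along_const)

lemma smooth_on_deriv_along:
  assumes "\<And>i. smooth_on_open U (\<lambda>x. X x $ i)" "smooth_on_open U u"
  shows "smooth_on_open U (deriv_along X u)"
  unfolding deriv_along_def[abs_def]
  by (intro smooth_on_add smooth_on_mult smooth_on_partial assms)

definition sqn :: "real^2 \<Rightarrow> real" where
  "sqn x = x $ 1 * x $ 1 + x $ 2 * x $ 2"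

lemma norm_eq_sqn: "(norm x)\<^sup>2 = sqn x"
  unfolding power2_norm_eq_inner by (simp add: sqn_def inner_vec_def sum_2)

lemma sqn_eq_0_iff [simp]: "sqn x = 0 \<longleftrightarrow> x = 0"
  unfolding norm_eq_sqn[symmetric] by simp

lemma sqn_nonneg [simp]: "sqn x \<ge> 0"
  unfolding norm_eq_sqn[symmetric] by simp

lemma smooth_on_sqn: "open U \<Longrightarrow> smooth_on_open U sqn"
  unfolding sqn_def[abs_def] by (intro smooth_on_add smooth_on_mult smooth_on_component)

lemma deriv_along_sqn: "deriv_along X sqn x = 2 * (X x $ 1 * x $ 1 + X x $ 2 * x $ 2)"
proof -
  have s: "smooth_on_open UNIV (\<lambda>x::real^2. x $ i)" for i by (rule smooth_on_component) simp
  show ?thesis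
    unfolding sqn_def[abs_def]
    by (simp add: deriv_along_add[OF smooth_on_mult[OF s s] smooth_on_mult[OF s s]]
        deriv_along_mult[OF s s] deriv_along_component)
qed

lemma partial_deriv_sqn: "partial_deriv i sqn x = 2 * x $ i"
  using deriv_along_sqn[of "\<lambda>x. axis i 1" x] exhaust_2[of i]
  by (auto simp: deriv_along_def axis_def)

lemma partial_deriv_radial:
  assumes "(\<phi> has_field_derivative d) (at (sqn x))"
  shows "partial_deriv i (\<lambda>x. \<phi> (sqn x)) x = 2 * d * x $ i"
  using smooth_on_partial_compose[OF smooth_on_sqn[OF open_UNIV] UNIV_I assms]
  by (simp add: partial_deriv_sqn)

text \<open>The derivation r d/dr, a polynomial vector field and so smooth at the origin, unlike
  d/dr.\<close>

definition euler :: "(real^2 \<Rightarrow> real) \<Rightarrow> real^2 \<Rightarrow> real" where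
  "euler = deriv_along (\<lambda>x. x)"

text \<open>The derivation d/d\<theta>.\<close>

definition rot :: "(real^2 \<Rightarrow> real) \<Rightarrow> real^2 \<Rightarrow> real" where
  "rot = deriv_along (\<lambda>x. vector [- x $ 2, x $ 1])"

text \<open>The derivation \<open>h_K(r) \<partial>/\<partial>r\<close>.\<close>

definition radial :: "real \<Rightarrow> (real^2 \<Rightarrow> real) \<Rightarrow> real^2 \<Rightarrow> real" where
  "radial K = deriv_along (\<lambda>x. sincK K (sqn x) *\<^sub>R x)"

lemma radial_eq: "radial K u x = sincK K (sqn x) * euler u x"
  by (simp add: radial_def euler_def deriv_along_def algebra_simps)

lemma smooth_on_euler: "smooth_on_open U u \<Longrightarrow> smooth_on_open U (euler u)"
  unfolding euler_def by (intro smooth_on_deriv_along smooth_on_component smooth_onD)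

lemma smooth_on_rot: "smooth_on_open U u \<Longrightarrow> smooth_on_open U (rot u)"
  unfolding rot_def
proof (rule smooth_on_deriv_along)
  assume u: "smooth_on_open U u"
  fix i :: 2
  have "smooth_on_open U (\<lambda>x. -1 * x $ 2)" "smooth_on_open U (\<lambda>x. x $ 1)"
    by (intro smooth_on_mult smooth_on_const smooth_on_component smooth_onD(1)[OF u])+
  then show "smooth_on_open U (\<lambda>x. vector [- x $ 2, x $ 1] $ i)"
    using exhaust_2[of i] by auto
qed

lemma smooth_on_radial: "smooth_on_open U u \<Longrightarrow> smooth_on_open U (radial K u)"
  unfolding radial_eq[abs_def]
  by (intro smooth_on_mult smooth_on_euler smooth_on_sincK smooth_on_sqn smooth_onD)

section \<open>The Laplacian of a space form\<close>

text \<open>The domain of the normal coordinates; for K > 0 this is the sphere without the point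
  antipodal to the centre.\<close>

definition chart :: "real \<Rightarrow> (real^2) set" where
  "chart K = {x. ereal (norm x) < r_max K}"

lemma open_chart: "open (chart K)"
proof (cases "r_max K")
  case (real r)
  then have "chart K = ball 0 r" by (auto simp: chart_def)
  then show ?thesis by simp
next
  case PInf
  then have "chart K = UNIV" by (auto simp: chart_def)
  then show ?thesis by simp
next
  case MInf
  then have "chart K = {}" by (auto simp: chart_def)
  then show ?thesis by simp
qed

lemma sincK_chart_pos: "x \<in> chart K \<Longrightarrow> sincK K (sqn x) > 0"
  using sincK_pos[of "norm x" K] by (simp add: chart_def norm_eq_sqn)

text \<open>The metric is \<open>\<eta>\<^sup>2 I - C x x\<^sup>T\<close> with \<open>\<eta> = h/r\<close> and \<open>\<eta>\<^sup>2 - C r\<^sup>2 = 1\<close>; this form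
  exhibits its smoothness at the origin.\<close>

definition metric_coeff :: "real \<Rightarrow> real \<Rightarrow> real" where
  "metric_coeff K s = sincK1 K s * (sincK K s + 1)"

lemma metric_coeff_eq: "(sincK K s)\<^sup>2 - s * metric_coeff K s = 1"
  by (simp add: metric_coeff_def sincK_eq power2_eq_square algebra_simps)

lemma space_form_metric_nth:
  "space_form_metric K x $ i $ j =
    (sincK K (sqn x))\<^sup>2 * (if i = j then 1 else 0) - metric_coeff K (sqn x) * (x $ i * x $ j)"
proof (cases "x = 0")
  case True
  then show ?thesis by (simp add: space_form_metric_def mat_def sqn_def)
next
  case False
  then have "h_fun K (norm x) / norm x = sincK K (sqn x)"
    by (simp add: h_fun_eq_sincK norm_eq_sqn)
  moreover have "(1 - (sincK K (sqn x))\<^sup>2) / sqn x = - metric_coeff K (sqn x)"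
    using metric_coeff_eq[of K "sqn x"] False by (simp add: field_simps)
  moreover have "space_form_metric K x $ i $ j =
      (h_fun K (norm x) / norm x)\<^sup>2 * (if i = j then 1 else 0)
      + (1 - (h_fun K (norm x) / norm x)\<^sup>2) / sqn x * (x $ i * x $ j)"
    using False by (simp add: space_form_metric_def mat_def norm_eq_sqn field_simps)
  ultimately show ?thesis by simp
qed

text \<open>The eigenvalues of the metric are (h/r)^2 in the tangential direction and 1 in the
  radial one; the second factor in the proof is the latter.\<close>

lemma det_space_form_metric: "det (space_form_metric K x) = (sincK K (sqn x))\<^sup>2"
proof -
  let ?e = "(sincK K (sqn x))\<^sup>2" and ?C = "metric_coeff K (sqn x)"
  have "det (space_form_metric K x) = ?e * (?e - sqn x * ?C)"
    by (simp add: det_2 space_form_metric_nth sqn_def power2_eq_square algebra_simps)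
  then show ?thesis by (simp add: metric_coeff_eq)
qed

lemma matrix_inv_eqI:
  fixes A B :: "real^'n^'n"
  assumes "A ** B = mat 1"
  shows "matrix_inv A = B"
proof -
  have "\<exists>A'. A ** A' = mat 1 \<and> A' ** A = mat 1"
    using assms matrix_left_right_inverse by blast
  then have "matrix_inv A ** A = mat 1"
    unfolding matrix_inv_def by (metis (mono_tags, lifting) someI_ex)
  then have "B = matrix_inv A ** (A ** B)"
    by (simp add: matrix_mul_assoc)
  then show ?thesis using assms by simp
qed

text \<open>The components of sqrt(det g) g^(-1) du. Since (h/r)^2 - C r^2 = 1, the inverse of
  (h/r)^2 I - C x x^T is (I + C x x^T) / (h/r)^2, and x^T du is \<open>euler u\<close>.\<close>

definition flux :: "real \<Rightarrow> (real^2 \<Rightarrow> real) \<Rightarrow> 2 \<Rightarrow> real^2 \<Rightarrow> real" where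
  "flux K u i y = inverse (sincK K (sqn y)) *
    (partial_deriv i u y + metric_coeff K (sqn y) * (y $ i * euler u y))"

lemma riem_grad_space_form:
  assumes "x \<in> chart K"
  shows "sqrt (det (space_form_metric K x)) * riem_grad (space_form_metric K) u x $ i = flux K u i x"
proof -
  let ?e = "sincK K (sqn x)" and ?C = "metric_coeff K (sqn x)"
  have e: "?e > 0" by (rule sincK_chart_pos[OF assms])
  define B :: "real^2^2" where
    "B = (\<chi> i j. ((if i = j then 1 else 0) + ?C * (x $ i * x $ j)) / ?e\<^sup>2)"
  have C: "sqn x * ?C = ?e\<^sup>2 - 1" using metric_coeff_eq[of K "sqn x"] by simp
  have C2: "x $ 1 * x $ 1 * ?C = ?e * ?e - 1 - x $ 2 * x $ 2 * ?C"
    using C by (simp add: sqn_def power2_eq_square algebra_simps)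
  have "space_form_metric K x ** B = mat 1"
    using e
    by (simp add: vec_eq_iff forall_2 matrix_matrix_mult_def sum_2 space_form_metric_nth B_def mat_def
        field_simps power2_eq_square) (use C2 in algebra)
  then have "matrix_inv (space_form_metric K x) = B" by (rule matrix_inv_eqI)
  then have "riem_grad (space_form_metric K) u x $ i
      = (partial_deriv i u x + ?C * (x $ i * euler u x)) / ?e\<^sup>2"
    using exhaust_2[of i] e
    by (auto simp: riem_grad_def matrix_vector_mult_def sum_2 B_def euler_def deriv_along_def
        field_simps)
  then show ?thesis
    using e by (simp add: det_space_form_metric flux_def power2_eq_square field_simps)
qed

text \<open>Written with \<open>sincK\<close> in place of sqrt(det g), which it equals on the chart
  because it is positive there.\<close>

definition lap :: "real \<Rightarrow> (real^2 \<Rightarrow> real) \<Rightarrow> real^2 \<Rightarrow> real" where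
  "lap K u x = (partial_deriv 1 (flux K u 1) x + partial_deriv 2 (flux K u 2) x) / sincK K (sqn x)"

lemma laplace_beltrami_space_form:
  assumes "x \<in> chart K"
  shows "laplace_beltrami (space_form_metric K) u x = lap K u x"
proof -
  have "partial_deriv i (\<lambda>y. sqrt (det (space_form_metric K y)) *
      riem_grad (space_form_metric K) u y $ i) x = partial_deriv i (flux K u i) x" for i
    by (rule partial_deriv_cong_open[OF open_chart assms]) (rule riem_grad_space_form)
  then show ?thesis
    using sincK_chart_pos[OF assms]
    by (simp add: laplace_beltrami_def riem_div_def lap_def sum_2 det_space_form_metric)
qed

lemma smooth_on_flux:
  assumes "smooth_on_open U u" "U \<subseteq> chart K"
  shows "smooth_on_open U (flux K u i)"
proof -
  have U: "open U" using assms(1) by (rule smooth_onD)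
  have "sincK K (sqn x) \<noteq> 0" if "x \<in> U" for x
    using sincK_chart_pos[of x K] that assms(2) by force
  then show ?thesis
    unfolding flux_def[abs_def] metric_coeff_def
    by (intro smooth_on_mult smooth_on_inverse smooth_on_add smooth_on_partial smooth_on_euler
        smooth_on_sincK smooth_on_sincK1 smooth_on_sqn smooth_on_const smooth_on_component U assms)
qed

lemma smooth_on_lap:
  assumes "smooth_on_open U u" "U \<subseteq> chart K"
  shows "smooth_on_open U (lap K u)"
proof -
  have U: "open U" using assms(1) by (rule smooth_onD)
  have "sincK K (sqn x) \<noteq> 0" if "x \<in> U" for x
    using sincK_chart_pos[of x K] that assms(2) by force
  then show ?thesis
    unfolding lap_def[abs_def]
    by (intro smooth_on_divide smooth_on_add smooth_on_partial smooth_on_flux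
        smooth_on_sincK smooth_on_sqn U assms)
qed

lemma lap_cong_open:
  assumes "open U" "x \<in> U" "\<And>y. y \<in> U \<Longrightarrow> f y = g y"
  shows "lap K f x = lap K g x"
proof -
  have "flux K f i y = flux K g i y" if "y \<in> U" for i y
    unfolding flux_def euler_def
    using partial_deriv_cong_open[OF assms(1) that assms(3)]
      deriv_along_cong_open[OF assms(1) that assms(3)] by simp
  then show ?thesis
    unfolding lap_def using partial_deriv_cong_open[OF assms(1,2)] by metis
qed

text \<open>Differentiating \<open>metric_coeff_eq\<close> gives the relation. The derivative
  \<open>d\<close> stays implicit and is later eliminated through this relation.\<close>

lemma metric_coeff_deriv:
  obtains d where "(metric_coeff K has_field_derivative d) (at s)"
    "2 * sincK K s * sincK' K s = metric_coeff K s + s * d"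
proof -
  have "(sincK1 K has_field_derivative (\<Sum>n. diffs (\<lambda>n. sin_coeff_K K (Suc n)) n * s ^ n)) (at s)"
    unfolding sincK1_def[abs_def]
    by (rule termdiffs_strong_converges_everywhere[OF summable_sin_coeff_K_Suc])
  from DERIV_mult[OF this DERIV_add[OF DERIV_sincK[of K s] DERIV_const[of 1]]]
  obtain d where d: "(metric_coeff K has_field_derivative d) (at s)"
    unfolding metric_coeff_def[abs_def] by blast
  have "((\<lambda>s. sincK K s * sincK K s - s * metric_coeff K s) has_field_derivative
      (2 * sincK K s * sincK' K s - (metric_coeff K s + s * d))) (at s)"
    by (rule derivative_eq_intros DERIV_sincK d refl)+ (simp add: algebra_simps)
  moreover have "(\<lambda>s. sincK K s * sincK K s - s * metric_coeff K s) = (\<lambda>s. 1)"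
    using metric_coeff_eq[of K] by (simp add: power2_eq_square)
  ultimately have "2 * sincK K s * sincK' K s - (metric_coeff K s + s * d) = 0"
    using DERIV_unique[OF _ DERIV_const] by metis
  with d that show ?thesis by simp
qed

text \<open>The polar form h^2 \<Delta> = (h d/dr)^2 + (d/d\<theta>)^2. Multiplication by h^2
  removes the singularity, so it can be checked at every point, the centre included, by expanding
  both sides in Cartesian second derivatives. Everything is expressed through the flat Laplacian
  \<open>L\<close>, \<open>EEu\<close> and \<open>Eu x\<close>.\<close>

lemma lap_eq_radial_rot:
  assumes u: "smooth_on_open U u" and sub: "U \<subseteq> chart K" and x: "x \<in> U"
  shows "sqn x * (sincK K (sqn x))\<^sup>2 * lap K u x = radial K (radial K u) x + rot (rot u) x"
proof -
  have U: "open U" using u by (rule smooth_onD)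
  let ?s = "sqn x"
  define e where "e = sincK K ?s"
  define e' where "e' = sincK' K ?s"
  define C where "C = metric_coeff K ?s"
  have e: "e > 0" unfolding e_def using sincK_chart_pos sub x by blast
  obtain C' where C': "(metric_coeff K has_field_derivative C') (at ?s)"
    and C'_eq: "2 * e * e' = C + ?s * C'"
    unfolding e_def e'_def C_def by (rule metric_coeff_deriv)
  have eC: "e\<^sup>2 - ?s * C = 1" unfolding e_def C_def by (rule metric_coeff_eq)
  define a where "a = partial_deriv 1 u"
  define b where "b = partial_deriv 2 u"
  have ab: "smooth_on_open U a" "smooth_on_open U b"
    unfolding a_def b_def by (rule smooth_on_partial[OF u])+
  define Eu where "Eu = euler u"
  have Eu: "smooth_on_open U Eu" unfolding Eu_def by (rule smooth_on_euler[OF u])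
  have Eu_eq: "Eu = (\<lambda>x. x $ 1 * a x + x $ 2 * b x)"
    by (simp add: Eu_def euler_def deriv_along_def a_def b_def fun_eq_iff)
  have comp: "smooth_on_open U (\<lambda>x. x $ i)" for i by (rule smooth_on_component[OF U])
  have pEu: "partial_deriv i Eu x = x $ 1 * partial_deriv i a x + (if i = 1 then a x else 0) +
      (x $ 2 * partial_deriv i b x + (if i = 2 then b x else 0))" for i
    unfolding Eu_eq
    by (simp add: smooth_on_partial_add[OF smooth_on_mult[OF comp ab(1)] smooth_on_mult[OF comp ab(2)] x]
        smooth_on_partial_mult[OF comp ab(1) x] smooth_on_partial_mult[OF comp ab(2) x]
        partial_deriv_component)
  have ne: "sincK K (sqn y) \<noteq> 0" if "y \<in> U" for y
    using sincK_chart_pos[of y K] that sub by force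
  have sG: "smooth_on_open U (\<lambda>y. inverse (sincK K (sqn y)))"
    by (intro smooth_on_inverse smooth_on_sincK smooth_on_sqn U ne)
  have sC: "smooth_on_open U (\<lambda>y. metric_coeff K (sqn y))"
    unfolding metric_coeff_def
    by (intro smooth_on_mult smooth_on_add smooth_on_sincK smooth_on_sincK1 smooth_on_sqn
        smooth_on_const U)
  have "((\<lambda>s. inverse (sincK K s)) has_field_derivative - (e' / e\<^sup>2)) (at ?s)"
    unfolding e_def e'_def using e[unfolded e_def]
    by (auto intro!: derivative_eq_intros DERIV_sincK simp: power2_eq_square field_simps)
  from partial_deriv_radial[OF this]
  have pG: "partial_deriv i (\<lambda>y. inverse (sincK K (sqn y))) x = - 2 * e' / e\<^sup>2 * x $ i" for i
    by simp
  have pC: "partial_deriv i (\<lambda>y. metric_coeff K (sqn y)) x = 2 * C' * x $ i" for i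
    by (rule partial_deriv_radial[OF C'])
  have pF: "partial_deriv i (flux K u i) x =
      inverse e * (partial_deriv i (partial_deriv i u) x +
        (C * (x $ i * partial_deriv i Eu x + Eu x) + 2 * C' * x $ i * (x $ i * Eu x)))
      + - 2 * e' / e\<^sup>2 * x $ i * (partial_deriv i u x + C * (x $ i * Eu x))" for i
  proof -
    have 1: "smooth_on_open U (\<lambda>y. y $ i * Eu y)" by (intro smooth_on_mult comp Eu)
    have 2: "smooth_on_open U (\<lambda>y. metric_coeff K (sqn y) * (y $ i * Eu y))"
      by (intro smooth_on_mult 1 sC)
    have 3: "smooth_on_open U (\<lambda>y. partial_deriv i u y + metric_coeff K (sqn y) * (y $ i * Eu y))"
      by (intro smooth_on_add 2 smooth_on_partial u)
    show ?thesis
      unfolding flux_def[abs_def] Eu_def[symmetric] smooth_on_partial_mult[OF sG 3 x]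
        smooth_on_partial_add[OF smooth_on_partial[OF u] 2 x] smooth_on_partial_mult[OF sC 1 x]
        smooth_on_partial_mult[OF comp Eu x] pG pC partial_deriv_component
      by (simp add: e_def C_def)
  qed
  define L where "L = partial_deriv 1 a x + partial_deriv 2 b x"
  define EEu where "EEu = euler Eu x"
  have EEu_eq: "EEu = x $ 1 * partial_deriv 1 Eu x + x $ 2 * partial_deriv 2 Eu x"
    by (simp add: EEu_def euler_def deriv_along_def)
  have div: "partial_deriv 1 (flux K u 1) x + partial_deriv 2 (flux K u 2) x =
      inverse e * (L + C * EEu + 2 * (C + ?s * C') * Eu x) - 2 * e' / e\<^sup>2 * (1 + C * ?s) * Eu x"
    unfolding pF L_def EEu_eq a_def[symmetric] b_def[symmetric] sqn_def Eu_eq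
    by (simp add: algebra_simps add_divide_distrib)
  have "rot u = (\<lambda>x. x $ 1 * b x + (-1) * (x $ 2 * a x))"
    by (simp add: rot_def deriv_along_def a_def b_def fun_eq_iff)
  then have "rot (rot u) x = deriv_along (\<lambda>x. vector [- x $ 2, x $ 1])
      (\<lambda>x. x $ 1 * b x + (-1) * (x $ 2 * a x)) x"
    by (simp add: rot_def)
  also have "\<dots> = x $ 1 * rot b x - x $ 2 * b x - x $ 2 * rot a x - x $ 1 * a x"
    unfolding rot_def
      deriv_along_add[OF smooth_on_mult[OF comp ab(2)]
        smooth_on_mult[OF smooth_on_const[OF U] smooth_on_mult[OF comp ab(1)]] x]
      deriv_along_mult[OF comp ab(1) x] deriv_along_mult[OF comp ab(2) x] deriv_along_component
      deriv_along_cmult[OF smooth_on_mult[OF comp ab(1)] x]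
    by simp
  \<comment> \<open>The mixed derivatives enter the left side and \<open>EEu\<close> as the same sum
    of \<open>partial_deriv 1 b x\<close> and \<open>partial_deriv 2 a x\<close>, and the
    first-order terms on both sides are those of \<open>EEu\<close>.\<close>
  finally have rot: "rot (rot u) x = ?s * L - EEu"
    unfolding EEu_eq pEu L_def sqn_def by (simp add: rot_def deriv_along_def algebra_simps)
  have "radial K (radial K u) x = e * euler (\<lambda>x. sincK K (sqn x) * Eu x) x"
    unfolding radial_eq[abs_def] e_def Eu_def ..
  also have "euler (\<lambda>x. sincK K (sqn x) * Eu x) x = e * EEu + 2 * ?s * e' * Eu x"
    unfolding euler_def
      deriv_along_mult[OF smooth_on_sincK[OF smooth_on_sqn[OF U]] Eu x]
      deriv_along_compose[OF smooth_on_sqn[OF U] x DERIV_sincK] deriv_along_sqn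
    by (simp add: EEu_def euler_def e_def e'_def sqn_def algebra_simps)
  finally have rad: "radial K (radial K u) x = e\<^sup>2 * EEu + 2 * ?s * e * e' * Eu x"
    by (simp add: algebra_simps power2_eq_square)
  have "1 + C * ?s = e\<^sup>2" using eC by (simp add: algebra_simps)
  then have "e * (partial_deriv 1 (flux K u 1) x + partial_deriv 2 (flux K u 2) x) =
      L + C * EEu + 2 * (2 * e * e') * Eu x - 2 * e' * e * Eu x"
    unfolding div C'_eq[symmetric] using e by (simp add: field_simps power2_eq_square)
  then have "e\<^sup>2 * lap K u x = L + C * EEu + 2 * e * e' * Eu x"
    using e by (simp add: lap_def e_def[symmetric] power2_eq_square)
  then have "?s * e\<^sup>2 * lap K u x = ?s * L + (?s * C) * EEu + 2 * ?s * e * e' * Eu x"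
    by (simp add: algebra_simps)
  also have "?s * C = e\<^sup>2 - 1" using eC by simp
  finally show ?thesis
    unfolding rot rad e_def[symmetric] by (simp add: algebra_simps)
qed

section \<open>The radial profile of the biharmonic modes\<close>

text \<open>In the conformal coordinate \<open>q = tan_K(r/2)\<^sup>2\<close>, the equation \<open>\<Delta>(f(q) w) = w\<close> for a
  harmonic mode \<open>w\<close> of degree \<open>k\<close> is \<open>q f'' + (k + 1) f' = 1 / (1 + K q)\<^sup>2\<close>. The sequence below
  consists of a solution \<open>f\<close> that is smooth at \<open>q = 0\<close> and of its derivatives.\<close>

definition profile :: "real \<Rightarrow> nat \<Rightarrow> nat \<Rightarrow> real \<Rightarrow> real" where
  "profile K k n q = integral {0..1} (\<lambda>s. case n of
      0 \<Rightarrow> s ^ k * q / (1 + K * q * s)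
    | Suc m \<Rightarrow> s ^ k * (- K * s) ^ m * fact (Suc m) / (1 + K * q * s) ^ Suc (Suc m))"

lemma one_plus_pos:
  fixes K q s :: real
  assumes "1 + K * q > 0" "s \<in> {0..1}"
  shows "1 + K * q * s > 0"
proof (cases "s = 1")
  case False
  have "1 + K * q * s = (1 - s) + s * (1 + K * q)" by (simp add: algebra_simps)
  moreover have "1 - s > 0" "s * (1 + K * q) \<ge> 0" using assms False by auto
  ultimately show ?thesis by linarith
qed (use assms in simp)

lemma has_field_derivative_profile:
  assumes q: "1 + K * q > 0"
  shows "(profile K k n has_field_derivative profile K k (Suc n) q) (at q)"
proof -
  let ?S = "{q. 1 + K * q > 0}"
  define f where "f n q s = (case n of
      0 \<Rightarrow> s ^ k * q / (1 + K * q * s)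
    | Suc m \<Rightarrow> s ^ k * (- K * s) ^ m * fact (Suc m) / (1 + K * q * s) ^ Suc (Suc m))"
    for n :: nat and q s :: real
  have "open ?S" by (intro open_Collect_less continuous_intros)
  have "convex ?S"
  proof (rule convexI)
    fix x y u v :: real
    assume xy: "x \<in> ?S" "y \<in> ?S" and uv: "0 \<le> u" "0 \<le> v" "u + v = 1"
    have "1 + K * (u *\<^sub>R x + v *\<^sub>R y) = u * (1 + K * x) + v * (1 + K * y)"
      using uv(3) by (simp add: algebra_simps)
    moreover have "u > 0 \<or> v > 0" using uv by linarith
    then have "u * (1 + K * x) + v * (1 + K * y) > 0"
      using xy uv by (auto intro: add_pos_nonneg add_nonneg_pos)
    ultimately show "u *\<^sub>R x + v *\<^sub>R y \<in> ?S" by simp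
  qed
  have pos: "1 + K * q * s \<noteq> 0" if "q \<in> ?S" "s \<in> {0..1}" for q s
    using one_plus_pos[of K q s] that by auto
  have cont: "continuous_on (?S \<times> cbox 0 1) (\<lambda>(q, s). f n q s)" for n
    unfolding f_def case_prod_beta
    by (cases n) (use pos in \<open>auto intro!: continuous_intros\<close>)
  have der: "((\<lambda>q. f n q s) has_field_derivative f (Suc n) q s) (at q within ?S)"
    if qs: "q \<in> ?S" "s \<in> cbox 0 1" for q s
  proof (cases n)
    case 0
    show ?thesis
      unfolding 0 f_def using pos[of q s] qs
      by (auto intro!: derivative_eq_intros simp: field_simps power2_eq_square)
  next
    case (Suc m)
    define t where "t = 1 + K * q * s"
    have t: "t \<noteq> 0" unfolding t_def using pos[of q s] qs by simp
    have 1: "((\<lambda>q. 1 + K * q * s) has_field_derivative K * s) (at q within ?S)"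
      by (auto intro!: derivative_eq_intros)
    have "((\<lambda>q. inverse (1 + K * q * s)) has_field_derivative
        - (inverse t * (K * s) * inverse t)) (at q within ?S)"
      using DERIV_inverse'[OF 1] t by (simp add: t_def)
    from DERIV_cmult[OF DERIV_power_Suc[OF this, of "Suc m"], of "s ^ k * (- K * s) ^ m * fact (Suc m)"]
    have "((\<lambda>q. s ^ k * (- K * s) ^ m * fact (Suc m) * inverse (1 + K * q * s) ^ Suc (Suc m))
        has_field_derivative s ^ k * (- K * s) ^ m * fact (Suc m) *
        ((1 + of_nat (Suc m)) * (- (inverse t * (K * s) * inverse t) * inverse t ^ Suc m)))
        (at q within ?S)"
      by (simp add: t_def)
    moreover have "s ^ k * (- K * s) ^ m * fact (Suc m) *
        ((1 + of_nat (Suc m)) * (- (inverse t * (K * s) * inverse t) * inverse t ^ Suc m))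
        = f (Suc n) q s"
      unfolding f_def Suc t_def[symmetric]
      by (simp add: divide_inverse power_inverse algebra_simps)
    moreover have "(\<lambda>q. f n q s) =
        (\<lambda>q. s ^ k * (- K * s) ^ m * fact (Suc m) * inverse (1 + K * q * s) ^ Suc (Suc m))"
      unfolding f_def Suc by (simp add: divide_inverse power_inverse)
    ultimately show ?thesis by (simp only:)
  qed
  have int: "f n q integrable_on cbox 0 1" if "q \<in> ?S" for q
  proof (rule integrable_continuous)
    show "continuous_on (cbox 0 1) (f n q)"
      by (rule continuous_on_compose2[OF cont, of _ "\<lambda>s. (q, s)", simplified])
        (use that in \<open>auto intro!: continuous_intros\<close>)
  qed
  have "((\<lambda>q. integral (cbox 0 1) (f n q)) has_field_derivative
      integral (cbox 0 1) (f (Suc n) q)) (at q within ?S)"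
    using q by (intro leibniz_rule_field_derivative der int cont \<open>convex ?S\<close>) auto
  then have "((\<lambda>q. integral (cbox 0 1) (f n q)) has_field_derivative
      integral (cbox 0 1) (f (Suc n) q)) (at q)"
    using at_within_open[OF _ \<open>open ?S\<close>] q by simp
  then show ?thesis
    unfolding profile_def[abs_def] f_def by simp
qed

text \<open>The combination of integrands is the derivative in s of s^(k+1) / (1 + K q s)^2, so only
  the value at s = 1 survives.\<close>

lemma profile_ode:
  assumes q: "1 + K * q > 0"
  shows "q * profile K k 2 q + (real k + 1) * profile K k 1 q = 1 / (1 + K * q)\<^sup>2"
proof -
  let ?a = "\<lambda>s. s ^ k / (1 + K * q * s)\<^sup>2" and ?b = "\<lambda>s. s ^ k * (- K * s) * 2 / (1 + K * q * s) ^ 3"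
  have pos: "1 + K * q * s \<noteq> 0" if "s \<in> {0..1}" for s
    using one_plus_pos[OF q that] by simp
  have "((\<lambda>s. q * ?b s + (real k + 1) * ?a s) has_integral
      (1 ^ Suc k / (1 + K * q * 1)\<^sup>2 - 0 ^ Suc k / (1 + K * q * 0)\<^sup>2)) {0..1}"
  proof (rule fundamental_theorem_of_calculus)
    fix s :: real assume s: "s \<in> {0..1}"
    define t where "t = 1 + K * q * s"
    have t: "t \<noteq> 0" unfolding t_def by (rule pos[OF s])
    have 1: "((\<lambda>s. 1 + K * q * s) has_field_derivative K * q) (at s within {0..1})"
      by (auto intro!: derivative_eq_intros)
    have 2: "((\<lambda>s. s ^ Suc k) has_field_derivative (1 + real k) * s ^ k) (at s within {0..1})"
      using DERIV_power_Suc[OF DERIV_ident, of k] by (simp add: algebra_simps)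
    have "((\<lambda>s. (1 + K * q * s)\<^sup>2) has_field_derivative 2 * (K * q) * t) (at s within {0..1})"
      using DERIV_power_Suc[OF 1, of 1] by (simp add: t_def power2_eq_square mult_ac)
    from DERIV_divide[OF 2 this]
    have "((\<lambda>s. s ^ Suc k / (1 + K * q * s)\<^sup>2) has_field_derivative
        ((1 + real k) * s ^ k * t\<^sup>2 - s ^ Suc k * (2 * (K * q) * t)) / (t\<^sup>2 * t\<^sup>2)) (at s within {0..1})"
      using t by (simp add: t_def)
    moreover have "((1 + real k) * s ^ k * t\<^sup>2 - s ^ Suc k * (2 * (K * q) * t)) / (t\<^sup>2 * t\<^sup>2)
        = q * ?b s + (real k + 1) * ?a s"
      unfolding t_def[symmetric] using t
      by (simp add: divide_simps) (simp add: eval_nat_numeral algebra_simps)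
    ultimately show "((\<lambda>s. s ^ Suc k / (1 + K * q * s)\<^sup>2) has_vector_derivative
        q * ?b s + (real k + 1) * ?a s) (at s within {0..1})"
      by (simp add: has_real_derivative_iff_has_vector_derivative[symmetric])
  qed simp
  then have "integral {0..1} (\<lambda>s. q * ?b s + (real k + 1) * ?a s) = 1 / (1 + K * q)\<^sup>2"
    by (simp add: integral_unique)
  moreover have "integral {0..1} (\<lambda>s. q * ?b s + (real k + 1) * ?a s)
      = q * integral {0..1} ?b + (real k + 1) * integral {0..1} ?a"
  proof -
    have "?a integrable_on {0..1}" "?b integrable_on {0..1}"
      using pos by (auto intro!: integrable_continuous_interval continuous_intros)
    then show ?thesis
      by (simp only: integral_add integrable_on_mult_right integral_mult_right)
  qed
  moreover have "profile K k 2 q = integral {0..1} ?b"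
    unfolding profile_def numeral_2_eq_2 by (simp add: numeral_3_eq_3 numeral_2_eq_2 mult_ac)
  moreover have "profile K k 1 q = integral {0..1} ?a"
    unfolding profile_def by (simp add: numeral_2_eq_2)
  ultimately show ?thesis by simp
qed

section \<open>Harmonic and biharmonic modes\<close>

text \<open>This is tan_K(r/2) / r as a function of r^2, so that multiplying x by it gives the
  conformal coordinate z (stereographic projection if K > 0).\<close>

definition conf_factor :: "real \<Rightarrow> real^2 \<Rightarrow> real" where
  "conf_factor K x = sincK K (sqn x) / (1 + cosK K (sqn x))"

definition conf_coord :: "real \<Rightarrow> real^2 \<Rightarrow> complex" where
  "conf_coord K x = Complex (conf_factor K x * x $ 1) (conf_factor K x * x $ 2)"

definition mode_re :: "real \<Rightarrow> nat \<Rightarrow> real^2 \<Rightarrow> real" where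
  "mode_re K k x = Re (conf_coord K x ^ k)"

definition mode_im :: "real \<Rightarrow> nat \<Rightarrow> real^2 \<Rightarrow> real" where
  "mode_im K k x = Im (conf_coord K x ^ k)"

definition conf_sqn :: "real \<Rightarrow> real^2 \<Rightarrow> real" where
  "conf_sqn K x = sqn x * (conf_factor K x)\<^sup>2"

lemma one_plus_cosK_pos: "x \<in> chart K \<Longrightarrow> 1 + cosK K (sqn x) > 0"
  using c_fun_gt_m1[of "norm x" K] by (simp add: chart_def c_fun_eq_cosK norm_eq_sqn)

text \<open>The identity 1 + tan^2 = 1 / cos^2 at r/2, with 2 cos^2(r/2) = 1 + cos r. Its positivity
  keeps q in the range where \<open>profile\<close> is differentiable.\<close>

lemma one_plus_conf_sqn:
  assumes "x \<in> chart K"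
  shows "1 + K * conf_sqn K x = 2 / (1 + cosK K (sqn x))"
proof -
  define c where "c = cosK K (sqn x)"
  have c: "1 + c > 0" unfolding c_def by (rule one_plus_cosK_pos[OF assms])
  have "K * sqn x * (sincK K (sqn x))\<^sup>2 = 1 - c\<^sup>2"
    using cosK_sincK_id[of "sqn x" K] unfolding c_def by simp
  then have "K * conf_sqn K x = (1 - c\<^sup>2) / (1 + c)\<^sup>2"
    unfolding conf_sqn_def conf_factor_def c_def[symmetric]
    by (simp add: power_divide mult_ac)
  also have "\<dots> = 2 / (1 + c) - 1"
    using c by (simp add: divide_simps) (simp add: power2_eq_square algebra_simps)
  finally show ?thesis unfolding c_def by simp
qed

context
  fixes U :: "(real^2) set" and K :: real
  assumes U: "open U" and sub: "U \<subseteq> chart K"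
begin

lemma smooth_conf_factor: "smooth_on_open U (conf_factor K)"
proof -
  have "1 + cosK K (sqn x) \<noteq> 0" if "x \<in> U" for x
    using one_plus_cosK_pos[of x K] sub that by force
  then show ?thesis
    unfolding conf_factor_def[abs_def]
    by (intro smooth_on_divide smooth_on_add smooth_on_const smooth_on_cosK smooth_on_sincK
        smooth_on_sqn U)
qed

lemma smooth_conf_sqn: "smooth_on_open U (conf_sqn K)"
  unfolding conf_sqn_def[abs_def]
  by (intro smooth_on_mult smooth_on_power smooth_on_sqn smooth_conf_factor U)

lemma smooth_coord: "smooth_on_open U (\<lambda>x. conf_factor K x * x $ i)"
  by (intro smooth_on_mult smooth_conf_factor smooth_on_component U)

lemma mode_Suc:
  "mode_re K (Suc k) x = (conf_factor K x * x $ 1) * mode_re K k x + (-1) * ((conf_factor K x * x $ 2) * mode_im K k x)"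
  "mode_im K (Suc k) x = (conf_factor K x * x $ 1) * mode_im K k x + (conf_factor K x * x $ 2) * mode_re K k x"
  by (simp_all add: mode_re_def mode_im_def conf_coord_def)

lemma smooth_mode: "smooth_on_open U (mode_re K k)" "smooth_on_open U (mode_im K k)"
proof (induction k)
  case 0
  case 1
  show ?case unfolding mode_re_def by (simp add: smooth_on_const U)
  case 2
  show ?case unfolding mode_im_def by (simp add: smooth_on_const U)
next
  case (Suc k)
  case 1
  show ?case unfolding mode_Suc[abs_def]
    by (intro smooth_on_add smooth_on_mult[OF smooth_coord] smooth_on_mult[OF smooth_on_const[OF U]] Suc)
  case 2
  show ?case unfolding mode_Suc[abs_def]
    by (intro smooth_on_add smooth_on_mult[OF smooth_coord] Suc)
qed

context
  fixes x :: "real^2"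
  assumes x: "x \<in> U"
begin

text \<open>This is h d/dr tan_K(r/2) = tan_K(r/2): as \<open>radial K\<close> multiplies each
  coordinate of x by \<open>sincK\<close>, the factor found here leaves the components of z
  fixed.\<close>

lemma radial_conf_factor: "radial K (conf_factor K) x = conf_factor K x * (1 - sincK K (sqn x))"
proof -
  define c where "c = cosK K (sqn x)"
  define e where "e = sincK K (sqn x)"
  define e' where "e' = sincK' K (sqn x)"
  let ?s = "sqn x"
  have c: "1 + c > 0" unfolding c_def using one_plus_cosK_pos sub x by blast
  have id: "c\<^sup>2 + K * ?s * e\<^sup>2 = 1" unfolding c_def e_def by (rule cosK_sincK_id) simp
  have e': "e + 2 * ?s * e' = c" unfolding c_def e_def e'_def by (rule sincK'_eq)
  have "((\<lambda>s. sincK K s / (1 + cosK K s)) has_field_derivative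
      (e' * (1 + c) - e * (- K / 2 * e)) / (1 + c)\<^sup>2) (at ?s)"
    using c unfolding c_def e_def e'_def
    by (auto intro!: derivative_eq_intros DERIV_sincK DERIV_cosK simp: power2_eq_square)
  note deriv_along_compose[OF smooth_on_sqn[OF U] x this]
  moreover have "(a *\<^sub>R x) $ 1 * x $ 1 + (a *\<^sub>R x) $ 2 * x $ 2 = a * ?s" for a
    by (simp add: sqn_def algebra_simps)
  ultimately have "radial K (conf_factor K) x =
      (e' * (1 + c) - e * (- K / 2 * e)) / (1 + c)\<^sup>2 * (2 * (e * ?s))"
    unfolding radial_def conf_factor_def[abs_def] deriv_along_sqn e_def by (simp only:)
  also have "\<dots> = e * (2 * ?s * e' * (1 + c) + K * ?s * e\<^sup>2) / (1 + c)\<^sup>2"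
    by (simp add: power2_eq_square algebra_simps)
  also have "2 * ?s * e' = c - e" using e' by simp
  also have "K * ?s * e\<^sup>2 = (1 + c) * (1 - c)" using id by (simp add: power2_eq_square algebra_simps)
  also have "e * ((c - e) * (1 + c) + (1 + c) * (1 - c)) / (1 + c)\<^sup>2 = e / (1 + c) * (1 - e)"
    using c by (simp add: divide_simps) (simp add: power2_eq_square algebra_simps)
  finally show ?thesis by (simp add: conf_factor_def[abs_def] e_def c_def)
qed

lemma rot_radial_fun:
  assumes "(\<phi> has_field_derivative d) (at (sqn x))"
  shows "rot (\<lambda>x. \<phi> (sqn x)) x = 0"
  unfolding rot_def deriv_along_compose[OF smooth_on_sqn[OF U] x assms] deriv_along_sqn
  by simp

lemma rot_conf_factor: "rot (conf_factor K) x = 0"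
proof -
  have "1 + cosK K (sqn x) \<noteq> 0"
    using one_plus_cosK_pos[of x K] sub x by force
  then show ?thesis
    unfolding conf_factor_def[abs_def]
    by (intro rot_radial_fun) (rule derivative_eq_intros DERIV_sincK DERIV_cosK refl | assumption)+
qed

lemma coord_derivations:
  shows "radial K (\<lambda>x. conf_factor K x * x $ i) x = conf_factor K x * x $ i"
    and "rot (\<lambda>x. conf_factor K x * x $ 1) x = - (conf_factor K x * x $ 2)"
    and "rot (\<lambda>x. conf_factor K x * x $ 2) x = conf_factor K x * x $ 1"
  unfolding radial_def rot_def deriv_along_mult[OF smooth_conf_factor smooth_on_component[OF U] x]
    deriv_along_component
  by (simp_all add: radial_conf_factor[unfolded radial_def] rot_conf_factor[unfolded rot_def]
      algebra_simps)

text \<open>By the Leibniz rule, starting from z: h d/dr z^k = k z^k and d/d\<theta> z^k = i k z^k,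
  split into real and imaginary parts. Hence (h d/dr)^2 + (d/d\<theta>)^2 annihilates both
  parts.\<close>

lemma mode_derivations:
  "radial K (mode_re K k) x = k * mode_re K k x \<and> radial K (mode_im K k) x = k * mode_im K k x \<and>
   rot (mode_re K k) x = - k * mode_im K k x \<and> rot (mode_im K k) x = k * mode_re K k x"
proof (induction k)
  case 0
  show ?case
    by (simp add: mode_re_def[abs_def] mode_im_def[abs_def] radial_def rot_def deriv_along_const)
next
  case (Suc k)
  let ?m = "\<lambda>i x. conf_factor K x * x $ i"
  have re: "deriv_along X (mode_re K (Suc k)) x =
      ?m 1 x * deriv_along X (mode_re K k) x + deriv_along X (?m 1) x * mode_re K k x
      - (?m 2 x * deriv_along X (mode_im K k) x + deriv_along X (?m 2) x * mode_im K k x)" for X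
    unfolding mode_Suc[abs_def]
      deriv_along_add[OF smooth_on_mult[OF smooth_coord smooth_mode(1)]
        smooth_on_mult[OF smooth_on_const[OF U] smooth_on_mult[OF smooth_coord smooth_mode(2)]] x]
      deriv_along_cmult[OF smooth_on_mult[OF smooth_coord smooth_mode(2)] x]
      deriv_along_mult[OF smooth_coord smooth_mode(1) x]
      deriv_along_mult[OF smooth_coord smooth_mode(2) x] by simp
  have im: "deriv_along X (mode_im K (Suc k)) x =
      ?m 1 x * deriv_along X (mode_im K k) x + deriv_along X (?m 1) x * mode_im K k x
      + (?m 2 x * deriv_along X (mode_re K k) x + deriv_along X (?m 2) x * mode_re K k x)" for X
    unfolding mode_Suc[abs_def]
      deriv_along_add[OF smooth_on_mult[OF smooth_coord smooth_mode(2)]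
        smooth_on_mult[OF smooth_coord smooth_mode(1)] x]
      deriv_along_mult[OF smooth_coord smooth_mode(1) x]
      deriv_along_mult[OF smooth_coord smooth_mode(2) x] by simp
  show ?case
    using Suc unfolding radial_def rot_def re im coord_derivations[unfolded radial_def rot_def]
    by (simp add: mode_Suc algebra_simps)
qed

lemma conf_sqn_derivations:
  "radial K (conf_sqn K) x = 2 * conf_sqn K x" "rot (conf_sqn K) x = 0"
proof -
  let ?m = "\<lambda>i x. conf_factor K x * x $ i"
  have eq: "conf_sqn K = (\<lambda>x. ?m 1 x * ?m 1 x + ?m 2 x * ?m 2 x)"
    by (simp add: conf_sqn_def sqn_def fun_eq_iff power2_eq_square algebra_simps)
  have "deriv_along X (conf_sqn K) x =
      2 * (?m 1 x * deriv_along X (?m 1) x + ?m 2 x * deriv_along X (?m 2) x)" for X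
    unfolding eq deriv_along_add[OF smooth_on_mult[OF smooth_coord smooth_coord]
        smooth_on_mult[OF smooth_coord smooth_coord] x]
      deriv_along_mult[OF smooth_coord smooth_coord x] by simp
  then show "radial K (conf_sqn K) x = 2 * conf_sqn K x" "rot (conf_sqn K) x = 0"
    using coord_derivations unfolding radial_def rot_def by (simp_all add: eq)
qed

end

lemma one_plus_conf_sqn_pos: "x \<in> U \<Longrightarrow> 1 + K * conf_sqn K x > 0"
  using one_plus_conf_sqn[of x K] one_plus_cosK_pos[of x K] sub by (auto intro: divide_pos_pos)

text \<open>Stated for any sequence \<open>D\<close> of successive derivatives because it serves
  twice: the sequence 1, 0, 0, ... gives the harmonicity of the modes, and \<open>profile\<close>
  shifted by a constant gives the biharmonic functions.\<close>

lemma profile_mode_lap: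
  fixes D :: "nat \<Rightarrow> real \<Rightarrow> real" and k :: nat
  assumes D: "\<And>n q. 1 + K * q > 0 \<Longrightarrow> (D n has_field_derivative D (Suc n) q) (at q)"
  defines "u \<equiv> (\<lambda>x. D 0 (conf_sqn K x) * mode_re K k x)"
  shows "smooth_on_open U u"
    and "\<And>x. x \<in> U \<Longrightarrow> radial K u x =
      (2 * conf_sqn K x * D 1 (conf_sqn K x) + real k * D 0 (conf_sqn K x)) * mode_re K k x"
    and "\<And>x. x \<in> U \<Longrightarrow> sqn x * (sincK K (sqn x))\<^sup>2 * lap K u x = 4 * conf_sqn K x *
      (conf_sqn K x * D 2 (conf_sqn K x) + (real k + 1) * D 1 (conf_sqn K x)) * mode_re K k x"
proof -
  let ?q = "conf_sqn K"
  have sD: "smooth_on_open U (\<lambda>x. D n (?q x))" for n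
    by (rule smooth_on_compose[where D = D and S = "{q. 1 + K * q > 0}", OF smooth_conf_sqn])
      (use D one_plus_conf_sqn_pos in simp_all)
  show u: "smooth_on_open U u"
    unfolding u_def by (intro smooth_on_mult sD smooth_mode)
  have dD: "deriv_along X (\<lambda>x. D n (?q x)) x = D (Suc n) (?q x) * deriv_along X ?q x"
    if "x \<in> U" for X n x
    by (rule deriv_along_compose[OF smooth_conf_sqn that D[OF one_plus_conf_sqn_pos[OF that]]])
  have radD: "radial K (\<lambda>x. D n (?q x)) x = 2 * ?q x * D (Suc n) (?q x)" if "x \<in> U" for n x
    using dD[OF that] conf_sqn_derivations[OF that] by (simp add: radial_def)
  have rotD: "rot (\<lambda>x. D n (?q x)) x = 0" if "x \<in> U" for n x
    using dD[OF that] conf_sqn_derivations[OF that] by (simp add: rot_def)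
  let ?v = "\<lambda>x. ((2 * ?q x) * D 1 (?q x) + real k * D 0 (?q x)) * mode_re K k x"
  show rad: "radial K u x = ?v x" if "x \<in> U" for x
    using radD[OF that, of 0] mode_derivations[OF that, of k]
    unfolding u_def radial_def deriv_along_mult[OF sD smooth_mode(1) that]
    by (simp add: algebra_simps)
  fix x assume x: "x \<in> U"
  have "radial K (radial K u) x = radial K ?v x"
    unfolding radial_def by (rule deriv_along_cong_open[OF U x]) (use rad in \<open>simp add: radial_def\<close>)
  also have "\<dots> = (4 * (?q x)\<^sup>2 * D 2 (?q x) + 4 * ?q x * D 1 (?q x) + 4 * real k * ?q x * D 1 (?q x)
      + (real k)\<^sup>2 * D 0 (?q x)) * mode_re K k x"
  proof -
    note q2 = smooth_on_mult[OF smooth_on_const[OF U, of 2] smooth_conf_sqn]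
    note 1 = smooth_on_mult[OF q2 sD[of 1]]
    note 2 = smooth_on_mult[OF smooth_on_const[OF U, of "real k"] sD[of 0]]
    show ?thesis
      using radD[OF x, of 0] radD[OF x, of 1] mode_derivations[OF x, of k] conf_sqn_derivations[OF x]
      unfolding radial_def deriv_along_mult[OF smooth_on_add[OF 1 2] smooth_mode(1) x]
        deriv_along_add[OF 1 2 x] deriv_along_mult[OF q2 sD[of 1] x]
        deriv_along_cmult[OF smooth_conf_sqn x] deriv_along_cmult[OF sD[of 0] x]
      by (simp add: numeral_2_eq_2 algebra_simps power2_eq_square)
  qed
  finally have rr: "radial K (radial K u) x = \<dots>" .
  have rot1: "rot u y = D 0 (?q y) * ((- real k) * mode_im K k y)" if "y \<in> U" for y
    using rotD[OF that, of 0] mode_derivations[OF that, of k]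
    unfolding u_def rot_def deriv_along_mult[OF sD smooth_mode(1) that] by simp
  have "rot (rot u) x = rot (\<lambda>y. D 0 (?q y) * ((- real k) * mode_im K k y)) x"
    unfolding rot_def by (rule deriv_along_cong_open[OF U x]) (use rot1 in \<open>simp add: rot_def\<close>)
  also have "\<dots> = - (real k)\<^sup>2 * D 0 (?q x) * mode_re K k x"
    using rotD[OF x, of 0] mode_derivations[OF x, of k]
    unfolding rot_def
      deriv_along_mult[OF sD smooth_on_mult[OF smooth_on_const[OF U] smooth_mode(2)] x]
      deriv_along_cmult[OF smooth_mode(2) x]
    by (simp add: power2_eq_square)
  finally show "sqn x * (sincK K (sqn x))\<^sup>2 * lap K u x =
      4 * ?q x * (?q x * D 2 (?q x) + (real k + 1) * D 1 (?q x)) * mode_re K k x"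
    unfolding lap_eq_radial_rot[OF u sub x] rr by (simp add: algebra_simps power2_eq_square)
qed

text \<open>The polar form of the Laplacian carries the factor \<open>sqn x\<close> and so
  determines \<open>lap\<close> only away from the centre; continuity supplies the missing
  point.\<close>

lemma eq_at_origin:
  fixes f g :: "real^2 \<Rightarrow> real"
  assumes "continuous_on U f" "continuous_on U g" "x \<in> U"
    and "\<And>y. y \<in> U \<Longrightarrow> y \<noteq> 0 \<Longrightarrow> f y = g y"
  shows "f x = g x"
proof (cases "x = 0")
  case True
  have "(f \<longlongrightarrow> f x) (at x)" "(g \<longlongrightarrow> g x) (at x)"
    using assms(1-3) U by (auto simp: continuous_on_eq_continuous_at isCont_def)
  moreover have "eventually (\<lambda>y. f y = g y) (at x)"
    unfolding eventually_at_topological using U assms(3,4) True by blast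
  ultimately show ?thesis
    using tendsto_unique[of "at x" g "f x" "g x"] tendsto_cong by fastforce
qed (use assms in blast)

lemma lap_mode:
  assumes "x \<in> U"
  shows "lap K (mode_re K k) x = 0"
proof (rule eq_at_origin[where g = "\<lambda>x. 0", OF _ _ assms])
  show "continuous_on U (lap K (mode_re K k))"
    by (rule smooth_on_continuous[OF smooth_on_lap[OF smooth_mode(1) sub]])
  fix y assume y: "y \<in> U" "y \<noteq> 0"
  define D :: "nat \<Rightarrow> real \<Rightarrow> real" where "D n q = (if n = 0 then 1 else 0)" for n q
  have "(D n has_field_derivative D (Suc n) q) (at q)" for n q
    unfolding D_def by simp
  from profile_mode_lap(3)[where D = D and k = k, OF this y(1)]
  have "sqn y * (sincK K (sqn y))\<^sup>2 * lap K (mode_re K k) y = 0"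
    by (simp add: D_def)
  then show "lap K (mode_re K k) y = 0"
    using y sincK_chart_pos[of y K] sub by auto
qed simp

lemma lap_profile_mode:
  assumes "x \<in> U"
  shows "lap K (\<lambda>x. (profile K k 0 (conf_sqn K x) + b) * mode_re K k x) x = mode_re K k x"
proof (rule eq_at_origin[where g = "mode_re K k", OF _ _ assms])
  define D where "D n q = profile K k n q + (if n = 0 then b else 0)" for n q
  have D: "(D n has_field_derivative D (Suc n) q) (at q)" if "1 + K * q > 0" for n q
    using DERIV_add[OF has_field_derivative_profile[OF that, of k n] DERIV_const, of "if n = 0 then b else 0"]
    by (simp add: D_def[abs_def])
  note * = profile_mode_lap[where D = D and k = k, OF D]
  show "continuous_on U (lap K (\<lambda>x. (profile K k 0 (conf_sqn K x) + b) * mode_re K k x))"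
    using smooth_on_continuous[OF smooth_on_lap[OF *(1) sub]] by (simp add: D_def)
  show "continuous_on U (mode_re K k)"
    by (rule smooth_on_continuous[OF smooth_mode(1)])
  fix y assume y: "y \<in> U" "y \<noteq> 0"
  have pos: "1 + K * conf_sqn K y > 0" by (rule one_plus_conf_sqn_pos[OF y(1)])
  let ?c = "1 + cosK K (sqn y)"
  have c: "?c > 0" using one_plus_cosK_pos[of y K] sub y by blast
  have "sqn y * (sincK K (sqn y))\<^sup>2 * lap K (\<lambda>x. (profile K k 0 (conf_sqn K x) + b) * mode_re K k x) y
      = 4 * conf_sqn K y * (1 / (1 + K * conf_sqn K y)\<^sup>2) * mode_re K k y"
    using *(3)[OF _ y(1)] profile_ode[OF pos, of k] by (simp add: D_def)
  \<comment> \<open>The metric is 4 |dz|^2 / (1 + K q)^2 in the conformal coordinate, and h^2 is its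
    coefficient of d\<theta>^2.\<close>
  also have "4 * conf_sqn K y * (1 / (1 + K * conf_sqn K y)\<^sup>2) = sqn y * (sincK K (sqn y))\<^sup>2"
  proof -
    have *: "1 + K * conf_sqn K y = 2 / ?c" using sub y by (intro one_plus_conf_sqn) auto
    have **: "conf_sqn K y * ?c\<^sup>2 = sqn y * (sincK K (sqn y))\<^sup>2"
      using c by (simp add: conf_sqn_def conf_factor_def power_divide)
    show ?thesis unfolding * **[symmetric] using c by (simp add: power_divide)
  qed
  finally show "lap K (\<lambda>x. (profile K k 0 (conf_sqn K x) + b) * mode_re K k x) y = mode_re K k y"
    using y sincK_chart_pos[of y K] sub by auto
qed

end

section \<open>The radial equations\<close>

definition tan_half :: "real \<Rightarrow> real \<Rightarrow> real" where
  "tan_half K r = h_fun K r / (1 + c_fun K r)"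

lemma tan_half_0 [simp]: "tan_half K 0 = 0"
  by (simp add: tan_half_def)

lemma DERIV_tan_half:
  assumes "1 + c_fun K r > 0"
  shows "(tan_half K has_field_derivative 1 / (1 + c_fun K r)) (at r within S)"
proof -
  let ?c = "c_fun K r" and ?h = "h_fun K r"
  have "?c * (1 + ?c) - ?h * (- K * ?h) = 1 + ?c"
    using c_h_id[of K r] by (simp add: power2_eq_square algebra_simps)
  then have "(?c * (1 + ?c) - ?h * (- K * ?h)) / ((1 + ?c) * (1 + ?c)) = 1 / (1 + ?c)"
    using assms by simp
  moreover have "(tan_half K has_field_derivative
      (?c * (1 + ?c) - ?h * (- K * ?h)) / ((1 + ?c) * (1 + ?c))) (at r)"
    unfolding tan_half_def[abs_def] using assms
    by (intro DERIV_divide DERIV_h_fun) (auto intro!: derivative_eq_intros DERIV_c_fun)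
  ultimately show ?thesis
    using has_field_derivative_at_within by metis
qed

lemma h_fun_tan_half:
  assumes "1 + c_fun K r > 0"
  shows "(h_fun K r)\<^sup>2 = 4 * (tan_half K r)\<^sup>2 / (1 + K * (tan_half K r)\<^sup>2)\<^sup>2"
    and "1 + K * (tan_half K r)\<^sup>2 = 2 / (1 + c_fun K r)"
proof -
  let ?c = "c_fun K r"
  have "K * (tan_half K r)\<^sup>2 = (1 - ?c\<^sup>2) / (1 + ?c)\<^sup>2"
    using c_h_id[of K r] by (simp add: tan_half_def power_divide algebra_simps)
  also have "\<dots> = 2 / (1 + ?c) - 1"
    using assms by (simp add: divide_simps) (simp add: power2_eq_square algebra_simps)
  finally show *: "1 + K * (tan_half K r)\<^sup>2 = 2 / (1 + ?c)"
    by simp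
  show "(h_fun K r)\<^sup>2 = 4 * (tan_half K r)\<^sup>2 / (1 + K * (tan_half K r)\<^sup>2)\<^sup>2"
    unfolding * using assms by (simp add: tan_half_def power_divide)
qed

lemma deriv_zero_imp_const:
  assumes "\<And>r. r \<in> {0<..R} \<Longrightarrow> (z has_field_derivative 0) (at r within {0<..R})"
  shows "\<exists>c. \<forall>r\<in>{0<..R}. z r = (c :: real)"
  using has_field_derivative_zero_constant[of "{0<..R}" z] assms by (auto simp: convex_real_interval)

text \<open>\<open>p\<close> and \<open>P\<close> are coefficients of degree \<open>k\<close> in the angular expansions of a function and of its
  Laplacian, and \<open>y = h p'\<close>.\<close>

definition radial_system ::
  "real \<Rightarrow> real \<Rightarrow> nat \<Rightarrow> (real \<Rightarrow> real) \<Rightarrow> (real \<Rightarrow> real) \<Rightarrow> (real \<Rightarrow> real) \<Rightarrow> bool" where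
  "radial_system K R k p y P \<longleftrightarrow> continuous_on {0..R} p \<and> continuous_on {0..R} y \<and> y 0 = 0 \<and>
     (\<forall>r\<in>{0<..R}. \<exists>p' y'. (p has_field_derivative p') (at r within {0<..R}) \<and>
        (y has_field_derivative y') (at r within {0<..R}) \<and>
        h_fun K r * p' = y r \<and> h_fun K r * y' = (h_fun K r)\<^sup>2 * P r + (real k)\<^sup>2 * p r)"

context
  fixes K R :: real
  assumes R: "0 < R" "ereal R < r_max K"
begin

lemma radius_bounds:
  assumes "r \<in> {0..R}"
  shows "1 + c_fun K r > 0" "r > 0 \<Longrightarrow> h_fun K r > 0" "r > 0 \<Longrightarrow> tan_half K r > 0"
proof -
  have "ereal r < r_max K"
    using R(2) assms ereal_less_eq(3)[of r R] le_less_trans by (metis atLeastAtMost_iff)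
  then show "1 + c_fun K r > 0" "r > 0 \<Longrightarrow> h_fun K r > 0"
    using c_fun_gt_m1 h_fun_pos assms by auto
  then show "r > 0 \<Longrightarrow> tan_half K r > 0" by (simp add: tan_half_def)
qed

lemma DERIV_tan_half_power:
  assumes "r \<in> {0<..R}"
  shows "\<exists>t'. ((\<lambda>r. tan_half K r ^ k) has_field_derivative t') (at r within S) \<and>
    h_fun K r * t' = real k * tan_half K r ^ k"
proof -
  have c: "1 + c_fun K r > 0" using radius_bounds[of r] assms by auto
  have t: "h_fun K r * (1 / (1 + c_fun K r)) = tan_half K r"
    by (simp add: tan_half_def)
  have "((\<lambda>r. tan_half K r ^ k) has_field_derivative
      real k * (1 / (1 + c_fun K r) * tan_half K r ^ (k - Suc 0))) (at r within S)"
    by (rule DERIV_power[OF DERIV_tan_half[OF c]])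
  moreover have "h_fun K r * (real k * (1 / (1 + c_fun K r) * tan_half K r ^ (k - Suc 0)))
      = real k * tan_half K r ^ k"
  proof (cases k)
    case (Suc n)
    have "h_fun K r * (real k * (1 / (1 + c_fun K r) * tan_half K r ^ (k - Suc 0)))
       = real k * ((h_fun K r * (1 / (1 + c_fun K r))) * tan_half K r ^ n)"
      by (simp add: Suc mult_ac)
    then show ?thesis unfolding t Suc by simp
  qed simp
  ultimately show ?thesis by blast
qed

lemma continuous_on_tan_half: "continuous_on {0..R} (tan_half K)"
  by (rule DERIV_continuous_on) (rule DERIV_tan_half[OF radius_bounds(1)])

text \<open>The solutions of \<open>h (h p')' = k\<^sup>2 p\<close> are spanned by \<open>tan\<^sub>K(r/2)\<^sup>k\<close> and \<open>tan\<^sub>K(r/2)\<^sup>-\<^sup>k\<close>; the continuity of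
  \<open>p\<close> and \<open>y\<close> at \<open>0\<close> forces \<open>y = k p\<close> and excludes the second one.\<close>

lemma radial_system_homogeneous:
  assumes sys: "radial_system K R k p y P" and P: "\<And>r. r \<in> {0<..R} \<Longrightarrow> P r = 0"
  shows "\<exists>C. \<forall>r\<in>{0<..R}. p r = C * tan_half K r ^ k \<and> y r = k * p r"
proof -
  let ?T = "\<lambda>r. tan_half K r ^ k"
  \<comment> \<open>A first integral: with T = \<open>tan_half K\<close>, h (y - k p)' = - k (y - k
    p) while h (T^k)' = k T^k. It vanishes at 0, through T(0) = 0 if k > 0 and through y(0) = 0 if k
    = 0.\<close>
  define z where "z r = (y r - k * p r) * ?T r" for r
  have zc: "continuous_on {0..R} z"
    unfolding z_def using sys continuous_on_tan_half
    by (intro continuous_intros) (auto simp: radial_system_def)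
  have z0: "z 0 = 0"
    using sys by (cases k) (auto simp: z_def radial_system_def)
  have h: "h_fun K r > 0" "tan_half K r > 0" if "r \<in> {0<..R}" for r
    using radius_bounds[of r] that by auto
  have "(z has_field_derivative 0) (at r within {0<..R})" if r: "r \<in> {0<..R}" for r
  proof -
    obtain p' y' where d: "(p has_field_derivative p') (at r within {0<..R})"
      "(y has_field_derivative y') (at r within {0<..R})"
      "h_fun K r * p' = y r" "h_fun K r * y' = (real k)\<^sup>2 * p r"
      using sys P[OF r] r unfolding radial_system_def by fastforce
    obtain t' where t: "(?T has_field_derivative t') (at r within {0<..R})"
      "h_fun K r * t' = real k * ?T r"
      using DERIV_tan_half_power[OF r] by blast
    have "(z has_field_derivative (y' - k * p') * ?T r + t' * (y r - k * p r)) (at r within {0<..R})"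
      unfolding z_def[abs_def] by (intro DERIV_mult DERIV_diff DERIV_cmult d t)
    moreover have "h_fun K r * ((y' - k * p') * ?T r + t' * (y r - k * p r)) = 
        (h_fun K r * y' - k * (h_fun K r * p')) * ?T r + (h_fun K r * t') * (y r - k * p r)"
      by (simp add: algebra_simps)
    then have "h_fun K r * ((y' - k * p') * ?T r + t' * (y r - k * p r)) = 0"
      unfolding d t by (simp add: algebra_simps power2_eq_square)
    ultimately show ?thesis using h[OF r] by simp
  qed
  from deriv_zero_imp_const[OF this] obtain c where c: "z r = c" if "r \<in> {0<..R}" for r by blast
  have z: "z r = z 0" if r: "r \<in> {0<..R}" for r
  proof -
    have "z 0 = c"
    proof (rule continuous_constant_on_closure[of "{0<..<R}" z])
      show "continuous_on (closure {0<..<R}) z" "0 \<in> closure {0<..<R}"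
        using zc R by simp_all
      show "z x = c" if "x \<in> {0<..<R}" for x
        using c that by simp
    qed
    then show ?thesis using c[OF r] by simp
  qed
  then have y: "y r = k * p r" if "r \<in> {0<..R}" for r
    using that z0 h[OF that] z[OF that] by (simp add: z_def[of r])
  have "((\<lambda>r. p r / ?T r) has_field_derivative 0) (at r within {0<..R})" if r: "r \<in> {0<..R}" for r
  proof -
    obtain p' where d: "(p has_field_derivative p') (at r within {0<..R})"
      "h_fun K r * p' = k * p r"
      using sys y[OF r] r unfolding radial_system_def by fastforce
    obtain t' where t: "(?T has_field_derivative t') (at r within {0<..R})"
      "h_fun K r * t' = real k * ?T r"
      using DERIV_tan_half_power[OF r] by blast
    have "((\<lambda>r. p r / ?T r) has_field_derivative (p' * ?T r - p r * t') / (?T r * ?T r))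
        (at r within {0<..R})"
      using h[OF r] by (intro DERIV_divide d t) auto
    moreover have "h_fun K r * (p' * ?T r - p r * t') = (h_fun K r * p') * ?T r - p r * (h_fun K r * t')"
      by (simp add: algebra_simps)
    then have "p' * ?T r - p r * t' = 0"
      unfolding d t using h[OF r] by simp
    ultimately show ?thesis by simp
  qed
  from deriv_zero_imp_const[OF this] obtain C where "\<forall>r\<in>{0<..R}. p r / ?T r = C" by blast
  then have "\<forall>r\<in>{0<..R}. p r = C * ?T r"
    using h by (metis less_irrefl nonzero_divide_eq_eq power_not_zero)
  with y show ?thesis by blast
qed

lemma radial_system_diff:
  assumes "radial_system K R k p y P" "radial_system K R k q z Q"
  shows "radial_system K R k (\<lambda>r. p r - c * q r) (\<lambda>r. y r - c * z r) (\<lambda>r. P r - c * Q r)"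
  unfolding radial_system_def
proof (intro conjI ballI)
  fix r assume r: "r \<in> {0<..R}"
  obtain p' y' where d: "(p has_field_derivative p') (at r within {0<..R})"
    "(y has_field_derivative y') (at r within {0<..R})"
    "h_fun K r * p' = y r" "h_fun K r * y' = (h_fun K r)\<^sup>2 * P r + (real k)\<^sup>2 * p r"
    using assms(1) r unfolding radial_system_def by blast
  obtain q' z' where e: "(q has_field_derivative q') (at r within {0<..R})"
    "(z has_field_derivative z') (at r within {0<..R})"
    "h_fun K r * q' = z r" "h_fun K r * z' = (h_fun K r)\<^sup>2 * Q r + (real k)\<^sup>2 * q r"
    using assms(2) r unfolding radial_system_def by blast
  have "((\<lambda>r. p r - c * q r) has_field_derivative p' - c * q') (at r within {0<..R})"
    "((\<lambda>r. y r - c * z r) has_field_derivative y' - c * z') (at r within {0<..R})"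
    by (intro DERIV_diff DERIV_cmult d e)+
  moreover have "h_fun K r * (p' - c * q') = y r - c * z r"
    unfolding d(3)[symmetric] e(3)[symmetric] by (simp add: algebra_simps)
  moreover have "h_fun K r * (y' - c * z') =
      (h_fun K r)\<^sup>2 * (P r - c * Q r) + (real k)\<^sup>2 * (p r - c * q r)"
    using d(4) e(4) by (simp add: algebra_simps)
  ultimately show "\<exists>p' y'. ((\<lambda>r. p r - c * q r) has_field_derivative p') (at r within {0<..R}) \<and>
      ((\<lambda>r. y r - c * z r) has_field_derivative y') (at r within {0<..R}) \<and>
      h_fun K r * p' = y r - c * z r \<and>
      h_fun K r * y' = (h_fun K r)\<^sup>2 * (P r - c * Q r) + (real k)\<^sup>2 * (p r - c * q r)"
    by blast
qed (use assms in \<open>auto simp: radial_system_def intro!: continuous_intros\<close>)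

text \<open>A particular solution with inhomogeneity T^k, where T = \<open>tan_half K\<close>:
  subtracting C times it from a solution with P = C T^k leaves the homogeneous case. It is the
  radial counterpart of \<open>lap_profile_mode\<close>.\<close>

lemma radial_system_profile:
  "radial_system K R k (\<lambda>r. profile K k 0 ((tan_half K r)\<^sup>2) * tan_half K r ^ k)
    (\<lambda>r. (2 * (tan_half K r)\<^sup>2 * profile K k 1 ((tan_half K r)\<^sup>2) + k * profile K k 0 ((tan_half K r)\<^sup>2))
      * tan_half K r ^ k)
    (\<lambda>r. tan_half K r ^ k)"
proof -
  let ?T = "tan_half K" and ?f = "\<lambda>n r. profile K k n ((tan_half K r)\<^sup>2)"
  have pos: "1 + K * (?T r)\<^sup>2 > 0" if "r \<in> {0..R}" for r
    using h_fun_tan_half(2)[of K r] radius_bounds(1)[OF that] by simp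
  have fd: "\<exists>d. ((\<lambda>r. ?f n r) has_field_derivative d) (at r within S) \<and>
      h_fun K r * d = 2 * (?T r)\<^sup>2 * ?f (Suc n) r" if r: "r \<in> {0<..R}" for n r S
  proof -
    obtain t' where t: "((\<lambda>r. (?T r)\<^sup>2) has_field_derivative t') (at r within S)"
      "h_fun K r * t' = 2 * (?T r)\<^sup>2"
      using DERIV_tan_half_power[OF r, of 2] by auto
    show ?thesis
      using DERIV_chain2[OF has_field_derivative_profile[OF pos] t(1), of k n] t(2) r
      by (intro exI[of _ "?f (Suc n) r * t'"]) auto
  qed
  have fc: "continuous_on {0..R} (?f n)" for n
  proof -
    have "continuous_on {q. 1 + K * q > 0} (profile K k n)"
      by (rule DERIV_continuous_on) (use has_field_derivative_profile has_field_derivative_at_within in blast)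
    then show ?thesis
      by (rule continuous_on_compose2) (use pos in \<open>auto intro!: continuous_intros continuous_on_tan_half\<close>)
  qed
  show ?thesis
    unfolding radial_system_def
  proof (intro conjI ballI)
    fix r assume r: "r \<in> {0<..R}"
    let ?S = "{0<..R}" and ?h = "h_fun K r" and ?q = "(?T r)\<^sup>2"
    obtain f0 where f0: "((\<lambda>r. ?f 0 r) has_field_derivative f0) (at r within ?S)"
      "?h * f0 = 2 * ?q * ?f 1 r" using fd[OF r, of 0] by auto
    obtain f1 where f1: "((\<lambda>r. ?f 1 r) has_field_derivative f1) (at r within ?S)"
      "?h * f1 = 2 * ?q * ?f 2 r" using fd[OF r, of 1] by (auto simp: numeral_2_eq_2)
    obtain t2 where t2: "((\<lambda>r. (?T r)\<^sup>2) has_field_derivative t2) (at r within ?S)"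
      "?h * t2 = 2 * ?q"
      using DERIV_tan_half_power[OF r, of 2] by auto
    obtain tk where tk: "((\<lambda>r. ?T r ^ k) has_field_derivative tk) (at r within ?S)"
      "?h * tk = k * ?T r ^ k"
      using DERIV_tan_half_power[OF r, of k] by auto
    let ?p' = "f0 * ?T r ^ k + tk * ?f 0 r"
    let ?y' = "(2 * t2 * ?f 1 r + f1 * (2 * ?q) + k * f0) * ?T r ^ k
      + tk * (2 * ?q * ?f 1 r + k * ?f 0 r)"
    have h1: "?h * ?p' = (?h * f0) * ?T r ^ k + (?h * tk) * ?f 0 r"
      by (simp add: algebra_simps)
    have h2: "?h * ?y' = (2 * (?h * t2) * ?f 1 r + (?h * f1) * (2 * ?q) + k * (?h * f0)) * ?T r ^ k
        + (?h * tk) * (2 * ?q * ?f 1 r + k * ?f 0 r)"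
      by (simp add: algebra_simps)
    have "?h * ?y' = 4 * ?q * (?q * ?f 2 r + (real k + 1) * ?f 1 r) * ?T r ^ k
        + (real k)\<^sup>2 * (?f 0 r * ?T r ^ k)"
      unfolding h2 f0 f1 tk t2 by (simp add: algebra_simps power2_eq_square)
    moreover have "4 * ?q * (?q * ?f 2 r + (real k + 1) * ?f 1 r) = ?h\<^sup>2"
      using profile_ode[OF pos, of r k] h_fun_tan_half(1)[of K r] radius_bounds(1)[of r] r by simp
    ultimately have h3: "?h * ?y' = ?h\<^sup>2 * ?T r ^ k + (real k)\<^sup>2 * (?f 0 r * ?T r ^ k)"
      by (simp only:)
    show "\<exists>p' y'. ((\<lambda>r. ?f 0 r * ?T r ^ k) has_field_derivative p') (at r within ?S) \<and>
      ((\<lambda>r. (2 * (?T r)\<^sup>2 * ?f 1 r + k * ?f 0 r) * ?T r ^ k) has_field_derivative y') (at r within ?S) \<and>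
      ?h * p' = (2 * ?q * ?f 1 r + k * ?f 0 r) * ?T r ^ k \<and>
      ?h * y' = ?h\<^sup>2 * ?T r ^ k + (real k)\<^sup>2 * (?f 0 r * ?T r ^ k)"
    proof (intro exI conjI)
      show "((\<lambda>r. ?f 0 r * ?T r ^ k) has_field_derivative ?p') (at r within ?S)"
        by (intro DERIV_mult f0 tk)
      show "((\<lambda>r. (2 * (?T r)\<^sup>2 * ?f 1 r + k * ?f 0 r) * ?T r ^ k)
          has_field_derivative ?y') (at r within ?S)"
        by (rule DERIV_mult[OF DERIV_add[OF DERIV_mult[OF DERIV_cmult[OF t2(1)] f1(1)]
                DERIV_cmult[OF f0(1)]] tk(1)])
      show "?h * ?p' = (2 * ?q * ?f 1 r + k * ?f 0 r) * ?T r ^ k"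
        unfolding h1 f0 tk by (simp add: algebra_simps)
    qed (rule h3)
  qed (auto intro!: continuous_intros fc continuous_on_tan_half simp: power_0_left)
qed

end

section \<open>Boundary conditions for the radial coefficients\<close>

lemma profile_1_pos:
  assumes "1 + K * q > 0"
  shows "profile K k 1 q > 0"
proof -
  have pos: "1 + K * q * s > 0" if "s \<in> {0..1}" for s
    using one_plus_pos[OF assms that] .
  have eq: "profile K k 1 q = integral {0..1} (\<lambda>s. s ^ k / (1 + K * q * s)\<^sup>2)"
    unfolding profile_def by (simp add: numeral_2_eq_2)
  have cont: "continuous_on {0..1} (\<lambda>s. s ^ k / (1 + K * q * s)\<^sup>2)"
    using pos by (fastforce intro!: continuous_intros)
  then have "((\<lambda>s. s ^ k / (1 + K * q * s)\<^sup>2) has_integral profile K k 1 q) (cbox 0 1)"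
    unfolding eq by (simp add: integrable_continuous_interval integrable_integral)
  moreover have "profile K k 1 q \<noteq> 0"
  proof
    assume 0: "profile K k 1 q = 0"
    \<comment> \<open>A nonnegative continuous integrand with zero integral vanishes everywhere; s =
      1 is chosen because s^k = 1 there for every k.\<close>
    have "1 ^ k / (1 + K * q * 1)\<^sup>2 = 0"
      by (rule has_integral_0_cbox_imp_0[of 0 1 "\<lambda>s. s ^ k / (1 + K * q * s)\<^sup>2"])
        (use cont calculation 0 in auto)
    then show False using assms by simp
  qed
  moreover have "profile K k 1 q \<ge> 0"
    unfolding eq by (intro integral_nonneg integrable_continuous_interval cont) auto
  ultimately show ?thesis by simp
qed

text \<open>For \<open>k \<ge> 1\<close>, the two boundary conditions on \<open>(f(q) + b) w\<close>, with \<open>w\<close> harmonic of degree \<open>k\<close>, determine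
  the constant \<open>b\<close> and then the eigenvalue. For \<open>k = 0\<close> only the constants remain, with eigenvalue \<open>0\<close>.\<close>

definition steklov_value :: "real \<Rightarrow> real \<Rightarrow> nat \<Rightarrow> real" where
  "steklov_value K R k = (real k)\<^sup>2 /
     (2 * h_fun K R * (tan_half K R)\<^sup>2 * profile K k 1 ((tan_half K R)\<^sup>2))"

text \<open>With T = \<open>tan_half K\<close>, first P = C T^k and then p = (C f + D) T^k. The
  boundary conditions form a homogeneous linear system for C and D whose determinant is, up to a
  nonzero factor, 2 \<xi> q f' - k^2 / h; it vanishes only for \<xi> =
  \<open>steklov_value K R k\<close>. This includes k = 0, where that value is 0.\<close>

lemma radial_system_boundary:
  assumes R: "0 < R" "ereal R < r_max K"
    and sys: "radial_system K R k p y P" "radial_system K R k P Y (\<lambda>r. 0)"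
    and bd: "y R = 0" "Y R / h_fun K R + \<xi> * p R = 0" and \<xi>: "\<xi> \<noteq> steklov_value K R k"
    and r: "r \<in> {0<..R}"
  shows "p r = 0"
proof -
  let ?T = "tan_half K"
  define h Q t where "h = h_fun K R" and "Q = (?T R)\<^sup>2" and "t = ?T R ^ k"
  have RR: "R \<in> {0<..R}" using R by simp
  have h: "h > 0" "Q > 0" "t > 0"
    using radius_bounds[OF R, of R] R by (auto simp: h_def Q_def t_def)
  obtain C where C: "\<And>r. r \<in> {0<..R} \<Longrightarrow> P r = C * ?T r ^ k \<and> Y r = k * P r"
    using radial_system_homogeneous[OF R sys(2)] by blast
  obtain D where D: "\<And>r. r \<in> {0<..R} \<Longrightarrow>
      p r - C * (profile K k 0 ((?T r)\<^sup>2) * ?T r ^ k) = D * ?T r ^ k \<and>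
      y r - C * ((2 * (?T r)\<^sup>2 * profile K k 1 ((?T r)\<^sup>2) + k * profile K k 0 ((?T r)\<^sup>2)) * ?T r ^ k)
      = k * (p r - C * (profile K k 0 ((?T r)\<^sup>2) * ?T r ^ k))"
    using radial_system_homogeneous[OF R radial_system_diff[OF R sys(1) radial_system_profile[OF R], of C]]
      C right_minus_eq by (metis (no_types, lifting))
  define f0 f1 where "f0 = profile K k 0 Q" and "f1 = profile K k 1 Q"
  have f1: "f1 > 0"
    unfolding f1_def Q_def
    using h_fun_tan_half(2)[of K R] radius_bounds(1)[OF R, of R] R by (intro profile_1_pos) simp
  have p: "p R = (C * f0 + D) * t" and "y R = (C * (2 * Q * f1 + k * f0) + k * D) * t"
    and Y: "Y R = k * C * t"
    using D[OF RR] C[OF RR] unfolding t_def[symmetric] Q_def[symmetric] f0_def[symmetric] f1_def[symmetric]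
    by (simp_all add: algebra_simps)
  then have "(2 * C * Q * f1 + k * (C * f0 + D)) * t = 0"
    using bd(1) by (simp add: algebra_simps)
  then have y: "2 * C * Q * f1 + k * (C * f0 + D) = 0"
    using h(3) by simp
  have "(k * C / h + \<xi> * (C * f0 + D)) * t = 0"
    using bd(2) unfolding p Y h_def[symmetric] by (simp add: algebra_simps)
  then have *: "k * C / h + \<xi> * (C * f0 + D) = 0"
    using h(3) by simp
  have \<xi>': "\<xi> * (2 * h * Q * f1) \<noteq> (real k)\<^sup>2"
    using \<xi> h f1 unfolding steklov_value_def h_def[symmetric] Q_def[symmetric] f1_def[symmetric]
    by (auto simp: eq_divide_eq)
  have "C = 0 \<and> D = 0"
  proof (cases "k = 0")
    case True
    then show ?thesis using y f1 h * \<xi> by (auto simp: steklov_value_def)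
  next
    case False
    have "real k * (C * f0 + D) = - (2 * C * Q * f1)" using y by linarith
    moreover have "real k * h * (k * C / h + \<xi> * (C * f0 + D))
        = (real k)\<^sup>2 * C + \<xi> * h * (real k * (C * f0 + D))"
      using h by (simp add: power2_eq_square algebra_simps)
    ultimately have "C * ((real k)\<^sup>2 - \<xi> * (2 * h * Q * f1)) = 0"
      unfolding * by algebra
    then have "C = 0" using \<xi>' by simp
    with y False show ?thesis by simp
  qed
  with D[OF r] show ?thesis by simp
qed

section \<open>Angular Fourier coefficients\<close>

definition circ :: "real \<Rightarrow> real^2" where
  "circ t = vector [cos t, sin t]"

lemma circ_nth [simp]: "circ t $ 1 = cos t" "circ t $ 2 = sin t"
  by (simp_all add: circ_def)

lemma sqn_circ [simp]: "sqn (r *\<^sub>R circ t) = r\<^sup>2"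
proof -
  have "sqn (r *\<^sub>R circ t) = r\<^sup>2 * ((cos t)\<^sup>2 + (sin t)\<^sup>2)"
    unfolding sqn_def vector_scaleR_component circ_nth real_scaleR_def by algebra
  then show ?thesis by simp
qed

lemma norm_circ [simp]: "norm (circ t) = 1"
  using norm_eq_sqn[of "circ t"] sqn_circ[of 1 t] power2_eq_imp_eq[of "norm (circ t)" 1] by simp

lemma circ_polar: "\<exists>t\<in>{0..2*pi}. x = norm x *\<^sub>R circ t"
proof (cases "x = 0")
  case False
  have "(x $ 1 / norm x)\<^sup>2 + (x $ 2 / norm x)\<^sup>2 = sqn x / (norm x)\<^sup>2"
    by (simp add: sqn_def power2_eq_square add_divide_distrib)
  then have "(x $ 1 / norm x)\<^sup>2 + (x $ 2 / norm x)\<^sup>2 = 1"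
    using False by (simp add: norm_eq_sqn)
  from sincos_total_2pi_le[OF this] obtain t
    where t: "0 \<le> t" "t \<le> 2 * pi" "x $ 1 / norm x = cos t" "x $ 2 / norm x = sin t"
    by metis
  then have "x = norm x *\<^sub>R circ t"
    using False by (simp add: vec_eq_iff forall_2 flip: t(3,4))
  with t(1,2) show ?thesis by auto
next
  case True
  show ?thesis by (rule bexI[of _ 0]) (simp_all add: True)
qed

lemma continuous_on_circ: "continuous_on S circ"
proof -
  have "continuous_on S (\<lambda>t. cos t *\<^sub>R axis 1 1 + sin t *\<^sub>R axis 2 1 :: real^2)"
    by (intro continuous_intros)
  moreover have "circ t = cos t *\<^sub>R axis 1 1 + sin t *\<^sub>R axis 2 1" for t
    by (simp add: vec_eq_iff forall_2 axis_def)
  ultimately show ?thesis by simp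
qed

lemma has_vector_derivative_circ:
  "(circ has_vector_derivative vector [- sin t, cos t]) (at t)"
proof -
  have "((\<lambda>t. cos t *\<^sub>R axis 1 1 + sin t *\<^sub>R axis 2 1 :: real^2) has_vector_derivative
      (cos t *\<^sub>R 0 + (- sin t) *\<^sub>R axis 1 1) + (sin t *\<^sub>R 0 + cos t *\<^sub>R axis 2 1)) (at t)"
    by (intro has_vector_derivative_add has_vector_derivative_scaleR DERIV_cos DERIV_sin
        has_vector_derivative_const)
  moreover have "circ = (\<lambda>t. cos t *\<^sub>R axis 1 1 + sin t *\<^sub>R axis 2 1)"
    by (auto simp: vec_eq_iff forall_2 axis_def fun_eq_iff)
  moreover have "vector [- sin t, cos t] = ((- sin t) *\<^sub>R axis 1 1 + cos t *\<^sub>R axis 2 1 :: real^2)"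
    by (simp add: vec_eq_iff forall_2 axis_def)
  ultimately show ?thesis by simp
qed

lemma has_field_derivative_along:
  fixes c :: "real \<Rightarrow> real^2"
  assumes w: "smooth_on_open U w" "c t \<in> U" and c: "(c has_vector_derivative v) (at t)"
  shows "((\<lambda>t. w (c t)) has_field_derivative
    v $ 1 * partial_deriv 1 w (c t) + v $ 2 * partial_deriv 2 w (c t)) (at t)"
  using has_derivative_compose[OF c[unfolded has_vector_derivative_def] smooth_on_has_derivative[OF w]]
  unfolding has_field_derivative_def by (rule has_derivative_eq_rhs) (simp add: sum_2 fun_eq_iff algebra_simps)

lemma DERIV_ray:
  assumes w: "smooth_on_open U w" "r *\<^sub>R circ t \<in> U" and r: "r \<noteq> 0"
  shows "((\<lambda>r. w (r *\<^sub>R circ t)) has_field_derivative euler w (r *\<^sub>R circ t) / r) (at r)"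
proof -
  have "((\<lambda>r. r *\<^sub>R circ t) has_vector_derivative circ t) (at r)"
    by (auto intro!: derivative_eq_intros simp: has_vector_derivative_def)
  from has_field_derivative_along[where c = "\<lambda>r. r *\<^sub>R circ t", OF w this] show ?thesis
    using r by (simp add: euler_def deriv_along_def add_divide_distrib)
qed

lemma DERIV_circle:
  assumes w: "smooth_on_open U w" "r *\<^sub>R circ t \<in> U"
  shows "((\<lambda>t. w (r *\<^sub>R circ t)) has_field_derivative rot w (r *\<^sub>R circ t)) (at t)"
proof -
  have "((\<lambda>t. r *\<^sub>R circ t) has_vector_derivative r *\<^sub>R vector [- sin t, cos t]) (at t)"
    by (intro bounded_linear.has_vector_derivative[OF bounded_linear_scaleR_right]
        has_vector_derivative_circ)
  from has_field_derivative_along[where c = "\<lambda>t. r *\<^sub>R circ t", OF w this] show ?thesis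
    by (simp add: rot_def deriv_along_def)
qed

text \<open>The weight \<open>\<phi>\<close> is arbitrary so that cosines and sines are treated
  together. There is no normalisation, as the argument concerns the vanishing of these
  coefficients.\<close>

definition angular_coeff :: "(real \<Rightarrow> real) \<Rightarrow> (real^2 \<Rightarrow> real) \<Rightarrow> real \<Rightarrow> real" where
  "angular_coeff \<phi> w r = integral {0..2*pi} (\<lambda>t. w (r *\<^sub>R circ t) * \<phi> t)"

lemma angular_coeff_cong:
  assumes "\<And>t. t \<in> {0..2*pi} \<Longrightarrow> v (r *\<^sub>R circ t) = w (r *\<^sub>R circ t)"
  shows "angular_coeff \<phi> v r = angular_coeff \<phi> w r"
  unfolding angular_coeff_def by (rule integral_cong) (simp add: assms)

context
  fixes U :: "(real^2) set" and R :: real and \<phi> :: "real \<Rightarrow> real"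
  assumes U: "cball 0 R \<subseteq> U" and \<phi>: "continuous_on {0..2*pi} \<phi>"
begin

lemma circle_sub: "r \<in> {0..R} \<Longrightarrow> r *\<^sub>R circ t \<in> U"
  using U by (auto simp: subset_iff)

lemma continuous_on_polar:
  assumes "continuous_on U w"
  shows "continuous_on ({0..R} \<times> cbox 0 (2*pi)) (\<lambda>(r, t). w (r *\<^sub>R circ t) * \<phi> t)"
proof -
  have "continuous_on ({0..R} \<times> cbox 0 (2*pi)) (\<lambda>z. fst z *\<^sub>R circ (snd z))"
    by (intro continuous_intros continuous_on_compose2[OF continuous_on_circ[of UNIV]]) auto
  then have "continuous_on ({0..R} \<times> cbox 0 (2*pi)) (\<lambda>z. w (fst z *\<^sub>R circ (snd z)))"
    by (rule continuous_on_compose2[OF assms]) (use circle_sub in auto)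
  then show ?thesis
    unfolding case_prod_beta
    by (intro continuous_on_mult continuous_on_compose2[OF \<phi>]) (auto intro!: continuous_intros)
qed

lemma continuous_on_circle:
  assumes "continuous_on U w" "r \<in> {0..R}"
  shows "continuous_on {0..2*pi} (\<lambda>t. w (r *\<^sub>R circ t) * \<phi> t)"
proof -
  have "continuous_on {0..2*pi} (\<lambda>t. (\<lambda>(r, t). w (r *\<^sub>R circ t) * \<phi> t) (r, t))"
    by (rule continuous_on_compose2[OF continuous_on_polar[OF assms(1)]])
      (use assms(2) in \<open>auto intro!: continuous_intros\<close>)
  then show ?thesis by simp
qed

lemma continuous_on_angular_coeff:
  "continuous_on U w \<Longrightarrow> continuous_on {0..R} (angular_coeff \<phi> w)"
  unfolding angular_coeff_def[abs_def]
  using integral_continuous_on_param[where U = "{0..R}" and a = 0 and b = "2 * pi", OF continuous_on_polar[of w]]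
  by simp

lemma DERIV_angular_coeff:
  assumes w: "smooth_on_open U w" and r: "r \<in> {0<..R}"
  shows "\<exists>d. (angular_coeff \<phi> w has_field_derivative d) (at r within {0<..R}) \<and>
    h_fun K r * d = angular_coeff \<phi> (radial K w) r"
proof -
  let ?f = "\<lambda>r t. (euler w (r *\<^sub>R circ t) / r) * \<phi> t"
  have "((\<lambda>r. integral (cbox 0 (2*pi)) (\<lambda>t. w (r *\<^sub>R circ t) * \<phi> t)) has_field_derivative
      integral (cbox 0 (2*pi)) (?f r)) (at r within {0<..R})"
  proof (rule leibniz_rule_field_derivative)
    fix s t :: real assume s: "s \<in> {0<..R}" "t \<in> cbox 0 (2*pi)"
    have "((\<lambda>r. w (r *\<^sub>R circ t)) has_field_derivative euler w (s *\<^sub>R circ t) / s) (at s within {0<..R})"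
      using DERIV_ray[OF w circle_sub[of s]] s has_field_derivative_at_within by fastforce
    then show "((\<lambda>x. w (x *\<^sub>R circ t) * \<phi> t) has_field_derivative ?f s t) (at s within {0<..R})"
      by (rule DERIV_cmult_right)
  next
    show "(\<lambda>t. w (s *\<^sub>R circ t) * \<phi> t) integrable_on cbox 0 (2*pi)" if "s \<in> {0<..R}" for s
      using continuous_on_circle[OF smooth_on_continuous[OF w]] that
      by (auto intro!: integrable_continuous_interval)
    have "continuous_on ({0<..R} \<times> cbox 0 (2*pi)) (\<lambda>(r, t). euler w (r *\<^sub>R circ t) * \<phi> t)"
      by (rule continuous_on_subset[OF continuous_on_polar[OF smooth_on_continuous[OF smooth_on_euler[OF w]]]])
        auto
    then have "continuous_on ({0<..R} \<times> cbox 0 (2*pi))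
        (\<lambda>z. (case z of (r, t) \<Rightarrow> euler w (r *\<^sub>R circ t) * \<phi> t) / fst z)"
      by (intro continuous_intros) auto
    then show "continuous_on ({0<..R} \<times> cbox 0 (2*pi)) (\<lambda>(r, t). ?f r t)"
      by (simp add: case_prod_beta)
  qed (use r in \<open>auto simp: convex_real_interval\<close>)
  then have "(angular_coeff \<phi> w has_field_derivative integral {0..2*pi} (?f r)) (at r within {0<..R})"
    by (simp add: angular_coeff_def[abs_def])
  moreover have "h_fun K r * integral {0..2*pi} (?f r) = angular_coeff \<phi> (radial K w) r"
    unfolding angular_coeff_def integral_mult_right[symmetric]
    using r by (intro integral_cong) (simp add: radial_eq h_fun_eq_sincK)
  ultimately show ?thesis by blast
qed

text \<open>Integration by parts on the circle; the boundary terms cancel by periodicity.\<close>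

lemma angular_coeff_rot:
  assumes w: "smooth_on_open U w" and r: "r \<in> {0..R}"
    and d: "\<And>t. (\<phi> has_field_derivative \<phi>' t) (at t)" "continuous_on {0..2*pi} \<phi>'" "\<phi> (2*pi) = \<phi> 0"
  shows "angular_coeff \<phi> (rot w) r = - angular_coeff \<phi>' w r"
proof -
  let ?F = "\<lambda>t. w (r *\<^sub>R circ t) * \<phi> t"
  have c: "circ (2 * pi) = circ 0" by (simp add: circ_def)
  have "((\<lambda>t. rot w (r *\<^sub>R circ t) * \<phi> t + \<phi>' t * w (r *\<^sub>R circ t)) has_integral (?F (2*pi) - ?F 0)) {0..2*pi}"
  proof (rule fundamental_theorem_of_calculus)
    fix t :: real
    show "(?F has_vector_derivative rot w (r *\<^sub>R circ t) * \<phi> t + \<phi>' t * w (r *\<^sub>R circ t)) (at t within {0..2*pi})"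
      unfolding has_real_derivative_iff_has_vector_derivative[symmetric]
      by (rule has_field_derivative_at_within) (rule DERIV_mult[OF DERIV_circle[OF w circle_sub[OF r]] d(1)])
  qed simp
  then have "integral {0..2*pi} (\<lambda>t. rot w (r *\<^sub>R circ t) * \<phi> t + \<phi>' t * w (r *\<^sub>R circ t)) = 0"
    using d(3) by (simp add: integral_unique c)
  moreover have "integral {0..2*pi} (\<lambda>t. rot w (r *\<^sub>R circ t) * \<phi> t + \<phi>' t * w (r *\<^sub>R circ t)) =
      integral {0..2*pi} (\<lambda>t. rot w (r *\<^sub>R circ t) * \<phi> t) + integral {0..2*pi} (\<lambda>t. \<phi>' t * w (r *\<^sub>R circ t))"
  proof (intro integral_add integrable_continuous_interval)
    show "continuous_on {0..2*pi} (\<lambda>t. rot w (r *\<^sub>R circ t) * \<phi> t)"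
      by (rule continuous_on_circle[OF smooth_on_continuous[OF smooth_on_rot[OF w]] r])
    have "continuous_on {0..2*pi} (\<lambda>t. w (r *\<^sub>R circ t))"
      by (rule continuous_on_compose2[OF smooth_on_continuous[OF w]])
        (use circle_sub[OF r] in \<open>auto intro!: continuous_intros continuous_on_circ\<close>)
    then show "continuous_on {0..2*pi} (\<lambda>t. \<phi>' t * w (r *\<^sub>R circ t))"
      using d(2) by (intro continuous_intros)
  qed
  ultimately show ?thesis
    by (simp add: angular_coeff_def mult.commute)
qed

end

text \<open>The polar form of the Laplacian, integrated against \<open>\<phi>\<close> on each
  circle: two integrations by parts move the angular derivatives to \<open>\<phi>\<close>, where
  they give the factor -k^2.\<close>

lemma radial_system_angular_coeff:
  fixes \<phi> \<phi>' :: "real \<Rightarrow> real"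
  assumes w: "smooth_on_open U w" and U: "cball 0 R \<subseteq> U" "U \<subseteq> chart K" and R: "0 < R"
    and d: "\<And>t. (\<phi> has_field_derivative \<phi>' t) (at t)"
      "\<And>t. (\<phi>' has_field_derivative - ((real k)\<^sup>2) * \<phi> t) (at t)"
    and per: "\<phi> (2*pi) = \<phi> 0" "\<phi>' (2*pi) = \<phi>' 0"
  shows "radial_system K R k (angular_coeff \<phi> w) (angular_coeff \<phi> (radial K w)) (angular_coeff \<phi> (lap K w))"
proof -
  have c: "continuous_on {0..2*pi} \<phi>" "continuous_on {0..2*pi} \<phi>'"
    by (rule DERIV_continuous_on, rule has_field_derivative_at_within, rule d)+
  then have c2: "continuous_on {0..2*pi} (\<lambda>t. - ((real k)\<^sup>2) * \<phi> t)"
    by (intro continuous_intros)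
  note cont = smooth_on_continuous[OF w] smooth_on_continuous[OF smooth_on_radial[OF w, of K]]
  have rr: "angular_coeff \<phi> (rot (rot w)) r = - ((real k)\<^sup>2) * angular_coeff \<phi> w r"
    if r: "r \<in> {0..R}" for r
  proof -
    have "angular_coeff \<phi> (rot (rot w)) r = angular_coeff (\<lambda>t. - ((real k)\<^sup>2) * \<phi> t) w r"
      using angular_coeff_rot[OF U(1) c(1) smooth_on_rot[OF w] r d(1) c(2) per(1)]
        angular_coeff_rot[OF U(1) c(2) w r d(2) c2 per(2)] by simp
    also have "\<dots> = integral {0..2*pi} (\<lambda>t. - ((real k)\<^sup>2) * (w (r *\<^sub>R circ t) * \<phi> t))"
      unfolding angular_coeff_def by (intro integral_cong) simp
    finally show ?thesis
      unfolding angular_coeff_def integral_mult_right .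
  qed
  have rad: "angular_coeff \<phi> (radial K (radial K w)) r =
      (h_fun K r)\<^sup>2 * angular_coeff \<phi> (lap K w) r + (real k)\<^sup>2 * angular_coeff \<phi> w r"
    if r: "r \<in> {0..R}" for r
  proof -
    have "angular_coeff \<phi> (radial K (radial K w)) r =
        integral {0..2*pi} (\<lambda>t. (h_fun K r)\<^sup>2 * (lap K w (r *\<^sub>R circ t) * \<phi> t) - rot (rot w) (r *\<^sub>R circ t) * \<phi> t)"
      unfolding angular_coeff_def
    proof (rule integral_cong)
      fix t
      have "radial K (radial K w) (r *\<^sub>R circ t) =
          (h_fun K r)\<^sup>2 * lap K w (r *\<^sub>R circ t) - rot (rot w) (r *\<^sub>R circ t)"
        using lap_eq_radial_rot[OF w U(2) circle_sub[OF U(1) c(1) r, of t]]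
        by (simp add: h_fun_eq_sincK power_mult_distrib)
      then show "radial K (radial K w) (r *\<^sub>R circ t) * \<phi> t =
          (h_fun K r)\<^sup>2 * (lap K w (r *\<^sub>R circ t) * \<phi> t) - rot (rot w) (r *\<^sub>R circ t) * \<phi> t"
        by (simp only: left_diff_distrib mult.assoc)
    qed
    also have "\<dots> = integral {0..2*pi} (\<lambda>t. (h_fun K r)\<^sup>2 * (lap K w (r *\<^sub>R circ t) * \<phi> t))
        - integral {0..2*pi} (\<lambda>t. rot (rot w) (r *\<^sub>R circ t) * \<phi> t)"
      by (intro integral_diff integrable_continuous_interval continuous_on_mult_left
          continuous_on_circle[OF U(1) c(1) _ r] smooth_on_continuous smooth_on_lap[OF w U(2)]
          smooth_on_rot w)
    also have "\<dots> = (h_fun K r)\<^sup>2 * angular_coeff \<phi> (lap K w) r - angular_coeff \<phi> (rot (rot w)) r"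
      unfolding angular_coeff_def integral_mult_right ..
    finally show ?thesis unfolding rr[OF r] by simp
  qed
  show ?thesis
    unfolding radial_system_def
  proof (intro conjI ballI)
    show "continuous_on {0..R} (angular_coeff \<phi> w)" "continuous_on {0..R} (angular_coeff \<phi> (radial K w))"
      by (rule continuous_on_angular_coeff[OF U(1) c(1)], rule cont)+
    \<comment> \<open>The field h d/dr vanishes at the centre. For k = 0 it is this value that
      excludes the logarithmic solution.\<close>
    show "angular_coeff \<phi> (radial K w) 0 = 0"
      by (simp add: angular_coeff_def radial_def deriv_along_def)
    fix r assume r: "r \<in> {0<..R}"
    then have "r \<in> {0..R}" by simp
    from DERIV_angular_coeff[OF U(1) c(1) w r, of K]
      DERIV_angular_coeff[OF U(1) c(1) smooth_on_radial[OF w] r, of K K] rad[OF this]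
    show "\<exists>p' y'. (angular_coeff \<phi> w has_field_derivative p') (at r within {0<..R}) \<and>
        (angular_coeff \<phi> (radial K w) has_field_derivative y') (at r within {0<..R}) \<and>
        h_fun K r * p' = angular_coeff \<phi> (radial K w) r \<and>
        h_fun K r * y' = (h_fun K r)\<^sup>2 * angular_coeff \<phi> (lap K w) r + (real k)\<^sup>2 * angular_coeff \<phi> w r"
      by metis
  qed
qed

section \<open>Completeness of the trigonometric system\<close>

definition trig_orthogonal :: "(real \<Rightarrow> real) \<Rightarrow> bool" where
  "trig_orthogonal g \<longleftrightarrow> continuous_on {0..2*pi} g \<and> (\<forall>k::nat.
     integral {0..2*pi} (\<lambda>t. g t * cos (k * t)) = 0 \<and> integral {0..2*pi} (\<lambda>t. g t * sin (k * t)) = 0)"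

lemma trig_orthogonal_add:
  assumes "trig_orthogonal f" "trig_orthogonal g"
  shows "trig_orthogonal (\<lambda>t. a * f t + b * g t)"
proof -
  have c: "continuous_on {0..2*pi} f" "continuous_on {0..2*pi} g"
    using assms by (auto simp: trig_orthogonal_def)
  have *: "integral {0..2*pi} (\<lambda>t. (a * f t + b * g t) * \<phi> t) =
      a * integral {0..2*pi} (\<lambda>t. f t * \<phi> t) + b * integral {0..2*pi} (\<lambda>t. g t * \<phi> t)"
    if "continuous_on {0..2*pi} \<phi>" for \<phi>
  proof -
    have "integral {0..2*pi} (\<lambda>t. (a * f t + b * g t) * \<phi> t) =
        integral {0..2*pi} (\<lambda>t. a * (f t * \<phi> t) + b * (g t * \<phi> t))"
      by (intro integral_cong) (simp add: algebra_simps)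
    also have "\<dots> = integral {0..2*pi} (\<lambda>t. a * (f t * \<phi> t)) + integral {0..2*pi} (\<lambda>t. b * (g t * \<phi> t))"
      using c that by (intro integral_add integrable_continuous_interval continuous_intros)
    finally show ?thesis by simp
  qed
  have "continuous_on {0..2*pi} (\<lambda>t. cos (real k * t))" "continuous_on {0..2*pi} (\<lambda>t. sin (real k * t))" for k
    by (intro continuous_intros)+
  then show ?thesis
    using assms c unfolding trig_orthogonal_def by (auto simp: * intro!: continuous_intros)
qed

text \<open>The product formulas turn a factor cos t or sin t into shifts of the frequency by one,
  up and down.\<close>

lemma trig_orthogonal_mult:
  assumes "trig_orthogonal g"
  shows "trig_orthogonal (\<lambda>t. g t * cos t)" "trig_orthogonal (\<lambda>t. g t * sin t)"
proof -
  have g: "continuous_on {0..2*pi} g" using assms by (simp add: trig_orthogonal_def)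
  have *: "integral {0..2*pi} (\<lambda>t. g t * cos (a * t)) = 0 \<and> integral {0..2*pi} (\<lambda>t. g t * sin (a * t)) = 0"
    if "a \<in> \<int>" for a :: real
  proof -
    from that obtain n :: int where n: "a = n" by (rule Ints_cases)
    obtain N :: nat where "a = N \<or> a = - real N" unfolding n by (cases n rule: int_cases2) auto
    then show ?thesis
    proof
      assume a: "a = real N"
      show ?thesis using assms unfolding trig_orthogonal_def a by blast
    next
      assume a: "a = - real N"
      show ?thesis using assms unfolding trig_orthogonal_def a by simp
    qed
  qed
  have comb: "integral {0..2*pi} (\<lambda>t. c * (g t * \<phi> t) + d * (g t * \<psi> t)) = 0"
    if "continuous_on {0..2*pi} \<phi>" "continuous_on {0..2*pi} \<psi>"
      "integral {0..2*pi} (\<lambda>t. g t * \<phi> t) = 0" "integral {0..2*pi} (\<lambda>t. g t * \<psi> t) = 0" for c d \<phi> \<psi>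
  proof -
    have "integral {0..2*pi} (\<lambda>t. c * (g t * \<phi> t) + d * (g t * \<psi> t)) =
        integral {0..2*pi} (\<lambda>t. c * (g t * \<phi> t)) + integral {0..2*pi} (\<lambda>t. d * (g t * \<psi> t))"
      using that g by (intro integral_add integrable_continuous_interval continuous_intros)
    then show ?thesis using that by simp
  qed
  have p: "(real k + 1) * t = real k * t + t" and m: "(real k - 1) * t = real k * t - t" for k t
    by (simp_all add: algebra_simps)
  let ?p = "\<lambda>k t. (real k + 1) * t" and ?m = "\<lambda>k t. (real k - 1) * t"
  have z: "integral {0..2*pi} (\<lambda>t. c * (g t * cos (?p k t)) + d * (g t * cos (?m k t))) = 0"
    "integral {0..2*pi} (\<lambda>t. c * (g t * sin (?p k t)) + d * (g t * sin (?m k t))) = 0" for c d and k :: nat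
    by (rule comb; (intro continuous_intros)?; simp add: *)+
  have e: "g t * cos t * cos (real k * t) = 1/2 * (g t * cos (?p k t)) + 1/2 * (g t * cos (?m k t))"
    "g t * cos t * sin (real k * t) = 1/2 * (g t * sin (?p k t)) + 1/2 * (g t * sin (?m k t))"
    "g t * sin t * cos (real k * t) = 1/2 * (g t * sin (?p k t)) + (-1/2) * (g t * sin (?m k t))"
    "g t * sin t * sin (real k * t) = (-1/2) * (g t * cos (?p k t)) + 1/2 * (g t * cos (?m k t))"
    for t and k :: nat
    unfolding p m cos_add cos_diff sin_add sin_diff by (simp_all add: field_simps)
  have "continuous_on {0..2*pi} (\<lambda>t. g t * cos t)" "continuous_on {0..2*pi} (\<lambda>t. g t * sin t)"
    by (intro continuous_intros g)+
  then show "trig_orthogonal (\<lambda>t. g t * cos t)" "trig_orthogonal (\<lambda>t. g t * sin t)"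
    by (simp_all only: trig_orthogonal_def e z simp_thms)
qed

text \<open>Orthogonality is preserved by the coordinate functions of the circle, hence by
  polynomials in them. The induction is for all \<open>g\<close>, since a product is absorbed one
  factor at a time.\<close>

lemma trig_orthogonal_polynomial:
  assumes "real_polynomial_function (p :: real^2 \<Rightarrow> real)" "trig_orthogonal g"
  shows "trig_orthogonal (\<lambda>t. g t * p (circ t))"
  using assms
proof (induction p arbitrary: g rule: real_polynomial_function.induct)
  case (linear f)
  have f: "f (circ t) = f (axis 1 1) * cos t + f (axis 2 1) * sin t" for t
  proof -
    interpret bounded_linear f by (rule linear(1))
    have "circ t = cos t *\<^sub>R axis 1 1 + sin t *\<^sub>R axis 2 1"
      by (simp add: vec_eq_iff forall_2 axis_def)
    then show ?thesis by (simp add: add scale)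
  qed
  show ?case
    using trig_orthogonal_add[OF trig_orthogonal_mult[OF linear(2)], of "f (axis 1 1)" "f (axis 2 1)"]
    unfolding f by (simp add: algebra_simps)
next
  case (const c)
  show ?case
    using trig_orthogonal_add[OF const const, of c 0] by (simp add: mult.commute)
next
  case (add f1 f2)
  show ?case
    using trig_orthogonal_add[OF add.IH(1)[OF add.prems] add.IH(2)[OF add.prems], of 1 1]
    by (simp add: algebra_simps)
next
  case (mult f1 f2)
  show ?case
    using mult.IH(2)[OF mult.IH(1)[OF mult.prems]] by (simp add: mult.assoc)
qed

text \<open>Stone-Weierstrass gives a polynomial p within e of f on the circle. With g =
  f(\<open>circ t\<close>), the integral of g p vanishes (frequency 0), so the integral of g^2
  equals that of g (g - p), which is at most e times the integral of |g|. Taking f on the sphere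
  builds in the periodicity.\<close>

lemma trig_complete:
  fixes f :: "real^2 \<Rightarrow> real"
  assumes f: "continuous_on (sphere 0 1) f" and orth: "trig_orthogonal (\<lambda>t. f (circ t))"
    and t: "t \<in> {0..2*pi}"
  shows "f (circ t) = 0"
proof -
  let ?g = "\<lambda>t. f (circ t)"
  have g: "continuous_on {0..2*pi} ?g" using orth by (simp add: trig_orthogonal_def)
  define B where "B = integral {0..2*pi} (\<lambda>t. \<bar>?g t\<bar>)"
  define I where "I = integral {0..2*pi} (\<lambda>t. (?g t)\<^sup>2)"
  have B: "B \<ge> 0" 
    unfolding B_def by (intro integral_nonneg integrable_continuous_interval continuous_intros g) simp
  have I: "I \<ge> 0" 
    unfolding I_def by (intro integral_nonneg integrable_continuous_interval continuous_intros g) simp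
  have "I \<le> e * B" if e: "e > 0" for e
  proof -
    obtain p where p: "real_polynomial_function p" "\<And>x. x \<in> sphere 0 1 \<Longrightarrow> \<bar>f x - p x\<bar> < e"
      using Stone_Weierstrass_real_polynomial_function[OF compact_sphere f e] by blast
    have pc: "continuous_on {0..2*pi} (\<lambda>t. p (circ t))"
      using continuous_on_polymonial_function[of p] p(1) 
      by (intro continuous_on_compose2[OF _ continuous_on_circ, of UNIV p]) (auto simp: real_polynomial_function_eq)
    have "integral {0..2*pi} (\<lambda>t. ?g t * p (circ t) * cos (real 0 * t)) = 0"
      using trig_orthogonal_polynomial[OF p(1) orth] unfolding trig_orthogonal_def by blast
    then have "integral {0..2*pi} (\<lambda>t. ?g t * p (circ t)) = 0" by simp
    moreover have "integral {0..2*pi} (\<lambda>t. (?g t)\<^sup>2 - ?g t * p (circ t)) =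
        I - integral {0..2*pi} (\<lambda>t. ?g t * p (circ t))"
      unfolding I_def by (intro integral_diff integrable_continuous_interval continuous_intros g pc)
    ultimately have "I = integral {0..2*pi} (\<lambda>t. (?g t)\<^sup>2 - ?g t * p (circ t))" by simp
    also have "\<dots> \<le> integral {0..2*pi} (\<lambda>t. e * \<bar>?g t\<bar>)"
    proof (rule integral_le)
      fix t :: real
      have "(?g t)\<^sup>2 - ?g t * p (circ t) = ?g t * (?g t - p (circ t))"
        by (simp add: power2_eq_square algebra_simps)
      also have "\<dots> \<le> \<bar>?g t\<bar> * \<bar>?g t - p (circ t)\<bar>"
        unfolding abs_mult[symmetric] by simp
      also have "\<dots> \<le> \<bar>?g t\<bar> * e"
        using p(2)[of "circ t"] by (intro mult_left_mono) auto
      finally show "(?g t)\<^sup>2 - ?g t * p (circ t) \<le> e * \<bar>?g t\<bar>" by (simp add: mult.commute)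
    qed (intro integrable_continuous_interval continuous_intros g pc)+
    also have "\<dots> = e * B" by (simp add: B_def)
    finally show ?thesis .
  qed
  note le = this
  have "I \<le> 0"
  proof (rule ccontr)
    assume "\<not> I \<le> 0"
    then have I0: "I > 0" by simp
    \<comment> \<open>The choice e = I / (2 (B + 1)) makes e B < I; the summand 1 covers B =
      0.\<close>
    have "I \<le> I / (2 * (B + 1)) * B" using I0 B by (intro le) (auto intro: divide_pos_pos)
    also have "\<dots> = I * (B / (2 * (B + 1)))" by simp
    also have "\<dots> < I * 1" using I0 B by (intro mult_strict_left_mono) (auto simp: field_simps)
    finally show False by simp
  qed
  then have "I = 0" using I by simp
  moreover have "((\<lambda>t. (?g t)\<^sup>2) has_integral I) (cbox 0 (2*pi))"
    unfolding I_def cbox_interval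
    by (intro integrable_integral integrable_continuous_interval continuous_intros g)
  ultimately have "(?g t)\<^sup>2 = 0"
    using t g pi_gt_zero by (intro has_integral_0_cbox_imp_0[of 0 "2*pi" "\<lambda>t. (?g t)\<^sup>2"])
      (simp_all add: continuous_on_power not_le)
  then show ?thesis by simp
qed

section \<open>The Steklov spectrum of a geodesic disk\<close>

lemma angular_coeffs_zero_imp:
  assumes w: "smooth_on_open U w" and U: "cball 0 R \<subseteq> U" and r: "r \<in> {0..R}"
    and z: "\<And>k::nat. angular_coeff (\<lambda>t. cos (k * t)) w r = 0" "\<And>k::nat. angular_coeff (\<lambda>t. sin (k * t)) w r = 0"
    and t: "t \<in> {0..2*pi}"
  shows "w (r *\<^sub>R circ t) = 0"
proof (rule trig_complete[where f = "\<lambda>x. w (r *\<^sub>R x)", OF _ _ t])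
  have sub: "r *\<^sub>R x \<in> U" if "norm x = 1" for x
    using U r that by (auto simp: subset_iff)
  show c: "continuous_on (sphere 0 1) (\<lambda>x. w (r *\<^sub>R x))"
    by (rule continuous_on_compose2[OF smooth_on_continuous[OF w]])
      (use sub in \<open>auto intro!: continuous_intros\<close>)
  have "continuous_on {0..2*pi} (\<lambda>t. w (r *\<^sub>R circ t))"
    by (rule continuous_on_compose2[OF c continuous_on_circ]) auto
  then show "trig_orthogonal (\<lambda>t. w (r *\<^sub>R circ t))"
    using z by (simp add: trig_orthogonal_def angular_coeff_def)
qed

text \<open>For each weight, the coefficients of u and \<Delta>u are the functions p and P of
  \<open>radial_system_boundary\<close>, and both boundary conditions pass to them by linearity.
  Dividing by h turns \<open>radial K\<close> into the normal derivative on the boundary.\<close>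

lemma biharmonic_Neumann_unique:
  assumes R: "0 < R" "ereal R < r_max K"
    and u: "smooth_on_open U u" and U: "cball 0 R \<subseteq> U" "U \<subseteq> chart K"
    and bih: "\<And>x. x \<in> cball 0 R \<Longrightarrow> lap K (lap K u) x = 0"
    and bd: "\<And>x. x \<in> sphere 0 R \<Longrightarrow> radial K u x = 0"
      "\<And>x. x \<in> sphere 0 R \<Longrightarrow> radial K (lap K u) x / h_fun K R + \<xi> * u x = 0"
    and \<xi>: "\<xi> \<notin> range (steklov_value K R)" and x: "x \<in> cball 0 R"
  shows "u x = 0"
proof -
  note lu = smooth_on_lap[OF u U(2)]
  have R': "R \<in> {0..R}" using R by simp
  have sp: "R *\<^sub>R circ t \<in> sphere 0 R" for t using R by simp
  have coeff: "angular_coeff \<phi> u r = 0"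
    if d: "\<And>t. (\<phi> has_field_derivative \<phi>' t) (at t)"
      "\<And>t. (\<phi>' has_field_derivative - ((real k)\<^sup>2) * \<phi> t) (at t)"
      and per: "\<phi> (2*pi) = \<phi> 0" "\<phi>' (2*pi) = \<phi>' 0" and r: "r \<in> {0<..R}"
    for \<phi> \<phi>' :: "real \<Rightarrow> real" and k r
  proof (rule radial_system_boundary[OF R _ _ _ _ _ r])
    have c: "continuous_on {0..2*pi} \<phi>"
      by (rule DERIV_continuous_on, rule has_field_derivative_at_within, rule d)
    show "radial_system K R k (angular_coeff \<phi> u) (angular_coeff \<phi> (radial K u)) (angular_coeff \<phi> (lap K u))"
      by (rule radial_system_angular_coeff[OF u U R(1) d per])
    have z: "angular_coeff \<phi> (lap K (lap K u)) r = 0" if "r \<in> {0<..R}" for r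
    proof -
      have "angular_coeff \<phi> (lap K (lap K u)) r = angular_coeff \<phi> (\<lambda>x. 0) r"
        by (rule angular_coeff_cong) (use bih that in simp)
      then show ?thesis by (simp add: angular_coeff_def)
    qed
    have "radial_system K R k (angular_coeff \<phi> (lap K u)) (angular_coeff \<phi> (radial K (lap K u)))
        (angular_coeff \<phi> (lap K (lap K u)))"
      by (rule radial_system_angular_coeff[OF lu U R(1) d per])
    then show "radial_system K R k (angular_coeff \<phi> (lap K u)) (angular_coeff \<phi> (radial K (lap K u))) (\<lambda>r. 0)"
      unfolding radial_system_def by (simp add: z)
    have "angular_coeff \<phi> (radial K u) R = angular_coeff \<phi> (\<lambda>x. 0) R"
      by (rule angular_coeff_cong) (rule bd(1)[OF sp])
    then show "angular_coeff \<phi> (radial K u) R = 0" by (simp add: angular_coeff_def)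
    have h: "h_fun K R > 0" using R by (intro h_fun_pos)
    have "angular_coeff \<phi> (radial K (lap K u)) R = integral {0..2*pi} (\<lambda>t. - (h_fun K R * \<xi>) * (u (R *\<^sub>R circ t) * \<phi> t))"
      unfolding angular_coeff_def
    proof (rule integral_cong)
      fix t
      have "radial K (lap K u) (R *\<^sub>R circ t) = - (h_fun K R * \<xi>) * u (R *\<^sub>R circ t)"
        using bd(2)[OF sp[of t]] h by (simp add: field_simps)
      then show "radial K (lap K u) (R *\<^sub>R circ t) * \<phi> t = - (h_fun K R * \<xi>) * (u (R *\<^sub>R circ t) * \<phi> t)"
        by simp
    qed
    also have "\<dots> = - (h_fun K R * \<xi>) * angular_coeff \<phi> u R"
      unfolding angular_coeff_def by (rule integral_mult_right)
    finally show "angular_coeff \<phi> (radial K (lap K u)) R / h_fun K R + \<xi> * angular_coeff \<phi> u R = 0"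
      using h by simp
    show "\<xi> \<noteq> steklov_value K R k" using \<xi> by blast
  qed
  have circle: "u (r *\<^sub>R circ t) = 0" if "r \<in> {0<..R}" "t \<in> {0..2*pi}" for r t
  proof (rule angular_coeffs_zero_imp[OF u U(1) _ _ _ that(2)])
    have p: "cos (real k * (2 * pi)) = 1" "sin (real k * (2 * pi)) = 0" for k
      using cos_int_2pin[of "int k"] sin_int_2pin[of "int k"] by (simp_all add: mult_ac)
    show "angular_coeff (\<lambda>t. cos (real k * t)) u r = 0" for k
      by (rule coeff[where \<phi>' = "\<lambda>t. - (real k * sin (real k * t))" and k = k])
        (use that p in \<open>auto intro!: derivative_eq_intros simp: power2_eq_square\<close>)
    show "angular_coeff (\<lambda>t. sin (real k * t)) u r = 0" for k
      by (rule coeff[where \<phi>' = "\<lambda>t. real k * cos (real k * t)" and k = k])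
        (use that p in \<open>auto intro!: derivative_eq_intros simp: power2_eq_square\<close>)
  qed (use that in simp)
  have nz: "u y = 0" if "y \<in> cball 0 R - {0}" for y
  proof -
    obtain t where t: "t \<in> {0..2*pi}" "y = norm y *\<^sub>R circ t" using circ_polar by blast
    have "norm y \<in> {0<..R}" using that by simp
    from circle[OF this t(1)] t(2) show ?thesis by simp
  qed
  show ?thesis
  proof (cases "x = 0")
    case True
    have "u 0 = (\<lambda>x. 0) 0"
    proof (rule eq_at_origin[where U = "ball 0 R" and K = K and f = u and g = "\<lambda>x. 0" and x = 0])
      show "continuous_on (ball 0 R) u"
        using smooth_on_continuous[OF u] U(1) by (rule continuous_on_subset[OF _ order_trans[OF ball_subset_cball]])
      show "u y = 0" if "y \<in> ball 0 R" "y \<noteq> 0" for y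
        using nz[of y] that by simp
      show "ball 0 R \<subseteq> chart K" using U ball_subset_cball by blast
    qed (use R in auto)
    then show ?thesis using True by simp
  qed (use nz x in simp)
qed

lemma nth_smallest_range:
  fixes f :: "nat \<Rightarrow> real"
  assumes f: "strict_mono f"
  shows "nth_smallest (range f) m = f m"
proof -
  have eq: "{\<eta> \<in> range f. \<eta> < f n} = f ` {..<n}" for n
    using strict_mono_less[OF f] by auto
  have card: "finite {\<eta> \<in> range f. \<eta> < f n}" "card {\<eta> \<in> range f. \<eta> < f n} = n" for n
    unfolding eq using strict_mono_imp_inj_on[OF f] by (simp_all add: card_image inj_on_subset[of f UNIV])
  show ?thesis
    unfolding nth_smallest_def by (rule the_equality) (use card in auto)
qed

lemma lap_const: "lap K (\<lambda>x. c) x = 0"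
proof -
  have "flux K (\<lambda>x. c) i = (\<lambda>x. 0)" for i
    by (simp add: flux_def[abs_def] partial_deriv_const euler_def deriv_along_const)
  then show ?thesis by (simp add: lap_def partial_deriv_const)
qed

lemma deriv_along_radial_field:
  assumes "x \<noteq> 0" "x \<in> chart K"
  shows "deriv_along radial_field u x = radial K u x / h_fun K (norm x)"
proof -
  have "sincK K (sqn x) > 0" by (rule sincK_chart_pos[OF assms(2)])
  then show ?thesis
    using assms(1) by (simp add: deriv_along_def radial_def radial_field_def h_fun_eq_sincK norm_eq_sqn field_simps)
qed

section \<open>The explicit spectrum of a fixed disk\<close>

context
  fixes K R :: real
  assumes R: "0 < R" "ereal R < r_max K"
begin

lemma cball_subset_chart: "cball 0 R \<subseteq> chart K"
  using R(2) by (auto simp: chart_def intro: le_less_trans[of _ "ereal R"])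

lemma steklov_boundary_radial:
  assumes u: "smooth_on_open U u" "U \<subseteq> chart K" and x: "x \<in> U" "x \<in> sphere 0 R"
  shows "frechet_derivative u (at x) (radial_field x) = radial K u x / h_fun K R"
    and "frechet_derivative (laplace_beltrami (space_form_metric K) u) (at x) (radial_field x) =
      radial K (lap K u) x / h_fun K R"
proof -
  have xc: "x \<noteq> 0" "x \<in> chart K" "norm x = R" using x u R by auto
  show "frechet_derivative u (at x) (radial_field x) = radial K u x / h_fun K R"
    using frechet_derivative_eq_deriv_along[OF u(1) x(1), of radial_field]
      deriv_along_radial_field[OF xc(1,2)] xc(3) by simp
  have "frechet_derivative (laplace_beltrami (space_form_metric K) u) (at x) = frechet_derivative (lap K u) (at x)"
    by (rule frechet_derivative_cong_open[OF open_chart xc(2)]) (rule laplace_beltrami_space_form)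
  then show "frechet_derivative (laplace_beltrami (space_form_metric K) u) (at x) (radial_field x) =
      radial K (lap K u) x / h_fun K R"
    using frechet_derivative_eq_deriv_along[OF smooth_on_lap[OF u] x(1), of radial_field]
      deriv_along_radial_field[OF xc(1,2)] xc(3) by simp
qed

lemma laplace_beltrami_twice:
  assumes "x \<in> chart K"
  shows "laplace_beltrami (space_form_metric K) (laplace_beltrami (space_form_metric K) u) x = lap K (lap K u) x"
  unfolding laplace_beltrami_space_form[OF assms]
  by (rule lap_cong_open[OF open_chart assms]) (rule laplace_beltrami_space_form)

lemma steklov_value_eigenvalue:
  "steklov_eigenvalue (space_form_metric K) (cball 0 R) radial_field (steklov_value K R k)"
proof -
  let ?U = "chart K"
  note U = open_chart[of K] order_refl[of ?U]
  have sm: "smooth_near (cball 0 R) u" if "smooth_on_open ?U u" for u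
    using that cball_subset_chart by (auto simp: smooth_near_def smooth_on_open_def)
  have fr: "frontier (cball 0 R :: (real^2) set) = sphere 0 R" using R by simp
  define x0 :: "real^2" where "x0 = R *\<^sub>R circ 0"
  have x0: "x0 \<in> cball 0 R" "x0 \<in> sphere 0 R" using R by (simp_all add: x0_def)
  show ?thesis
  proof (cases "k = 0")
    case True
    have c: "smooth_on_open ?U (\<lambda>x. 1)" by (rule smooth_on_const[OF U(1)])
    have l0: "lap K (\<lambda>x. 1) = (\<lambda>x. 0)" by (simp add: fun_eq_iff lap_const)
    show ?thesis
      unfolding steklov_eigenvalue_def fr
    proof (intro exI[of _ "\<lambda>x. 1"] conjI ballI)
      fix x :: "real^2" assume "x \<in> sphere 0 R"
      then have x: "x \<in> ?U" "x \<in> sphere 0 R" using cball_subset_chart by auto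
      show "frechet_derivative (\<lambda>x. 1) (at x) (radial_field x) = 0"
        "frechet_derivative (laplace_beltrami (space_form_metric K) (\<lambda>x. 1)) (at x) (radial_field x)
          + steklov_value K R k * 1 = 0"
        unfolding steklov_boundary_radial[OF c U(2) x]
        by (simp_all add: l0 radial_def deriv_along_const steklov_value_def True)
    qed (use sm[OF c] x0 cball_subset_chart in \<open>auto simp: laplace_beltrami_twice l0 lap_const\<close>)
  next
    case False
    define Q f0 f1 h where "Q = (tan_half K R)\<^sup>2" and "f0 = profile K k 0 Q"
      and "f1 = profile K k 1 Q" and "h = h_fun K R"
    \<comment> \<open>Chosen so that the Neumann condition 2 q f' + k (f + b) = 0 holds at r =
      R.\<close>
    define b where "b = - (2 * Q * f1 / k) - f0"
    define u where "u x = (profile K k 0 (conf_sqn K x) + b) * mode_re K k x" for x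
    define D where "D n q = profile K k n q + (if n = 0 then b else 0)" for n q
    have D: "(D n has_field_derivative D (Suc n) q) (at q)" if "1 + K * q > 0" for n q
      using DERIV_add[OF has_field_derivative_profile[OF that, of k n] DERIV_const, of "if n = 0 then b else 0"]
      by (simp add: D_def[abs_def])
    note D' = profile_mode_lap[where D = D and k = k, OF U D]
    have uD: "u = (\<lambda>x. D 0 (conf_sqn K x) * mode_re K k x)"
      by (simp add: u_def[abs_def] D_def)
    have su: "smooth_on_open ?U u" unfolding uD by (rule D'(1))
    have lu: "lap K u x = mode_re K k x" if "x \<in> ?U" for x
      unfolding u_def[abs_def] by (rule lap_profile_mode[OF U that])
    have llu: "lap K (lap K u) x = 0" if "x \<in> ?U" for x
      using lap_cong_open[OF U(1) that lu] lap_mode[OF U that] by simp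
    have hq: "conf_sqn K x = Q" if "x \<in> sphere 0 R" for x
      using that by (simp add: conf_sqn_def conf_factor_def Q_def tan_half_def h_fun_eq_sincK c_fun_eq_cosK
          power_divide power_mult_distrib flip: norm_eq_sqn)
    have pos: "h > 0" "Q > 0" "f1 > 0"
    proof -
      show "h > 0" "Q > 0" using radius_bounds[OF R, of R] R by (auto simp: h_def Q_def)
      show "f1 > 0"
        unfolding f1_def Q_def
        using h_fun_tan_half(2)[of K R] radius_bounds(1)[OF R, of R] R by (intro profile_1_pos) simp
    qed
    have ux: "u x = - (2 * Q * f1 / k) * mode_re K k x" if "x \<in> sphere 0 R" for x
      unfolding u_def hq[OF that] by (simp add: b_def f0_def)
    have \<xi>: "steklov_value K R k = (real k)\<^sup>2 / (2 * h * Q * f1)"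
      by (simp add: steklov_value_def h_def Q_def f1_def)
    show ?thesis
      unfolding steklov_eigenvalue_def fr
    proof (intro exI[of _ u] conjI ballI bexI[of _ x0])
      \<comment> \<open>Nontriviality is tested on the positive first axis, where z is real and
        positive, so that Re z^k = z^k > 0.\<close>
      have "conf_coord K x0 = complex_of_real (conf_factor K x0 * R)"
        by (simp add: conf_coord_def x0_def complex_eq_iff)
      then have "mode_re K k x0 = (conf_factor K x0 * R) ^ k"
        by (simp only: mode_re_def flip: of_real_power) simp
      moreover have "conf_factor K x0 > 0"
        unfolding conf_factor_def
        using x0(1) cball_subset_chart by (intro divide_pos_pos sincK_chart_pos one_plus_cosK_pos) auto
      ultimately show "u x0 \<noteq> 0"
        unfolding ux[OF x0(2)] using pos False R by simp
      fix x :: "real^2"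
      {
        assume "x \<in> cball 0 R"
        then have "x \<in> ?U" using cball_subset_chart by blast
        then show "laplace_beltrami (space_form_metric K) (laplace_beltrami (space_form_metric K) u) x = 0"
          by (simp add: laplace_beltrami_twice llu)
      next
        assume "x \<in> sphere 0 R"
        then have x: "x \<in> ?U" "x \<in> sphere 0 R" using cball_subset_chart by auto
        have "radial K u x = (2 * Q * f1 + real k * (f0 + b)) * mode_re K k x"
          using D'(2)[OF _ x(1)] by (simp add: uD hq[OF x(2)] D_def f0_def f1_def)
        also have "2 * Q * f1 + real k * (f0 + b) = 0"
          using False by (simp add: b_def field_simps)
        finally show "frechet_derivative u (at x) (radial_field x) = 0"
          unfolding steklov_boundary_radial[OF su U(2) x] by simp
        have "radial K (lap K u) x = radial K (mode_re K k) x"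
          unfolding radial_def by (rule deriv_along_cong_open[OF U(1) x(1) lu])
        also have "\<dots> = k * mode_re K k x"
          using mode_derivations[OF U x(1)] by simp
        finally show "frechet_derivative (laplace_beltrami (space_form_metric K) u) (at x) (radial_field x)
            + steklov_value K R k * u x = 0"
          unfolding steklov_boundary_radial[OF su U(2) x] ux[OF x(2)] \<xi> h_def[symmetric]
          using pos False by (simp add: power2_eq_square)
      }
    qed (use sm[OF su] x0 in auto)
  qed
qed

lemma disk_steklov_spectrum_eq: "disk_steklov_spectrum K R = range (steklov_value K R)"
proof
  show "range (steklov_value K R) \<subseteq> disk_steklov_spectrum K R"
    using steklov_value_eigenvalue by (auto simp: disk_steklov_spectrum_def)
  show "disk_steklov_spectrum K R \<subseteq> range (steklov_value K R)"
  proof (rule subsetI, rule ccontr)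
    fix \<xi> assume "\<xi> \<in> disk_steklov_spectrum K R" and \<xi>: "\<xi> \<notin> range (steklov_value K R)"
    then have "steklov_eigenvalue (space_form_metric K) (cball 0 R) radial_field \<xi>"
      by (simp add: disk_steklov_spectrum_def)
    then obtain u where "smooth_near (cball 0 R) u" and nz: "\<exists>x\<in>cball 0 R. u x \<noteq> 0"
      and bih: "\<forall>x\<in>cball 0 R. laplace_beltrami (space_form_metric K) (laplace_beltrami (space_form_metric K) u) x = 0"
      and bd: "\<forall>x\<in>frontier (cball 0 R). frechet_derivative u (at x) (radial_field x) = 0 \<and>
        frechet_derivative (laplace_beltrami (space_form_metric K) u) (at x) (radial_field x) + \<xi> * u x = 0"
      unfolding steklov_eigenvalue_def by blast
    then obtain V where V: "open V" "cball 0 R \<subseteq> V" "\<And>k. Ck_on k V u"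
      by (auto simp: smooth_near_def)
    \<comment> \<open>The given neighbourhood of the disk may extend beyond the chart, on which the
      smoothness of \<open>lap\<close> is established.\<close>
    define U where "U = V \<inter> chart K"
    have U: "cball 0 R \<subseteq> U" "U \<subseteq> chart K" using V cball_subset_chart by (auto simp: U_def)
    have u: "smooth_on_open U u"
      by (rule smooth_on_subset[of V]) (use V open_chart in \<open>auto simp: U_def smooth_on_open_def\<close>)
    have h: "h_fun K R > 0" using R by (intro h_fun_pos)
    have "u x = 0" if "x \<in> cball 0 R" for x
    proof (rule biharmonic_Neumann_unique[OF R u U _ _ _ \<xi> that])
      show "lap K (lap K u) x = 0" if "x \<in> cball 0 R" for x
        using bih that laplace_beltrami_twice[of x u] cball_subset_chart by auto
      fix x :: "real^2" assume x: "x \<in> sphere 0 R"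
      then have xU: "x \<in> U" using U(1) by auto
      have "x \<in> frontier (cball 0 R)" using x R by simp
      with bd have "frechet_derivative u (at x) (radial_field x) = 0"
        "frechet_derivative (laplace_beltrami (space_form_metric K) u) (at x) (radial_field x) + \<xi> * u x = 0"
        by blast+
      then show "radial K u x = 0" "radial K (lap K u) x / h_fun K R + \<xi> * u x = 0"
        unfolding steklov_boundary_radial[OF u U(2) xU x] using h by auto
    qed
    with nz show False by blast
  qed
qed

text \<open>The numerator k^2 increases strictly from 0, while the integral in the denominator does
  not increase, because s^k is nonincreasing in k on [0,1].\<close>

lemma strict_mono_steklov_value: "strict_mono (steklov_value K R)"
proof (rule strict_monoI)
  fix k l :: nat assume kl: "k < l"
  define Q c where "Q = (tan_half K R)\<^sup>2" and "c = 2 * h_fun K R * Q"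
  have "c > 0" using radius_bounds[OF R, of R] R by (auto simp: c_def Q_def)
  have Q: "1 + K * Q > 0"
    unfolding Q_def using h_fun_tan_half(2)[of K R] radius_bounds(1)[OF R, of R] R by simp
  have pos: "profile K n 1 Q > 0" for n by (rule profile_1_pos[OF Q])
  have "profile K l 1 Q \<le> profile K k 1 Q"
  proof -
    have nz: "1 + K * Q * s \<noteq> 0" if "s \<in> {0..1}" for s using one_plus_pos[OF Q that] by simp
    have "integral {0..1} (\<lambda>s. s ^ l / (1 + K * Q * s)\<^sup>2) \<le> integral {0..1} (\<lambda>s. s ^ k / (1 + K * Q * s)\<^sup>2)"
    proof (rule integral_le)
      show "s ^ l / (1 + K * Q * s)\<^sup>2 \<le> s ^ k / (1 + K * Q * s)\<^sup>2" if "s \<in> {0..1}" for s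
        using that kl by (intro divide_right_mono power_decreasing) auto
    qed (use nz in \<open>auto intro!: integrable_continuous_interval continuous_intros\<close>)
    then show ?thesis unfolding profile_def by (simp add: numeral_2_eq_2)
  qed
  then have "(real k)\<^sup>2 / (c * profile K k 1 Q) \<le> (real k)\<^sup>2 / (c * profile K l 1 Q)"
    using pos \<open>c > 0\<close> by (intro divide_left_mono mult_left_mono mult_pos_pos) auto
  also have "\<dots> < (real l)\<^sup>2 / (c * profile K l 1 Q)"
    using pos \<open>c > 0\<close> kl by (intro divide_strict_right_mono power_strict_mono mult_pos_pos) auto
  finally show "steklov_value K R k < steklov_value K R l"
    by (simp add: steklov_value_def c_def Q_def)
qed

lemma steklov_xi_radius_eq: "steklov_xi_radius m K R = steklov_value K R m"
  unfolding steklov_xi_radius_def disk_steklov_spectrum_eq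
  by (rule nth_smallest_range[OF strict_mono_steklov_value])

end

section \<open>Monotonicity in the curvature\<close>

definition half_integral :: "nat \<Rightarrow> real \<Rightarrow> real" where
  "half_integral n y = integral {0..1} (\<lambda>s. s ^ n * (1 - s) * (1 - y) / (1 - y * (1 - s)))"

lemma one_minus_pos:
  fixes y s :: real
  assumes "y < 1" "s \<in> {0..1}"
  shows "1 - y * (1 - s) > 0"
proof (cases "y \<le> 0")
  case True
  then have "y * (1 - s) \<le> 0" using assms(2) by (simp add: mult_le_0_iff)
  then show ?thesis by simp
next
  case False
  then have "y * (1 - s) \<le> y * 1" using assms(2) by (intro mult_left_mono) auto
  then show ?thesis using assms(1) by simp
qed

lemma continuous_on_half_integrand:
  fixes y :: real
  assumes "y < 1"
  shows "continuous_on {0..1} (\<lambda>s. s ^ n * (1 - s) * (1 - y) / (1 - y * (1 - s)))"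
proof -
  have "1 - y * (1 - s) \<noteq> 0" if "s \<in> {0..1}" for s
    using one_minus_pos[OF assms that] by simp
  then show ?thesis by (intro continuous_intros) auto
qed

text \<open>The factor depending on y is (1 - y) / (1 - y (1 - s)) = 1 / (1 + s y / (1 - y)), and y
  / (1 - y) increases for y < 1.\<close>

lemma half_integral_antimono:
  assumes "y \<le> z" "z < 1"
  shows "half_integral n z \<le> half_integral n y"
  unfolding half_integral_def
proof (rule integral_le)
  fix s :: real assume s: "s \<in> {0..1}"
  have p: "1 - y * (1 - s) > 0" "1 - z * (1 - s) > 0"
    using one_minus_pos[OF _ s, of y] one_minus_pos[OF _ s, of z] assms by auto
  have "(1 - y) * (1 - z * (1 - s)) - (1 - z) * (1 - y * (1 - s)) = (z - y) * s"
    by (simp add: algebra_simps)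
  also have "\<dots> \<ge> 0" using s assms by simp
  finally have "(1 - z) / (1 - z * (1 - s)) \<le> (1 - y) / (1 - y * (1 - s))"
    using p by (simp add: frac_le_eq divide_le_0_iff)
  then show "s ^ n * (1 - s) * (1 - z) / (1 - z * (1 - s)) \<le> s ^ n * (1 - s) * (1 - y) / (1 - y * (1 - s))"
    using s mult_left_mono[of "(1 - z) / (1 - z * (1 - s))" "(1 - y) / (1 - y * (1 - s))" "s ^ n * (1 - s)"]
    by simp
qed (use assms in \<open>auto intro!: integrable_continuous_interval continuous_on_half_integrand\<close>)

text \<open>Integration by parts with (1 - s) / (1 - y (1 - s)), whose derivative in s is - 1 / (1 -
  y (1 - s))^2. The boundary terms vanish because of s^(n+1) at 0 and of 1 - s at 1.\<close>

lemma half_integral_parts: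
  assumes y: "y < 1"
  shows "(1 - y) * integral {0..1} (\<lambda>s. s ^ Suc n / (1 - y * (1 - s))\<^sup>2) = Suc n * half_integral n y"
proof -
  let ?d = "\<lambda>s. 1 - y * (1 - s)"
  have pos: "?d s > 0" if "s \<in> {0..1}" for s
    using one_minus_pos[OF y that] .
  have ne: "?d s \<noteq> 0" if "s \<in> {0..1}" for s
    using pos[OF that] by simp
  let ?a = "\<lambda>s. s ^ n * (1 - s) * (1 - y) / ?d s" and ?b = "\<lambda>s. s ^ Suc n / (?d s)\<^sup>2"
  have "((\<lambda>s. Suc n * ?a s - (1 - y) * ?b s) has_integral
      ((1 - y) * (1 ^ Suc n * (1 - 1) / ?d 1) - (1 - y) * (0 ^ Suc n * (1 - 0) / ?d 0))) {0..1}"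
  proof (rule fundamental_theorem_of_calculus)
    fix s :: real assume s: "s \<in> {0..1}"
    have 1: "((\<lambda>s. s ^ Suc n * (1 - s)) has_field_derivative (1 + real n) * s ^ n * (1 - s) - s ^ Suc n)
        (at s within {0..1})"
    proof -
      have "((\<lambda>s. 1 - s) has_field_derivative - 1) (at s within {0..1})"
        by (auto intro!: derivative_eq_intros)
      from DERIV_mult[OF DERIV_power_Suc[OF DERIV_ident, of n] this] show ?thesis
        by (simp add: algebra_simps)
    qed
    have 2: "(?d has_field_derivative y) (at s within {0..1})"
      by (auto intro!: derivative_eq_intros)
    have "((\<lambda>s. (1 - y) * (s ^ Suc n * (1 - s) / ?d s)) has_field_derivative
        (1 - y) * ((((1 + real n) * s ^ n * (1 - s) - s ^ Suc n) * ?d s - s ^ Suc n * (1 - s) * y) / (?d s * ?d s)))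
        (at s within {0..1})"
      by (intro DERIV_cmult DERIV_divide 1 2 ne[OF s])
    moreover have "(1 - y) * ((((1 + real n) * s ^ n * (1 - s) - s ^ Suc n) * ?d s - s ^ Suc n * (1 - s) * y) / (?d s * ?d s))
        = Suc n * ?a s - (1 - y) * ?b s"
    proof -
      have e: "((1 + real n) * s ^ n * (1 - s) - s ^ Suc n) * ?d s - s ^ Suc n * (1 - s) * y =
          (1 + real n) * s ^ n * (1 - s) * ?d s - s ^ Suc n"
        by (simp add: algebra_simps)
      have "w * ((N * a * c * d - b) / (d * d)) = N * (a * c * w / d) - w * (b / d\<^sup>2)"
        if "d \<noteq> 0" for N a b c d w :: real
        using that by (simp add: field_simps power2_eq_square)
      from this[OF ne[OF s]] show ?thesis
        unfolding e by simp
    qed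
    ultimately show "((\<lambda>s. (1 - y) * (s ^ Suc n * (1 - s) / ?d s)) has_vector_derivative
        Suc n * ?a s - (1 - y) * ?b s) (at s within {0..1})"
      by (simp add: has_real_derivative_iff_has_vector_derivative[symmetric])
  qed simp
  then have "integral {0..1} (\<lambda>s. Suc n * ?a s - (1 - y) * ?b s) = 0"
    by (simp add: integral_unique)
  moreover have "integral {0..1} (\<lambda>s. Suc n * ?a s - (1 - y) * ?b s) =
      integral {0..1} (\<lambda>s. Suc n * ?a s) - integral {0..1} (\<lambda>s. (1 - y) * ?b s)"
    using ne by (intro integral_diff integrable_continuous_interval continuous_on_mult_left
        continuous_on_half_integrand[OF y]) (auto intro!: continuous_intros)
  ultimately show ?thesis
    unfolding half_integral_def integral_mult_right by simp
qed

text \<open>In terms of \<open>S = h(R/2)\<^sup>2\<close> and \<open>y = K S\<close> one has \<open>h(R)\<^sup>2 = 4 S (1 - y)\<close> and \<open>q = S / (1 - y)\<close>.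
  The integration by parts above is needed to make the integrand monotone in \<open>y\<close>.\<close>

lemma steklov_value_half:
  assumes R: "0 < R" "ereal R < r_max K"
  defines "S \<equiv> (h_fun K (R / 2))\<^sup>2"
  shows "S > 0" "K * S < 1" "half_integral n (K * S) > 0"
    and "steklov_value K R (Suc n) = Suc n / (4 * (sqrt (S * (1 - K * S)) * S) * half_integral n (K * S))"
proof -
  let ?y = "K * S"
  have "ereal (R / 2) < r_max K"
    by (rule le_less_trans[OF _ R(2)]) (use R in simp)
  then show S: "S > 0" using h_fun_pos[of "R / 2" K] R by (simp add: S_def)
  have c: "1 + c_fun K R = 2 * (1 - ?y)"
    using c_fun_double[of K "R / 2"] by (simp add: S_def)
  then show y: "?y < 1" using c_fun_gt_m1[of R K] R by simp
  have h2: "(h_fun K R)\<^sup>2 = 4 * (S * (1 - ?y))"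
  proof -
    have "1 - ?y = (c_fun K (R / 2))\<^sup>2"
      using c_h_id[of K "R / 2"] by (simp add: S_def)
    then show ?thesis
      using h_fun_double[of K "R / 2"] by (simp add: S_def power_mult_distrib)
  qed
  then have "h_fun K R = sqrt (4 * (S * (1 - ?y)))"
    using h_fun_pos[OF R] by (metis less_imp_le real_sqrt_unique)
  then have h: "h_fun K R = 2 * sqrt (S * (1 - ?y))"
    by (simp add: real_sqrt_mult)
  have Q: "(tan_half K R)\<^sup>2 = S / (1 - ?y)"
  proof -
    have "4 * (S * d) / (2 * d)\<^sup>2 = S / d" if "d > 0" for d
      using that by (simp add: power2_eq_square)
    from this[of "1 - ?y"] show ?thesis
      unfolding tan_half_def power_divide c h2 using y by simp
  qed
  have f1: "profile K (Suc n) 1 (S / (1 - ?y)) =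
      (1 - ?y)\<^sup>2 * integral {0..1} (\<lambda>s. s ^ Suc n / (1 - ?y * (1 - s))\<^sup>2)"
  proof -
    have "profile K (Suc n) 1 (S / (1 - ?y)) = integral {0..1} (\<lambda>s. s ^ Suc n / (1 + K * (S / (1 - ?y)) * s)\<^sup>2)"
      unfolding profile_def by (simp add: numeral_2_eq_2)
    also have "\<dots> = integral {0..1} (\<lambda>s. (1 - ?y)\<^sup>2 * (s ^ Suc n / (1 - ?y * (1 - s))\<^sup>2))"
    proof (rule integral_cong)
      fix s :: real
      have "1 + K * (S / (1 - ?y)) * s = (1 - ?y * (1 - s)) / (1 - ?y)"
        using y by (simp add: field_simps)
      then show "s ^ Suc n / (1 + K * (S / (1 - ?y)) * s)\<^sup>2 = (1 - ?y)\<^sup>2 * (s ^ Suc n / (1 - ?y * (1 - s))\<^sup>2)"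
        by (simp add: power_divide)
    qed
    finally show ?thesis unfolding integral_mult_right .
  qed
  have Qf: "S / (1 - ?y) * profile K (Suc n) 1 (S / (1 - ?y)) = S * (Suc n * half_integral n ?y)"
    unfolding f1 half_integral_parts[OF y, symmetric] using y by (simp add: power2_eq_square)
  have "profile K (Suc n) 1 (S / (1 - ?y)) > 0"
    using h_fun_tan_half(2)[of K R] c_fun_gt_m1[of R K] R unfolding Q[symmetric] by (intro profile_1_pos) simp
  then have "S / (1 - ?y) * profile K (Suc n) 1 (S / (1 - ?y)) > 0" using S y by simp
  then show "half_integral n ?y > 0"
    unfolding Qf using S by (simp add: zero_less_mult_iff)
  have "2 * h_fun K R * (S / (1 - ?y)) * profile K (Suc n) 1 (S / (1 - ?y)) =
      2 * h_fun K R * (S / (1 - ?y) * profile K (Suc n) 1 (S / (1 - ?y)))"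
    by (simp only: mult.assoc)
  then have "steklov_value K R (Suc n) =
      (real (Suc n))\<^sup>2 / (2 * (2 * sqrt (S * (1 - ?y))) * (S * (Suc n * half_integral n ?y)))"
    unfolding steklov_value_def Q Qf h by simp
  moreover have "N\<^sup>2 / (2 * (2 * t) * (S * (N * J))) = N / (4 * (t * S) * J)" if "N \<noteq> 0" for N t J :: real
    using that by (simp add: power2_eq_square mult_ac)
  then have "(real (Suc n))\<^sup>2 / (2 * (2 * sqrt (S * (1 - ?y))) * (S * (Suc n * half_integral n ?y))) =
      Suc n / (4 * (sqrt (S * (1 - ?y)) * S) * half_integral n ?y)"
    by (simp del: of_nat_Suc)
  ultimately show "steklov_value K R (Suc n) = Suc n / (4 * (sqrt (S * (1 - ?y)) * S) * half_integral n ?y)"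
    by simp
qed

text \<open>The common comparison behind both monotonicity claims. Strictness comes from S (1 - y) =
  (h(R)/2)^2; the factors S and \<open>half_integral\<close> contribute weak inequalities.\<close>

lemma steklov_value_less:
  assumes R: "0 < R" "ereal R < r_max K" and T: "0 < T" "ereal T < r_max L"
    and le: "(h_fun L (T / 2))\<^sup>2 \<le> (h_fun K (R / 2))\<^sup>2"
    and less: "K * (h_fun K (R / 2))\<^sup>2 < L * (h_fun L (T / 2))\<^sup>2"
    and m: "m \<ge> 1"
  shows "steklov_value K R m < steklov_value L T m"
proof -
  obtain n where n: "m = Suc n" using m by (cases m) auto
  define S S' y y' where "S = (h_fun K (R / 2))\<^sup>2" and "S' = (h_fun L (T / 2))\<^sup>2"
    and "y = K * S" and "y' = L * S'"
  note 1 = steklov_value_half(1,2)[OF R, folded S_def, folded y_def]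
    steklov_value_half(3,4)[OF R, of n, folded S_def, folded y_def]
  note 2 = steklov_value_half(1,2)[OF T, folded S'_def, folded y'_def]
    steklov_value_half(3,4)[OF T, of n, folded S'_def, folded y'_def]
  have le: "S' \<le> S" and less: "y < y'" using assms by (simp_all add: S_def S'_def y_def y'_def)
  have "S' * (1 - y') < S * (1 - y)"
    using le less 1 2 by (intro mult_le_less_imp_less) auto
  then have "sqrt (S' * (1 - y')) < sqrt (S * (1 - y))" by simp
  then have "sqrt (S' * (1 - y')) * S' < sqrt (S * (1 - y)) * S"
    using le 1 2 by (intro mult_less_le_imp_less) auto
  moreover have "0 < sqrt (S' * (1 - y')) * S'"
    using 2 by simp
  moreover have "half_integral n y' \<le> half_integral n y"
    using less 2(2) by (intro half_integral_antimono) auto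
  ultimately have "4 * (sqrt (S' * (1 - y')) * S') * half_integral n y' <
      4 * (sqrt (S * (1 - y)) * S) * half_integral n y"
    using 2(3) by (intro mult_less_le_imp_less[of "4 * _"]) simp_all
  then show ?thesis
    unfolding n 1(4) 2(4) using 1 2 by (intro divide_strict_left_mono mult_pos_pos) auto
qed

text \<open>Sturm comparison: the Wronskian w = h_K h_L' - h_K' h_L starts at 0 and has derivative -
  (L - K) h_K h_L, which is at most 0. Hence h_K / h_L is nondecreasing, and its limit at 0 is
  1.\<close>

lemma h_fun_antimono:
  assumes "K \<le> L" "0 < r" "ereal r < r_max L"
  shows "h_fun L r \<le> h_fun K r"
proof -
  have sL: "ereal s < r_max L" if "s \<le> r" for s
    by (rule le_less_trans[OF _ assms(3)]) (use that in simp)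
  then have L: "h_fun L s > 0" if "0 < s" "s \<le> r" for s
    using that by (intro h_fun_pos) auto
  have K: "h_fun K s > 0" if "0 < s" "s \<le> r" for s
  proof (rule h_fun_pos[OF that(1)])
    show "ereal s < r_max K"
    proof (cases "K > 0")
      case True
      have "ereal s < r_max L" using sL that by simp
      also have "r_max L \<le> r_max K"
        using True assms(1) by (auto simp: r_max_def intro!: divide_left_mono)
      finally show ?thesis .
    qed (simp add: r_max_def)
  qed
  define w where "w s = h_fun K s * c_fun L s - c_fun K s * h_fun L s" for s
  have dw: "(w has_field_derivative (L - K) * - (h_fun K s * h_fun L s)) (at s)" for s
    unfolding w_def[abs_def]
    by (rule derivative_eq_intros DERIV_h_fun DERIV_c_fun refl)+ (simp add: algebra_simps)
  have w_le: "w s \<le> w 0" if "0 \<le> s" "s \<le> r" for s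
  proof (rule DERIV_nonpos_imp_nonincreasing[OF that(1)])
    fix x assume x: "0 \<le> x" "x \<le> s"
    have "(L - K) * (h_fun K x * h_fun L x) \<ge> 0"
      using x that assms(1) K[of x] L[of x] by (cases "x = 0") (auto simp: less_imp_le)
    then show "\<exists>y. (w has_field_derivative y) (at x) \<and> y \<le> 0" using dw by force
  qed
  \<comment> \<open>The quotient h_K / h_L with the common factor s cancelled, so that it is
    continuous at 0 with value 1.\<close>
  define q where "q s = sincK K (s\<^sup>2) / sincK L (s\<^sup>2)" for s
  have pL: "sincK L (s\<^sup>2) > 0" if "0 \<le> s" "s \<le> r" for s
    using L[of s] that by (cases "s = 0") (auto simp: h_fun_eq_sincK zero_less_mult_iff)
  have "continuous_on {0..r} q"
  proof -
    have "continuous_on UNIV (sincK M)" for M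
      by (rule DERIV_continuous_on, rule has_field_derivative_at_within, rule DERIV_sincK)
    then have "continuous_on {0..r} (\<lambda>s. sincK M (s\<^sup>2))" for M
      by (rule continuous_on_compose2) (auto intro!: continuous_intros)
    then show ?thesis
      unfolding q_def using pL by (intro continuous_on_divide) force+
  qed
  have "q 0 \<le> q r"
  proof (rule DERIV_nonneg_imp_increasing_open[of 0 r q])
    fix s assume s: "0 < s" "s < r"
    have h: "h_fun L s > 0" using L s by simp
    have "((\<lambda>s. h_fun K s / h_fun L s) has_field_derivative - w s / (h_fun L s * h_fun L s)) (at s)"
      using DERIV_divide[OF DERIV_h_fun DERIV_h_fun, of L s K] h by (simp add: w_def)
    moreover have "eventually (\<lambda>s. h_fun K s / h_fun L s = q s) (nhds s)"
      using eventually_nhds_in_open[of "{0<..}" s] s by (auto elim!: eventually_mono simp: q_def h_fun_eq_sincK)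
    ultimately have "(q has_field_derivative - w s / (h_fun L s * h_fun L s)) (at s)"
      using DERIV_cong_ev[OF refl _ refl] by fast
    moreover have "- w s / (h_fun L s * h_fun L s) \<ge> 0"
      using w_le[of s] s h by (intro divide_nonneg_pos) (auto simp: w_def)
    ultimately show "\<exists>y. (q has_field_derivative y) (at s) \<and> 0 \<le> y" by blast
  qed (use assms \<open>continuous_on {0..r} q\<close> in auto)
  then have "sincK L (r\<^sup>2) \<le> sincK K (r\<^sup>2)"
    using pL[of r] assms by (simp add: q_def)
  then show ?thesis using assms by (simp add: h_fun_eq_sincK)
qed

text \<open>K h_K(r)^2 is sin^2(sqrt(K) r), 0 or - sinh^2(sqrt(-K) r), according to the sign of K.
  For L > 0 the bound on 2 r places sqrt(L) r below pi/2, where the sine increases.\<close>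

lemma curvature_h_fun_sq_less:
  assumes "K < L" "0 < r" "ereal (2 * r) < r_max L"
  shows "K * (h_fun K r)\<^sup>2 < L * (h_fun L r)\<^sup>2"
proof (cases L rule: curvature_cases)
  case (pos b)
  have br: "b * r < pi / 2" using assms(3) pos by (simp add: space_form_funs field_simps)
  have sin: "L * (h_fun L r)\<^sup>2 = (sin (b * r))\<^sup>2" using pos by (simp add: space_form_funs power_divide)
  have "sin (b * r) > 0" using pos br assms(2) pi_gt_zero by (intro sin_gt_zero mult_pos_pos) linarith+
  show ?thesis
  proof (cases K rule: curvature_cases)
    case (pos a)
    have "a < b" using assms(1) pos \<open>L = b\<^sup>2\<close> \<open>b > 0\<close> by (simp add: power2_less_imp_less)
    then have "a * r < b * r" using assms(2) by simp
    moreover have "0 < a * r" using pos(1) assms(2) by simp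
    ultimately have "sin (a * r) < sin (b * r)" "0 \<le> sin (a * r)"
      using br by (auto intro!: sin_monotone_2pi sin_ge_zero)
    then have "(sin (a * r))\<^sup>2 < (sin (b * r))\<^sup>2" by (intro power_strict_mono) auto
    then show ?thesis unfolding sin using pos by (simp add: space_form_funs power_divide)
  qed (use sin \<open>sin (b * r) > 0\<close> in \<open>auto intro: le_less_trans[of _ 0]\<close>)
next
  case zero
  then have "K < 0" using assms(1) by simp
  moreover have "h_fun K r > 0" using \<open>K < 0\<close> assms(2) by (intro h_fun_pos) (auto simp: r_max_def)
  ultimately show ?thesis using zero by (simp add: mult_neg_pos)
next
  case (neg b)
  define a where "a = sqrt (- K)"
  have "L < 0" using neg by simp
  then have "K < 0" using assms(1) by linarith
  then have a: "K = - (a\<^sup>2)" "a > 0" by (simp_all add: a_def)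
  have "b < a" using assms(1) neg a by (simp add: power2_less_imp_less)
  then have "sinh (b * r) < sinh (a * r)" "0 \<le> sinh (b * r)" using assms(2) neg by auto
  then have "(sinh (b * r))\<^sup>2 < (sinh (a * r))\<^sup>2" by (intro power_strict_mono) auto
  then show ?thesis using neg a by (simp add: space_form_funs power_divide)
qed

section \<open>Disks of given radius and of given area\<close>

lemma radius_less_r_max:
  assumes "\<rho> > 0" "K < (pi / \<rho>)\<^sup>2"
  shows "ereal \<rho> < r_max K"
proof (cases "K > 0")
  case True
  have "sqrt K < sqrt ((pi / \<rho>)\<^sup>2)" using assms(2) by (rule real_sqrt_less_mono)
  then have "sqrt K < pi / \<rho>" using assms(1) by simp
  then show ?thesis using True assms(1) by (simp add: r_max_def field_simps)
qed (simp add: r_max_def)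

text \<open>The double-angle formula h(r) = 2 h(r/2) h'(r/2) makes 2 h(r/2)^2 a primitive of h, so a
  disk of radius r has area 4 pi h(r/2)^2.\<close>

lemma DERIV_area:
  "((\<lambda>r. 2 * (h_fun K (r / 2))\<^sup>2) has_field_derivative h_fun K r) (at r)"
proof -
  have "((\<lambda>r. r / 2) has_field_derivative 1 / 2) (at r)" by (auto intro!: derivative_eq_intros)
  from DERIV_chain2[OF DERIV_h_fun this]
  have "((\<lambda>r. h_fun K (r / 2)) has_field_derivative c_fun K (r / 2) * (1 / 2)) (at r)" .
  from DERIV_cmult[OF DERIV_power[OF this, of 2], of 2] show ?thesis
    using h_fun_double[of K "r / 2"] by (simp add: mult_ac)
qed

lemma area_integral:
  assumes "0 \<le> R"
  shows "integral {0..R} (h_fun K) = 2 * (h_fun K (R / 2))\<^sup>2"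
proof -
  have "(h_fun K has_integral 2 * (h_fun K (R / 2))\<^sup>2 - 2 * (h_fun K (0 / 2))\<^sup>2) {0..R}"
    by (rule fundamental_theorem_of_calculus[OF assms],
        unfold has_real_derivative_iff_has_vector_derivative[symmetric])
      (rule has_field_derivative_at_within[OF DERIV_area])
  then show ?thesis by (simp add: integral_unique)
qed

text \<open>By \<open>area_integral\<close> the defining condition becomes h(R/2) =
  \<open>\<sigma>\<close>, solved by arcsin, the identity or arsinh. The bound on K says K
  \<sigma>^2 < 1, which for K > 0 puts the argument of arcsin below 1 and R below the antipodal
  distance. Uniqueness holds since the area increases strictly with R.\<close>

lemma radius_of_area:
  assumes A: "A > 0" "K < 4 * pi / A"
  shows "0 < radius_of_area K A" "ereal (radius_of_area K A) < r_max K"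
    and "(h_fun K (radius_of_area K A / 2))\<^sup>2 = A / (4 * pi)"
proof -
  let ?P = "\<lambda>R. 0 < R \<and> ereal R < r_max K \<and> 2 * pi * integral {0..R} (h_fun K) = A"
  have eq: "?P R \<longleftrightarrow> 0 < R \<and> ereal R < r_max K \<and> (h_fun K (R / 2))\<^sup>2 = A / (4 * pi)" for R
    using area_integral[of R K] pi_gt_zero by (auto simp: field_simps)
  define \<sigma> where "\<sigma> = sqrt (A / (4 * pi))"
  have \<sigma>: "\<sigma> > 0" "\<sigma>\<^sup>2 = A / (4 * pi)" using A by (simp_all add: \<sigma>_def)
  have "K * \<sigma>\<^sup>2 < 1" unfolding \<sigma>(2) using A by (simp add: field_simps)
  have "\<exists>r. 0 < r \<and> ereal (2 * r) < r_max K \<and> h_fun K r = \<sigma>"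
  proof (cases K rule: curvature_cases)
    case (pos a)
    have "(a * \<sigma>)\<^sup>2 < 1\<^sup>2" using \<open>K * \<sigma>\<^sup>2 < 1\<close> pos by (simp add: power_mult_distrib)
    then have s: "a * \<sigma> < 1" by (rule power2_less_imp_less) simp
    have s0: "0 < a * \<sigma>" using pos \<sigma> by simp
    have "arcsin 0 < arcsin (a * \<sigma>)" using s s0 by (intro arcsin_less_mono[THEN iffD2]) auto
    moreover have "arcsin (a * \<sigma>) < pi / 2" using arcsin_lt_bounded[of "a * \<sigma>"] s s0 by auto
    moreover have "sin (arcsin (a * \<sigma>)) = a * \<sigma>" using s s0 by (intro sin_arcsin) auto
    ultimately show ?thesis
      using pos by (intro exI[of _ "arcsin (a * \<sigma>) / a"]) (auto simp: space_form_funs field_simps)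
  next
    case zero
    then show ?thesis using \<sigma> by (intro exI[of _ \<sigma>]) (simp add: space_form_funs)
  next
    case (neg a)
    then show ?thesis using \<sigma> by (intro exI[of _ "arsinh (a * \<sigma>) / a"]) (auto simp: space_form_funs)
  qed
  then obtain r where "0 < r" "ereal (2 * r) < r_max K" "h_fun K r = \<sigma>" by blast
  then have ex: "?P (2 * r)" unfolding eq using \<sigma> by simp
  have less: "2 * (h_fun K (R / 2))\<^sup>2 < 2 * (h_fun K (T / 2))\<^sup>2"
    if RT: "0 < R" "R < T" "ereal T < r_max K" for R T
  proof (rule DERIV_pos_imp_increasing[OF RT(2)])
    fix s assume s: "R \<le> s" "s \<le> T"
    have "h_fun K s > 0"
    proof (rule h_fun_pos)
      show "ereal s < r_max K"
        by (rule le_less_trans[OF _ RT(3)]) (use s in simp)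
    qed (use s RT in simp)
    then show "\<exists>y. ((\<lambda>r. 2 * (h_fun K (r / 2))\<^sup>2) has_field_derivative y) (at s) \<and> 0 < y"
      using DERIV_area by blast
  qed
  have uniq: "R = T" if "?P R" "?P T" for R T
    using less[of R T] less[of T R] that unfolding eq by (cases R T rule: linorder_cases) auto
  have "?P (radius_of_area K A)"
    unfolding radius_of_area_def by (rule theI[of ?P, OF ex]) (use uniq ex in blast)
  then show "0 < radius_of_area K A" "ereal (radius_of_area K A) < r_max K"
    "(h_fun K (radius_of_area K A / 2))\<^sup>2 = A / (4 * pi)"
    unfolding eq by auto
qed

theorem corollary11:
  fixes m :: nat
  assumes "m \<ge> 1"
  shows "(\<forall>A::real. A > 0 \<longrightarrow>
            strict_mono_on {..<4 * pi / A} (\<lambda>K. steklov_xi_area m K A)) \<and>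
         (\<forall>\<rho>::real. \<rho> > 0 \<longrightarrow>
            strict_mono_on {..<(pi / \<rho>)\<^sup>2} (\<lambda>K. steklov_xi_radius m K \<rho>))"
proof (intro conjI allI impI)
  fix A :: real assume A: "A > 0"
  show "strict_mono_on {..<4 * pi / A} (\<lambda>K. steklov_xi_area m K A)"
  proof (rule strict_mono_onI)
    fix K L assume "K \<in> {..<4 * pi / A}" "L \<in> {..<4 * pi / A}" and KL: "K < L"
    then have K: "K < 4 * pi / A" "L < 4 * pi / A" by auto
    note RK = radius_of_area[OF A K(1)] and RL = radius_of_area[OF A K(2)]
    show "steklov_xi_area m K A < steklov_xi_area m L A"
      unfolding steklov_xi_area_def steklov_xi_radius_eq[OF RK(1,2)] steklov_xi_radius_eq[OF RL(1,2)]
    proof (rule steklov_value_less[OF RK(1,2) RL(1,2) _ _ assms])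
      \<comment> \<open>Equal areas give equal S = A / (4 pi), so K S and L S compare as K and L
        do.\<close>
      show "K * (h_fun K (radius_of_area K A / 2))\<^sup>2 < L * (h_fun L (radius_of_area L A / 2))\<^sup>2"
        unfolding RK(3) RL(3) using KL A by (intro mult_strict_right_mono) auto
    qed (simp add: RK(3) RL(3))
  qed
next
  fix \<rho> :: real assume \<rho>: "\<rho> > 0"
  show "strict_mono_on {..<(pi / \<rho>)\<^sup>2} (\<lambda>K. steklov_xi_radius m K \<rho>)"
  proof (rule strict_mono_onI)
    fix K L assume "K \<in> {..<(pi / \<rho>)\<^sup>2}" "L \<in> {..<(pi / \<rho>)\<^sup>2}" and KL: "K < L"
    then have K: "ereal \<rho> < r_max K" "ereal \<rho> < r_max L" using radius_less_r_max[OF \<rho>] by auto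
    have half: "ereal (\<rho> / 2) < r_max L"
      by (rule le_less_trans[OF _ K(2)]) (use \<rho> in simp)
    have "h_fun L (\<rho> / 2) > 0" by (rule h_fun_pos[OF _ half]) (use \<rho> in simp)
    moreover have "h_fun L (\<rho> / 2) \<le> h_fun K (\<rho> / 2)"
      using KL \<rho> half by (intro h_fun_antimono) auto
    ultimately have le: "(h_fun L (\<rho> / 2))\<^sup>2 \<le> (h_fun K (\<rho> / 2))\<^sup>2"
      by (intro power_mono) auto
    show "steklov_xi_radius m K \<rho> < steklov_xi_radius m L \<rho>"
      unfolding steklov_xi_radius_eq[OF \<rho> K(1)] steklov_xi_radius_eq[OF \<rho> K(2)]
      by (rule steklov_value_less[OF \<rho> K(1) \<rho> K(2) le curvature_h_fun_sq_less[OF KL] assms])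
        (use \<rho> K in simp_all)
  qed
qed

end
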